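(* Let $N\ge 2$ and $\Omega=\mathbb{R}\times\omega\subset\mathbb{R}^N$, where $\omega\subset\mathbb{R}^{N-1}$ is a bounded connected open set of class $C^1$, and let $n$ denote the outward unit normal on $\partial\Omega$. Let $p\in C^1(\Omega,\mathbb{R})$ and $v\in C^1(\Omega,\mathbb{R}^N)\cap C(\overline{\Omega},\mathbb{R}^N)$ be a solution of either the steady incompressible Euler equations $$v\cdot\nabla v+\nabla p=0\ \text{in }\Omega,\qquad \mathrm{div}\,v=0\ \text{in }\Omega,\qquad v\cdot n=0\ \text{on }\partial\Omega,$$ or the steady incompressible Navier–Stokes equations $$\mu\Delta v+v\cdot\nabla v+\nabla p=0\ \text{in }\Omega,\qquad \mathrm{div}\,v=0\ \text{in }\Omega,\qquad v\cdot n=0\ \text{on }\partial\Omega,$$ for some $\mu>0$ (the latter understood in the weak sense, $v\in W^{2,q}_{loc}(\Omega,\mathbb{R}^N)$ for all $q\in[1,\infty)$). Assume that $v$ is a potential flow, i.e. there exists $\psi\in C^2(\Omega,\mathbb{R})\cap C^1(\overline{\Omega},\mathbb{R})$ with $v=\nabla\psi$ in $\overline{\Omega}$, and that $v$ is away from stagnation, i.e. $\inf_{\overline{\Omega}}|v|>0$. Then there exists $a\in\mathbb{R}\setminus\{0\}$ such that $v=(a,0,\dots,0)$ in $\overline{\Omega}$, and $p$ is constant in $\overline{\Omega}$.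
   Context: $|\cdot|$ denotes the Euclidean norm on $\mathbb{R}^N$ and $x\cdot y$ the Euclidean inner product. *)

theory Defs
  imports "HOL-Analysis.Analysis"
begin

definition has_grad :: "('a::euclidean_space \<Rightarrow> real) \<Rightarrow> 'a \<Rightarrow> 'a \<Rightarrow> bool" where
  "has_grad f x g \<longleftrightarrow> (f has_derivative (\<lambda>h. g \<bullet> h)) (at x)"

definition local_defining_fun ::
  "'a::euclidean_space set \<Rightarrow> 'a \<Rightarrow> 'a set \<Rightarrow> ('a \<Rightarrow> real) \<Rightarrow> ('a \<Rightarrow> 'a) \<Rightarrow> bool" where
  "local_defining_fun \<omega> x U \<phi> \<phi>' \<longleftrightarrow>
     open U \<and> x \<in> U \<and> (\<forall>y\<in>U. has_grad \<phi> y (\<phi>' y)) \<and> continuous_on U \<phi>' \<and>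
     (\<forall>y\<in>U. \<phi>' y \<noteq> 0) \<and> \<omega> \<inter> U = {y\<in>U. \<phi> y < 0}"

definition C1_domain :: "'a::euclidean_space set \<Rightarrow> bool" where
  "C1_domain \<omega> \<longleftrightarrow> open \<omega> \<and>
     (\<forall>x\<in>frontier \<omega>. \<exists>U \<phi> \<phi>'. local_defining_fun \<omega> x U \<phi> \<phi>')"

definition outward_normal :: "'a::euclidean_space set \<Rightarrow> 'a \<Rightarrow> 'a \<Rightarrow> bool" where
  "outward_normal \<omega> x \<nu> \<longleftrightarrow> x \<in> frontier \<omega> \<and>
     (\<exists>U \<phi> \<phi>'. local_defining_fun \<omega> x U \<phi> \<phi>' \<and> \<nu> = (1 / norm (\<phi>' x)) *\<^sub>R \<phi>' x)"

definition div_of :: "'a::euclidean_space \<Rightarrow>\<^sub>L 'a \<Rightarrow> real" where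
  "div_of L = (\<Sum>b\<in>Basis. blinfun_apply L b \<bullet> b)"

definition C1c_test :: "'a::euclidean_space set \<Rightarrow> ('a \<Rightarrow> 'a) \<Rightarrow> ('a \<Rightarrow> 'a \<Rightarrow>\<^sub>L 'a) \<Rightarrow> bool" where
  "C1c_test \<Omega> \<phi> D\<phi> \<longleftrightarrow>
     (\<forall>x. (\<phi> has_derivative blinfun_apply (D\<phi> x)) (at x)) \<and> continuous_on UNIV D\<phi> \<and>
     compact (closure {x. \<phi> x \<noteq> 0}) \<and> closure {x. \<phi> x \<noteq> 0} \<subseteq> \<Omega>"

end

(* The cross-section is the sublevel set {Theta < 0} of one global C1 function, and cutting off with functions of
   Theta turns div v = 0 and v.n = 0 into the weak identity int v.grad phi = 0, for phi of bounded axial support.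

   As |grad psi| >= delta, psi can be raised by any given amount within a bounded distance. A large compact piece of
   the cylinder, being connected, is thereby pushed entirely into one end, so psi is bounded above on the
   opposite half; likewise -psi. The two halves must differ, so psi is bounded below on one half and above on the
   other.

   The cross-sectional means of psi are affine in the axial variable, so this one-sided bound gives linear growth of
   the L1 norm of psi on unit slabs. A Nash inequality combined with the Caccioppoli inequality upgrades this to L2,
   and Caccioppoli gives int |v|^2 = O(n) on the slab of half-width n. The difference psi(x + h e1) - psi(x) solves the
   same problem, its squared L2 norm is O(n), so Caccioppoli makes its energy O(1/n), that is, zero. Hence v does not
   depend on x1, v1 is a constant b, and testing with a cut-off of psi - b x1 kills the transversal part of v. *)
theory Submission
  imports Defs
begin

subsection \<open>Calculus\<close>

text \<open>The obstacle is the boundary. The velocity is differentiable only inside and continuous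
  up to the closure, and the cross-section is merely C1, so neither Gauss' theorem on the cylinder,
  nor a flow of the gradient, nor boundary regularity of harmonic functions is at hand. What
  replaces them survives this low regularity: cut-offs in a boundary layer whose volume is linear in
  its thickness, Euler steps along an inward-tilted field, and estimates in integral norms obtained
  from test functions and translations along interior cones. A harmonic function with Neumann
  condition may grow exponentially along the axis. Absence of stagnation excludes this by giving a
  sign on either half: where \<tau> f >= -C with \<tau> = 1 or -1, one has |f| <= \<tau> f + 2 C, so
  the affine means control the L1 norm. The exponents then close. The squared L2 norm on half-width
  n is of order n slabs times n^2, so n^3. Each Caccioppoli inequality between half-widths n and 2 n
  divides by n^2, and an axial difference is bounded in L2 by the energy. The orders are n^3 for f,
  n for its energy, n for the difference, and 1/n for the energy of the difference.\<close>

lemma has_gradI: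
  "(f has_derivative D) (at x) \<Longrightarrow> (\<And>h. D h = a \<bullet> h) \<Longrightarrow> has_grad f x a"
  unfolding has_grad_def by (erule has_derivative_eq_rhs) auto

lemma has_gradD: "has_grad f x a \<Longrightarrow> (f has_derivative (\<lambda>h. a \<bullet> h)) (at x)"
  unfolding has_grad_def .

lemma has_grad_add:
  "has_grad f x a \<Longrightarrow> has_grad g x b \<Longrightarrow> has_grad (\<lambda>x. f x + g x) x (a + b)"
  unfolding has_grad_def by (auto intro!: derivative_eq_intros simp: inner_add_left)

lemma has_grad_diff:
  "has_grad f x a \<Longrightarrow> has_grad g x b \<Longrightarrow> has_grad (\<lambda>x. f x - g x) x (a - b)"
  unfolding has_grad_def by (auto intro!: derivative_eq_intros simp: inner_diff_left)

lemma has_grad_minus: "has_grad f x a \<Longrightarrow> has_grad (\<lambda>x. - f x) x (- a)"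
  unfolding has_grad_def by (auto intro!: derivative_eq_intros)

lemma has_grad_mult:
  "has_grad f x a \<Longrightarrow> has_grad g x b \<Longrightarrow> has_grad (\<lambda>x. f x * g x) x (f x *\<^sub>R b + g x *\<^sub>R a)"
  unfolding has_grad_def
  by (rule has_derivative_eq_rhs, rule has_derivative_mult) (auto simp: inner_add_left algebra_simps)

lemma has_grad_compose:
  assumes "has_grad f x a" "(h has_real_derivative h') (at (f x))"
  shows "has_grad (\<lambda>x. h (f x)) x (h' *\<^sub>R a)"
proof -
  have "(h has_derivative (\<lambda>t. h' * t)) (at (f x))"
    using assms(2) by (simp add: has_field_derivative_def)
  from has_derivative_compose[OF assms(1)[unfolded has_grad_def] this]
  show ?thesis by (rule has_gradI) simp
qed

lemma has_grad_const: "has_grad (\<lambda>x. c) x 0"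
  by (rule has_gradI[OF has_derivative_const]) simp

lemma has_grad_fst: "has_grad fst x (1, 0)"
  unfolding has_grad_def by (rule has_derivative_eq_rhs, rule has_derivative_fst, rule has_derivative_ident)
    (auto simp: inner_prod_def)

lemma has_grad_snd:
  assumes "has_grad f (snd x) a" shows "has_grad (\<lambda>x. f (snd x)) x (0, a)"
proof -
  have "((\<lambda>x. f (snd x)) has_derivative (\<lambda>h. a \<bullet> snd h)) (at x)"
    using assms unfolding has_grad_def
    by (rule has_derivative_compose[rotated]) (auto intro!: derivative_intros)
  then show ?thesis by (rule has_gradI) (simp add: inner_prod_def)
qed

lemma has_grad_shift:
  assumes "has_grad f (x + d) a" shows "has_grad (\<lambda>x. f (x + d)) x a"
proof -
  have "((\<lambda>x. x + d) has_derivative (\<lambda>h. h)) (at x)" by (auto intro!: derivative_eq_intros)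
  from has_derivative_compose[OF this assms[unfolded has_grad_def]]
  show ?thesis unfolding has_grad_def .
qed

lemma has_grad_continuous: "has_grad f x a \<Longrightarrow> isCont f x"
  unfolding has_grad_def by (rule has_derivative_continuous)

lemma has_grad_line:
  assumes "has_grad f (x + t *\<^sub>R d) a"
  shows "((\<lambda>t. f (x + t *\<^sub>R d)) has_real_derivative a \<bullet> d) (at t)"
proof -
  have "((\<lambda>t. x + t *\<^sub>R d) has_derivative (\<lambda>h. h *\<^sub>R d)) (at t)"
    by (auto intro!: derivative_eq_intros)
  from has_derivative_compose[OF this assms[unfolded has_grad_def]]
  show ?thesis unfolding has_field_derivative_def by (rule has_derivative_eq_rhs) (auto simp: mult.commute)
qed

section \<open>Cut-offs of class C1 built from the positive part\<close>

definition pos_sq :: "real \<Rightarrow> real" where "pos_sq s = (max 0 s)\<^sup>2"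

text \<open>Only the point 0 needs an argument: there the difference quotient is at most |h|^(n-1)
  in absolute value, which tends to 0 because n >= 2. The square serves the C1 cut-offs; the square
  and the cube serve the spline.\<close>

lemma pos_part_power_deriv:
  assumes "n \<ge> 2"
  shows "((\<lambda>s. (max 0 s) ^ n) has_real_derivative real n * (max 0 s) ^ (n - 1)) (at s)"
proof -
  consider "s > 0" | "s < 0" | "s = 0" by linarith
  then show ?thesis
  proof cases
    case 1
    have "((\<lambda>s. s ^ n) has_real_derivative real n * s ^ (n - 1)) (at s)"
      by (auto intro!: derivative_eq_intros)
    then show ?thesis
      using 1 by (subst DERIV_cong_ev[OF refl _ refl, where g = "\<lambda>s. s ^ n"])
        (auto intro!: eventually_mono[OF eventually_gt_at_top] simp: max_def
          eventually_nhds_metric dist_real_def intro!: exI[of _ s])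
  next
    case 2
    have "((\<lambda>s. 0) has_real_derivative 0) (at s)" by simp
    then show ?thesis
      using 2 assms by (subst DERIV_cong_ev[OF refl _ refl, where g = "\<lambda>s. 0"])
        (auto simp: max_def eventually_nhds_metric dist_real_def power_0_left intro!: exI[of _ "- s"])
  next
    case 3
    have "((\<lambda>h::real. (max 0 h) ^ n / h) \<longlongrightarrow> 0) (at 0)"
    proof (rule Lim_null_comparison)
      show "\<forall>\<^sub>F h in at 0. norm ((max 0 h) ^ n / h) \<le> \<bar>h\<bar> ^ (n - 1)"
      proof (rule always_eventually, rule allI)
        fix h :: real
        have "\<bar>h\<bar> ^ n = \<bar>h\<bar> * \<bar>h\<bar> ^ (n - 1)" using assms by (cases n) auto
        moreover have "\<bar>max 0 h ^ n\<bar> \<le> \<bar>h\<bar> ^ n" using power_mono[of "max 0 h" "\<bar>h\<bar>" n] by simp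
        ultimately show "norm ((max 0 h) ^ n / h) \<le> \<bar>h\<bar> ^ (n - 1)"
          by (cases "h = 0") (auto simp: divide_simps mult.commute)
      qed
      have "((\<lambda>h::real. \<bar>h\<bar> ^ (n - 1)) \<longlongrightarrow> \<bar>0\<bar> ^ (n - 1)) (at 0)" by (intro tendsto_intros)
      then show "((\<lambda>h::real. \<bar>h\<bar> ^ (n - 1)) \<longlongrightarrow> 0) (at 0)" using assms by (simp add: power_0_left)
    qed
    moreover have "(\<lambda>h. (max 0 (s + h) ^ n - max 0 s ^ n) / h) = (\<lambda>h. (max 0 h) ^ n / h)"
      "real n * max 0 s ^ (n - 1) = 0"
      using 3 assms by (auto simp: power_0_left)
    ultimately show ?thesis by (simp only: DERIV_def)
  qed
qed

lemma pos_sq_deriv: "(pos_sq has_real_derivative 2 * max 0 s) (at s)"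
  using pos_part_power_deriv[of 2 s] by (simp add: pos_sq_def[abs_def])

text \<open>On [0, 1] this is 1 - (1 - s^2)^2, a transition from 0 to 1. Squaring a positive part
  once from each end makes both joints C1.\<close>

definition step :: "real \<Rightarrow> real" where "step s = 1 - pos_sq (1 - pos_sq s)"
definition step' :: "real \<Rightarrow> real" where "step' s = 4 * max 0 (1 - pos_sq s) * max 0 s"

lemma step_deriv: "(step has_real_derivative step' s) (at s)"
proof -
  have "((\<lambda>s. 1 - pos_sq (1 - pos_sq s)) has_real_derivative
      0 - 2 * max 0 (1 - pos_sq s) * (0 - 2 * max 0 s)) (at s)"
    by (rule DERIV_diff[OF DERIV_const DERIV_chain2[OF pos_sq_deriv DERIV_diff[OF DERIV_const pos_sq_deriv]]])
  then show ?thesis by (simp add: step_def[abs_def] step'_def mult.assoc)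
qed

lemma continuous_pos_sq [continuous_intros]:
  "continuous_on S f \<Longrightarrow> continuous_on S (\<lambda>x. pos_sq (f x))"
  unfolding pos_sq_def by (intro continuous_intros)
lemma continuous_step [continuous_intros]:
  "continuous_on S f \<Longrightarrow> continuous_on S (\<lambda>x. step (f x))"
  unfolding step_def by (intro continuous_intros)
lemma continuous_step' [continuous_intros]:
  "continuous_on S f \<Longrightarrow> continuous_on S (\<lambda>x. step' (f x))"
  unfolding step'_def by (intro continuous_intros)

lemma pos_sq_nonneg: "0 \<le> pos_sq s" by (simp add: pos_sq_def)
lemma pos_sq_pos: "0 < s \<Longrightarrow> 0 < pos_sq s" by (simp add: pos_sq_def)
lemma pos_sq_eq_0: "s \<le> 0 \<Longrightarrow> pos_sq s = 0" by (simp add: pos_sq_def)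

lemma step_eq_0: "s \<le> 0 \<Longrightarrow> step s = 0" by (simp add: step_def pos_sq_def)
lemma step_eq_1: "s \<ge> 1 \<Longrightarrow> step s = 1"
  by (auto simp: step_def pos_sq_def max_def power2_eq_square) (metis mult_mono' mult_1 zero_le_one antisym)
lemma step_bounds: "0 \<le> step s" "step s \<le> 1"
  unfolding step_def by (auto simp: pos_sq_def power_le_one)
lemma step'_eq_0: "s \<le> 0 \<Longrightarrow> step' s = 0" by (simp add: step'_def)
lemma step'_eq_0': assumes "s \<ge> 1" shows "step' s = 0"
proof -
  have "pos_sq s \<ge> 1" using assms by (simp add: pos_sq_def max_def one_le_power)
  then show ?thesis by (simp add: step'_def)
qed
lemma step'_nonneg: "0 \<le> step' s" by (simp add: step'_def)
lemma step'_le: "step' s \<le> 4"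
proof (cases "s \<ge> 1")
  case True then show ?thesis using step'_eq_0' by simp
next
  case False
  have "max 0 (1 - pos_sq s) * max 0 s \<le> 1 * 1"
    using False pos_sq_nonneg[of s] by (intro mult_mono) auto
  then show ?thesis by (simp add: step'_def)
qed

subsection \<open>Local-to-global on compact sets\<close>

text \<open>A finite subcover packaged as an induction principle. It glues every local construction
  below without a separate covering argument: the defining function, the volume of the boundary
  layer, the common length of Euler steps, and the Nash constant.\<close>

lemma compact_local_induct:
  assumes K: "compact K" and local: "\<And>x. x \<in> K \<Longrightarrow> \<exists>U. open U \<and> x \<in> U \<and> P U"
    and Un: "\<And>A B. P A \<Longrightarrow> P B \<Longrightarrow> P (A \<union> B)"
    and mono: "\<And>A B. P B \<Longrightarrow> A \<subseteq> B \<Longrightarrow> P A" and empty: "P {}"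
  shows "P K"
proof -
  have "K \<subseteq> \<Union>{U. open U \<and> P U}" using local by blast
  then obtain \<C> where C: "\<C> \<subseteq> {U. open U \<and> P U}" "finite \<C>" "K \<subseteq> \<Union>\<C>"
    using compactE[OF K, of "{U. open U \<and> P U}"] by (metis (no_types, lifting) mem_Collect_eq)
  have "P (\<Union>\<D>)" if "\<D> \<subseteq> \<C>" for \<D>
    using finite_subset[OF that C(2)] that
    by (induction rule: finite_induct) (use C(1) Un empty in auto)
  from mono[OF this[OF order_refl] C(3)] show ?thesis .
qed

lemma continuous_compact_bound:
  fixes f :: "'a::topological_space \<Rightarrow> 'b::real_normed_vector"
  assumes "compact K" "continuous_on K f"
  shows "\<exists>B\<ge>0. \<forall>x\<in>K. norm (f x) \<le> B"
proof -
  have "bounded (f ` K)" using assms compact_continuous_image compact_imp_bounded by blast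
  then obtain B where "\<forall>y\<in>f ` K. norm y \<le> B" unfolding bounded_iff by blast
  then have "\<forall>x\<in>K. norm (f x) \<le> max B 0" by (auto simp: le_max_iff_disj)
  then show ?thesis by (metis max.cobounded2)
qed

subsection \<open>Integration\<close>

lemma lborel_integral_shift:
  fixes f :: "'a::euclidean_space \<Rightarrow> real"
  assumes "f \<in> borel_measurable borel"
  shows "integral\<^sup>L lborel (\<lambda>x. f (x + d)) = integral\<^sup>L lborel f"
proof -
  have "integral\<^sup>L lborel f = integral\<^sup>L (distr lborel borel ((+) d)) f"
    by (simp add: lborel_distr_plus)
  also have "\<dots> = integral\<^sup>L lborel (\<lambda>x. f (d + x))"
    using assms by (subst integral_distr) auto
  finally show ?thesis by (simp add: add.commute)
qed

lemma lborel_nn_integral_shift: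
  fixes f :: "'a::euclidean_space \<Rightarrow> ennreal"
  assumes "f \<in> borel_measurable borel"
  shows "integral\<^sup>N lborel (\<lambda>x. f (x + d)) = integral\<^sup>N lborel f"
proof -
  have "integral\<^sup>N lborel f = integral\<^sup>N (distr lborel borel ((+) d)) f"
    by (simp add: lborel_distr_plus)
  also have "\<dots> = integral\<^sup>N lborel (\<lambda>x. f (d + x))"
    using assms by (subst nn_integral_distr) auto
  finally show ?thesis by (simp add: add.commute)
qed

lemma integrable_bounded_support:
  fixes f :: "'a::euclidean_space \<Rightarrow> real"
  assumes "f \<in> borel_measurable borel" "\<And>x. \<bar>f x\<bar> \<le> B" "bounded S" "\<And>x. x \<notin> S \<Longrightarrow> f x = 0"
  shows "integrable lborel f"
proof -
  obtain r where r: "S \<subseteq> cball 0 r" using bounded_subset_ballD[OF assms(3), of 0] ball_subset_cball by blast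
  have "integrable lborel (\<lambda>x::'a. indicator (cball 0 r) x * B)"
    by (intro integrable_mult_left integrable_real_indicator) (use emeasure_bounded_finite[OF bounded_cball] in auto)
  then show ?thesis
  proof (rule Bochner_Integration.integrable_bound)
    show "f \<in> borel_measurable lborel" using assms(1) by simp
    show "AE x in lborel. norm (f x) \<le> norm (indicator (cball 0 r) x * B)"
    proof (rule AE_I2)
      fix x show "norm (f x) \<le> norm (indicator (cball 0 r) x * B)"
        using assms(2)[of x] assms(4)[of x] subsetD[OF r, of x] by (cases "x \<in> cball 0 r") auto
    qed
  qed
qed

text \<open>Difference quotients in direction \<open>b\<close> integrate to zero by translation
  invariance of Lebesgue measure, and they converge to the derivative while staying dominated by the
  Lipschitz bound on one ball. The derivative has to be bounded, not continuous; it is measurable as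
  a limit of the quotients.\<close>

lemma integral_derivative_zero:
  fixes f :: "'a::euclidean_space \<Rightarrow> real"
  assumes D: "\<And>x. (f has_derivative f' x) (at x)" and L: "\<And>x h. \<bar>f' x h\<bar> \<le> L * norm h"
    and S: "bounded S" "\<And>x. x \<notin> S \<Longrightarrow> f x = 0"
  shows "integrable lborel (\<lambda>x. f' x b)" "integral\<^sup>L lborel (\<lambda>x. f' x b) = 0"
proof -
  define q where "q = (\<lambda>n x. real (Suc n) * (f (x + (1 / real (Suc n)) *\<^sub>R b) - f x))"
  obtain r where r: "S \<subseteq> cball 0 r" using bounded_subset_ballD[OF S(1), of 0] ball_subset_cball by blast
  have cont: "continuous_on UNIV f"
    using D has_derivative_continuous continuous_at_imp_continuous_on by blast
  have fm: "f \<in> borel_measurable borel" using cont by (rule borel_measurable_continuous_onI)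
  have "continuous_on (cball 0 r) f" using cont continuous_on_subset by blast
  then obtain B where B: "\<And>x. x \<in> cball 0 r \<Longrightarrow> \<bar>f x\<bar> \<le> B"
    using continuous_compact_bound[OF compact_cball, of 0 r f] by (metis real_norm_def)
  have Bf: "\<bar>f x\<bar> \<le> max B 0" for x using B[of x] S(2)[of x] subsetD[OF r, of x]
    by (cases "x \<in> cball 0 r") (auto simp: le_max_iff_disj)
  have int: "integrable lborel f"
    by (rule integrable_bounded_support[OF fm Bf S])
  have fm': "(\<lambda>x. f (x + d)) \<in> borel_measurable borel" for d
    using fm by measurable
  have Bf': "integrable lborel (\<lambda>x. f (x + d))" for d
  proof (rule integrable_bounded_support[OF fm' Bf])
    show "bounded ((\<lambda>x. x - d) ` S)" using S(1) by (rule bounded_translation_minus)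
    show "f (x + d) = 0" if "x \<notin> (\<lambda>x. x - d) ` S" for x
      using that S(2)[of "x + d"] by (metis add_diff_cancel_right' image_eqI)
  qed
  have lip: "\<bar>f (x + d) - f x\<bar> \<le> L * norm d" for x d
  proof -
    have D': "((\<lambda>t. f (x + t *\<^sub>R d)) has_derivative (\<lambda>h. f' (x + t *\<^sub>R d) (h *\<^sub>R d))) (at t)" for t
      by (rule has_derivative_compose[of "\<lambda>t. x + t *\<^sub>R d" "\<lambda>h. h *\<^sub>R d" t UNIV f, OF _ D])
        (auto intro!: derivative_eq_intros)
    have "\<exists>t\<in>{0<..<1}. f (x + 1 *\<^sub>R d) - f (x + 0 *\<^sub>R d) = f' (x + t *\<^sub>R d) ((1 - 0) *\<^sub>R d)"
      by (rule mvt_simple) (auto intro!: has_derivative_at_withinI[OF D'])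
    then show ?thesis using L by auto
  qed
  have q0: "integral\<^sup>L lborel (q n) = 0" for n
    unfolding q_def using Bf' int lborel_integral_shift[OF fm] by simp
  have lim: "(\<lambda>n. q n x) \<longlonglongrightarrow> f' x b" for x
  proof -
    have "((\<lambda>t. f (x + t *\<^sub>R b)) has_derivative (\<lambda>h. f' x (h *\<^sub>R b))) (at 0)"
      using D[of x] by (intro has_derivative_compose[of "\<lambda>t. x + t *\<^sub>R b" "\<lambda>h. h *\<^sub>R b" 0 UNIV f "f' x"])
        (auto intro!: derivative_eq_intros)
    moreover have "f' x (h *\<^sub>R b) = f' x b * h" for h
      using linear_cmul[OF has_derivative_linear[OF D[of x]], of h b] by simp
    ultimately have "((\<lambda>t. f (x + t *\<^sub>R b)) has_real_derivative f' x b) (at 0)"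
      by (simp add: has_field_derivative_def)
    then have "((\<lambda>t. (f (x + t *\<^sub>R b) - f x) / t) \<longlongrightarrow> f' x b) (at 0)"
      by (simp add: DERIV_def)
    moreover have "filterlim (\<lambda>n. 1 / real (Suc n)) (at 0) sequentially"
      using LIMSEQ_inverse_real_of_nat by (intro filterlim_atI) (auto simp: inverse_eq_divide)
    ultimately have "(\<lambda>n. (f (x + (1 / real (Suc n)) *\<^sub>R b) - f x) / (1 / real (Suc n))) \<longlonglongrightarrow> f' x b"
      by (rule filterlim_compose)
    then show ?thesis by (simp add: q_def mult.commute)
  qed
  have qm: "q n \<in> borel_measurable borel" for n unfolding q_def using fm' fm by measurable
  \<comment> \<open>The increments are \<open>b\<close> divided by \<open>Suc n\<close>, hence no
    longer than \<open>b\<close>: all quotients vanish outside one enlarged ball, and a single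
    integrable function dominates them.\<close>
  have dom: "AE x in lborel. norm (q n x) \<le> indicator (cball 0 (r + norm b)) x * (L * norm b)" for n
  proof (rule AE_I2)
    fix x
    have "\<bar>q n x\<bar> \<le> real (Suc n) * (L * norm ((1 / real (Suc n)) *\<^sub>R b))"
      unfolding q_def abs_mult using lip[of x "(1 / real (Suc n)) *\<^sub>R b"] by (intro mult_mono) auto
    then have 1: "\<bar>q n x\<bar> \<le> L * norm b" by simp
    have "q n x = 0" if "x \<notin> cball 0 (r + norm b)"
    proof -
      let ?d = "(1 / real (Suc n)) *\<^sub>R b"
      have "norm ?d \<le> norm b" by (simp add: divide_simps) (simp add: algebra_simps)
      moreover have "norm x \<le> norm (x + ?d) + norm ?d"
        using norm_triangle_ineq[of "x + ?d" "- ?d"] by (simp del: scaleR_left.minus)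
      ultimately have "x + ?d \<notin> cball 0 r" using that by (simp del: norm_scaleR)
      then have "x + ?d \<notin> S" using r by blast
      moreover have "x \<notin> S"
      proof
        assume "x \<in> S"
        then have "norm x \<le> r" using r by auto
        then show False using that norm_ge_zero[of b] by (simp del: norm_ge_zero)
      qed
      ultimately show ?thesis using S(2) by (simp add: q_def)
    qed
    with 1 show "norm (q n x) \<le> indicator (cball 0 (r + norm b)) x * (L * norm b)"
      by (auto simp: indicator_def)
  qed
  have dint: "integrable lborel (\<lambda>x. indicator (cball 0 (r + norm b)) x * (L * norm b))"
    by (intro integrable_mult_left integrable_real_indicator) (use emeasure_bounded_finite[OF bounded_cball] in auto)
  have lm: "(\<lambda>x. f' x b) \<in> borel_measurable lborel"
    by (rule borel_measurable_LIMSEQ_real[OF lim]) (use qm in auto)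
  show "integrable lborel (\<lambda>x. f' x b)"
    by (rule integrable_dominated_convergence[where s = q, OF lm _ dint _ dom]) (use qm lim in auto)
  have "(\<lambda>n. integral\<^sup>L lborel (q n)) \<longlonglongrightarrow> integral\<^sup>L lborel (\<lambda>x. f' x b)"
    by (rule integral_dominated_convergence[OF lm _ dint _ dom]) (use qm lim in auto)
  then show "integral\<^sup>L lborel (\<lambda>x. f' x b) = 0" by (simp add: q0 LIMSEQ_const_iff)
qed

subsection \<open>A global defining function\<close>

lemma local_defining_fun_iff:
  "local_defining_fun \<omega> x U \<phi> \<phi>' \<Longrightarrow> y \<in> U \<Longrightarrow> y \<in> \<omega> \<longleftrightarrow> \<phi> y < 0"
  unfolding local_defining_fun_def by blast

text \<open>The value is nonnegative because y lies outside the open set, and nonpositive as a limit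
  of values at points of the set within U.\<close>

lemma local_defining_fun_frontier_zero:
  assumes L: "local_defining_fun \<omega> x U \<phi> \<phi>'" and y: "y \<in> U" "y \<in> frontier \<omega>" and op: "open \<omega>"
  shows "\<phi> y = 0"
proof -
  have U: "open U" "has_grad \<phi> y (\<phi>' y)" using L y(1) unfolding local_defining_fun_def by blast+
  have "y \<notin> \<omega>" using y op by (simp add: frontier_def interior_open)
  then have "\<phi> y \<ge> 0" using local_defining_fun_iff[OF L y(1)] by simp
  moreover have "y \<in> closure (\<omega> \<inter> U)"
    using y U(1) open_Int_closure_subset[of U \<omega>] by (auto simp: frontier_def Int_commute)
  then obtain f where f: "\<And>n. f n \<in> \<omega> \<inter> U" "f \<longlonglongrightarrow> y"
    using closure_sequential by blast
  have lim: "(\<lambda>n. \<phi> (f n)) \<longlonglongrightarrow> \<phi> y"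
    using f(2) has_grad_continuous[OF U(2)] by (rule isCont_tendsto_compose[rotated])
  have "\<phi> (f n) \<le> 0" for n using f(1)[of n] local_defining_fun_iff[OF L] by force
  then have "\<phi> y \<le> 0" using lim by (intro LIMSEQ_le_const2) auto
  ultimately show ?thesis by simp
qed

text \<open>If the product were not positive, the difference \<open>d\<close> of the two unit
  gradients would strictly decrease one function and strictly increase the other, so that y + h d
  would lie inside by one criterion and outside by the other. Positivity, weaker than parallelism,
  is what later prevents cancellation when local functions are added.\<close>

lemma outward_normals_agree:
  assumes y: "y \<in> frontier \<omega>"
    and 1: "local_defining_fun \<omega> x1 U1 \<phi>1 \<phi>1'" "y \<in> U1"
    and 2: "local_defining_fun \<omega> x2 U2 \<phi>2 \<phi>2'" "y \<in> U2"
    and op: "open \<omega>"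
  shows "\<phi>1' y \<bullet> \<phi>2' y > 0"
proof (rule ccontr)
  let ?a = "\<phi>1' y" and ?b = "\<phi>2' y"
  assume neg: "\<not> ?a \<bullet> ?b > 0"
  have D: "open U1" "open U2" "has_grad \<phi>1 y ?a" "has_grad \<phi>2 y ?b" "?a \<noteq> 0" "?b \<noteq> 0"
    using 1 2 unfolding local_defining_fun_def by auto
  have z12: "\<phi>1 y = 0" "\<phi>2 y = 0"
    using local_defining_fun_frontier_zero[OF 1 y op] local_defining_fun_frontier_zero[OF 2 y op] by auto
  define d where "d = ?b /\<^sub>R norm ?b - ?a /\<^sub>R norm ?a"
  have ad: "?a \<bullet> d < 0"
  proof -
    have "?a \<bullet> d = (?a \<bullet> ?b) / norm ?b - norm ?a"
      using D by (simp add: d_def inner_diff_right dot_square_norm power2_eq_square divide_inverse)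
    moreover have "(?a \<bullet> ?b) / norm ?b \<le> 0" using neg by (simp add: divide_nonpos_nonneg)
    ultimately show ?thesis using D by (smt (verit) zero_less_norm_iff)
  qed
  have bd: "?b \<bullet> d > 0"
  proof -
    have "?b \<bullet> d = norm ?b - (?a \<bullet> ?b) / norm ?a"
      using D by (simp add: d_def inner_diff_right dot_square_norm power2_eq_square divide_inverse inner_commute)
    moreover have "(?a \<bullet> ?b) / norm ?a \<le> 0" using neg by (simp add: divide_nonpos_nonneg)
    ultimately show ?thesis using D by (smt (verit) zero_less_norm_iff)
  qed
  have d1: "((\<lambda>t. \<phi>1 (y + t *\<^sub>R d)) has_real_derivative ?a \<bullet> d) (at 0)"
    by (rule has_grad_line) (use D in simp)
  have d2: "((\<lambda>t. \<phi>2 (y + t *\<^sub>R d)) has_real_derivative ?b \<bullet> d) (at 0)"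
    by (rule has_grad_line) (use D in simp)
  obtain e1 where e1: "e1 > 0" "\<And>h. 0 < h \<Longrightarrow> h < e1 \<Longrightarrow> \<phi>1 (y + h *\<^sub>R d) < 0"
    using DERIV_neg_dec_right[OF d1 ad] z12 by auto
  obtain e2 where e2: "e2 > 0" "\<And>h. 0 < h \<Longrightarrow> h < e2 \<Longrightarrow> \<phi>2 (y + h *\<^sub>R d) > 0"
    using DERIV_pos_inc_right[OF d2 bd] z12 by auto
  have "isCont (\<lambda>t. y + t *\<^sub>R d) 0" by (intro continuous_intros)
  then have "\<forall>\<^sub>F t in nhds 0. y + t *\<^sub>R d \<in> U1 \<inter> U2"
    using D 1 2 by (intro topological_tendstoD) (auto simp: isCont_def tendsto_nhds_iff)
  then obtain e3 where e3: "e3 > 0" "\<And>t. \<bar>t\<bar> < e3 \<Longrightarrow> y + t *\<^sub>R d \<in> U1 \<inter> U2"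
    unfolding eventually_nhds_metric by (auto simp: dist_real_def)
  define h where "h = Min {e1, e2, e3} / 2"
  have "h > 0" "h < e1" "h < e2" "h < e3" using e1 e2 e3 by (auto simp: h_def min_def)
  then have "y + h *\<^sub>R d \<in> U1 \<inter> U2" "\<phi>1 (y + h *\<^sub>R d) < 0" "\<phi>2 (y + h *\<^sub>R d) > 0"
    using e1 e2 e3 by auto
  then show False
    using local_defining_fun_iff[OF 1(1)] local_defining_fun_iff[OF 2(1)] by fastforce
qed

text \<open>Stands for being a nonnegative multiple of the outward normal, in a form that spares a
  proof that the normal is unique. The first clause keeps sums from cancelling; the second transfers
  the slip condition from normals to the gradient under construction. Both are stable under
  addition.\<close>

definition outward_or_zero :: "'a::euclidean_space set \<Rightarrow> 'a \<Rightarrow> 'a \<Rightarrow> bool" where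
  "outward_or_zero \<omega> y u \<longleftrightarrow>
     (u = 0 \<or> (\<forall>U \<phi> \<phi>'. local_defining_fun \<omega> y U \<phi> \<phi>' \<longrightarrow> u \<bullet> \<phi>' y > 0)) \<and>
     (\<forall>w. (\<forall>\<nu>. outward_normal \<omega> y \<nu> \<longrightarrow> w \<bullet> \<nu> = 0) \<longrightarrow> w \<bullet> u = 0)"

lemma outward_or_zero_scale_gradient:
  assumes y: "y \<in> frontier \<omega>" and L: "local_defining_fun \<omega> y U \<phi> \<phi>'" and c: "c > 0" and op: "open \<omega>"
  shows "outward_or_zero \<omega> y (c *\<^sub>R \<phi>' y)"
proof -
  have yU: "y \<in> U2" if "local_defining_fun \<omega> y U2 \<phi>2 \<phi>2'" for U2 \<phi>2 \<phi>2'
    using that unfolding local_defining_fun_def by blast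
  have "w \<bullet> (c *\<^sub>R \<phi>' y) = 0" if "\<forall>\<nu>. outward_normal \<omega> y \<nu> \<longrightarrow> w \<bullet> \<nu> = 0" for w
  proof -
    have "outward_normal \<omega> y ((1 / norm (\<phi>' y)) *\<^sub>R \<phi>' y)"
      unfolding outward_normal_def using y L by blast
    then have "w \<bullet> ((1 / norm (\<phi>' y)) *\<^sub>R \<phi>' y) = 0" using that by blast
    then show ?thesis using L unfolding local_defining_fun_def by auto
  qed
  moreover have "(c *\<^sub>R \<phi>' y) \<bullet> \<phi>2' y > 0" if "local_defining_fun \<omega> y U2 \<phi>2 \<phi>2'" for U2 \<phi>2 \<phi>2'
    using outward_normals_agree[OF y L yU[OF L] that yU[OF that] op] c by simp
  ultimately show ?thesis unfolding outward_or_zero_def by blast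
qed

lemma outward_or_zero_add:
  assumes "outward_or_zero \<omega> y u" "outward_or_zero \<omega> y w" and L: "local_defining_fun \<omega> y U \<phi> \<phi>'"
  shows "outward_or_zero \<omega> y (u + w)" "u + w = 0 \<Longrightarrow> u = 0 \<and> w = 0"
proof -
  show 1: "u + w = 0 \<Longrightarrow> u = 0 \<and> w = 0"
    using assms unfolding outward_or_zero_def
    by (metis add.right_neutral add_cancel_left_left add_pos_pos inner_add_left inner_zero_left less_irrefl)
  show "outward_or_zero \<omega> y (u + w)"
  proof (cases "u = 0 \<or> w = 0")
    case True then show ?thesis using assms by auto
  next
    case False
    then show ?thesis using assms(1,2) unfolding outward_or_zero_def
      by (simp add: inner_add_left inner_add_right add_pos_pos)
  qed
qed

lemma bump_exists:
  fixes x :: "'a::euclidean_space"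
  assumes r: "r > 0"
  obtains \<beta> \<beta>' where "\<And>y. has_grad \<beta> y (\<beta>' y)" "continuous_on UNIV \<beta>'"
    "\<And>y. \<beta> y \<ge> 0" "\<And>y. y \<in> ball x r \<Longrightarrow> \<beta> y > 0" "\<And>y. dist x y \<ge> r \<Longrightarrow> \<beta> y = 0 \<and> \<beta>' y = 0"
proof
  let ?\<beta> = "\<lambda>y. pos_sq (r\<^sup>2 - (norm (y - x))\<^sup>2)"
  let ?\<beta>' = "\<lambda>y. (2 * max 0 (r\<^sup>2 - (norm (y - x))\<^sup>2)) *\<^sub>R (- 2 *\<^sub>R (y - x))"
  show "has_grad ?\<beta> y (?\<beta>' y)" for y
  proof -
    have "has_grad (\<lambda>y. r\<^sup>2 - (norm (y - x))\<^sup>2) y (- 2 *\<^sub>R (y - x))"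
      unfolding power2_norm_eq_inner
      by (rule has_gradI, (rule derivative_eq_intros | simp)+) (simp add: inner_commute)
    from has_grad_compose[OF this pos_sq_deriv] show ?thesis .
  qed
  show "continuous_on UNIV ?\<beta>'" by (intro continuous_intros)
  show "?\<beta> y \<ge> 0" for y by (simp add: pos_sq_nonneg)
  show "?\<beta> y > 0" if "y \<in> ball x r" for y
    using that by (auto intro!: pos_sq_pos power_strict_mono simp: dist_norm norm_minus_commute)
  show "?\<beta> y = 0 \<and> ?\<beta>' y = 0" if "dist x y \<ge> r" for y
  proof -
    have "r\<^sup>2 \<le> (norm (y - x))\<^sup>2" using r that by (intro power_mono) (auto simp: dist_norm norm_minus_commute)
    then show ?thesis by (simp add: pos_sq_eq_0)
  qed
qed

text \<open>Local defining functions are cut off and extended by zero; near interior points the constant -1 plays their role.\<close>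

lemma local_datum:
  assumes C1: "C1_domain \<omega>" and x: "x \<in> closure \<omega>"
  shows "\<exists>V \<theta> \<theta>'. open V \<and> x \<in> V \<and> (\<forall>y. has_grad \<theta> y (\<theta>' y)) \<and> continuous_on UNIV \<theta>' \<and>
     (\<forall>y. y \<in> \<omega> \<longrightarrow> \<theta> y \<le> 0) \<and> (\<forall>y. y \<notin> \<omega> \<longrightarrow> \<theta> y \<ge> 0) \<and> (\<forall>y\<in>\<omega> \<inter> V. \<theta> y < 0) \<and>
     (\<forall>y\<in>frontier \<omega>. outward_or_zero \<omega> y (\<theta>' y)) \<and>
     (\<forall>y\<in>frontier \<omega> \<inter> V. \<theta>' y \<noteq> 0)"
proof -
  have op: "open \<omega>" using C1 by (simp add: C1_domain_def)
  show ?thesis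
  proof (cases "x \<in> \<omega>")
    case True
    then obtain r where r: "r > 0" "ball x r \<subseteq> \<omega>" using op open_contains_ball by blast
    define V where "V = ball x r"
    obtain \<beta> \<beta>' where b: "open V" "x \<in> V" "\<And>y. has_grad \<beta> y (\<beta>' y)"
      "continuous_on UNIV \<beta>'" "\<And>y. \<beta> y \<ge> 0" "\<And>y. y \<in> V \<Longrightarrow> \<beta> y > 0"
      "\<And>y. dist x y \<ge> r \<Longrightarrow> \<beta> y = 0 \<and> \<beta>' y = 0"
      using bump_exists[OF r(1), of x] r(1) unfolding V_def by (metis centre_in_ball open_ball)
    have out: "\<beta> y = 0 \<and> \<beta>' y = 0" if "y \<notin> \<omega>" for y
      using that r(2) b(7)[of y] by (meson in_mono mem_ball not_le)
    have fr: "y \<notin> \<omega>" if "y \<in> frontier \<omega>" for y using that op by (simp add: frontier_def interior_open)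
    have "y \<notin> V" if "y \<notin> \<omega>" for y using out[OF that] b(6)[of y] by auto
    then show ?thesis
      using b fr out
      by (intro exI[of _ V] exI[of _ "\<lambda>y. - \<beta> y"] exI[of _ "\<lambda>y. - \<beta>' y"])
        (auto intro!: has_grad_minus continuous_on_minus simp: outward_or_zero_def)
  next
    case False
    then have "x \<in> frontier \<omega>" using x op by (simp add: frontier_def interior_open)
    then obtain U \<phi> \<phi>' where L: "local_defining_fun \<omega> x U \<phi> \<phi>'" using C1 unfolding C1_domain_def by blast
    then have L': "open U" "x \<in> U" "\<And>y. y \<in> U \<Longrightarrow> has_grad \<phi> y (\<phi>' y)" "continuous_on U \<phi>'"
      "\<And>y. y \<in> U \<Longrightarrow> \<phi>' y \<noteq> 0" "\<And>y. y \<in> U \<Longrightarrow> y \<in> \<omega> \<longleftrightarrow> \<phi> y < 0"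
      using local_defining_fun_iff[OF L] unfolding local_defining_fun_def by blast+
    obtain r where r: "r > 0" "cball x r \<subseteq> U" using L' open_contains_cball by blast
    define V where "V = ball x r"
    obtain \<beta> \<beta>' where b: "open V" "x \<in> V" "\<And>y. has_grad \<beta> y (\<beta>' y)"
      "continuous_on UNIV \<beta>'" "\<And>y. \<beta> y \<ge> 0" "\<And>y. y \<in> V \<Longrightarrow> \<beta> y > 0"
      "\<And>y. dist x y \<ge> r \<Longrightarrow> \<beta> y = 0 \<and> \<beta>' y = 0"
      using bump_exists[OF r(1), of x] r(1) unfolding V_def by (metis centre_in_ball open_ball)
    define \<theta> where "\<theta> y = (if y \<in> U then \<beta> y * \<phi> y else 0)" for y
    define \<theta>' where "\<theta>' y = (if y \<in> U then \<beta> y *\<^sub>R \<phi>' y + \<phi> y *\<^sub>R \<beta>' y else 0)" for y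
    have out: "\<beta> y = 0" "\<beta>' y = 0" if "y \<notin> cball x r" for y using b(7)[of y] that by auto
    have VU: "V \<subseteq> U" using b(6) out r(2) by force
    have UU: "U \<union> - cball x r = UNIV" using r(2) by auto
    have cphi: "continuous_on U \<phi>"
      using L'(3) has_grad_continuous continuous_at_imp_continuous_on by blast
    have cbeta: "continuous_on U \<beta>"
      using b(3) has_grad_continuous continuous_at_imp_continuous_on by blast
    have gr: "has_grad \<theta> y (\<theta>' y)" for y
    proof (cases "y \<in> U")
      case True
      have "((\<lambda>y. \<beta> y * \<phi> y) has_derivative (\<lambda>h. \<theta>' y \<bullet> h)) (at y)"
        using has_grad_mult[OF b(3) L'(3)[OF True]] True by (simp add: has_grad_def \<theta>'_def)
      then have "(\<theta> has_derivative (\<lambda>h. \<theta>' y \<bullet> h)) (at y)"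
        by (rule has_derivative_transform_within_open[OF _ L'(1) True]) (auto simp: \<theta>_def)
      then show ?thesis by (simp add: has_grad_def)
    next
      case False
      then have y: "y \<in> - cball x r" using r(2) by auto
      have "((\<lambda>y. 0) has_derivative (\<lambda>h. \<theta>' y \<bullet> h)) (at y)" using False by (simp add: \<theta>'_def)
      then have "(\<theta> has_derivative (\<lambda>h. \<theta>' y \<bullet> h)) (at y)"
        by (rule has_derivative_transform_within_open[OF _ _ y]) (auto simp: \<theta>_def out)
      then show ?thesis by (simp add: has_grad_def)
    qed
    have "continuous_on U \<theta>'"
      unfolding \<theta>'_def by (auto intro!: continuous_intros cphi cbeta L'(4) continuous_on_subset[OF b(4)] cong: continuous_on_cong)
    moreover have "continuous_on (- cball x r) \<theta>'"
      by (rule continuous_on_eq[OF continuous_on_const[of _ 0]]) (auto simp: \<theta>'_def out)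
    ultimately have ct: "continuous_on UNIV \<theta>'"
      using continuous_on_open_Un[of U "- cball x r" \<theta>'] L'(1) UU by auto
    have frz: "\<phi> y = 0" if "y \<in> frontier \<omega>" "y \<in> U" for y
      by (rule local_defining_fun_frontier_zero[OF L that(2,1) op])
    show ?thesis
    proof (intro exI[of _ V] exI[of _ \<theta>] exI[of _ \<theta>'] conjI allI ballI impI)
      show "open V" "x \<in> V" "continuous_on UNIV \<theta>'" by (fact b ct)+
      show "has_grad \<theta> y (\<theta>' y)" for y by (fact gr)
      show "\<theta> y \<le> 0" if "y \<in> \<omega>" for y
        using that L'(6)[of y] b(5)[of y] by (auto simp: \<theta>_def mult_nonneg_nonpos)
      show "\<theta> y \<ge> 0" if "y \<notin> \<omega>" for y
        using that L'(6)[of y] b(5)[of y] by (auto simp: \<theta>_def)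
      show "\<theta> y < 0" if "y \<in> \<omega> \<inter> V" for y
        using that L'(6)[of y] b(6)[of y] VU by (auto simp: \<theta>_def mult_pos_neg)
      show "\<theta>' y \<noteq> 0" if "y \<in> frontier \<omega> \<inter> V" for y
        using that b(6)[of y] VU frz[of y] L'(5)[of y] by (auto simp: \<theta>'_def)
      fix y assume y: "y \<in> frontier \<omega>"
      show "outward_or_zero \<omega> y (\<theta>' y)"
      proof (cases "y \<in> U \<and> \<beta> y > 0")
        case True
        have "local_defining_fun \<omega> y U \<phi> \<phi>'" using L True unfolding local_defining_fun_def by auto
        \<comment> \<open>The function \<phi> vanishes on the frontier, so the term with the
          gradient of the bump drops out: there the cut-off only rescales the gradient by a positive
          factor.\<close>
        moreover have "\<theta>' y = \<beta> y *\<^sub>R \<phi>' y" using True frz[OF y] by (simp add: \<theta>'_def)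
        ultimately show ?thesis using True outward_or_zero_scale_gradient[OF y _ _ op] by metis
      next
        case False
        then have "\<theta>' y = 0" using frz[OF y] b(5)[of y] by (auto simp: \<theta>'_def)
        then show ?thesis by (simp add: outward_or_zero_def)
      qed
    qed
  qed
qed

text \<open>Local functions can simply be added. Each has the weak sign on both sides of the
  frontier, so one strictly negative summand near a point is enough for strictness; and on the
  frontier all gradients lie in one cone where a sum vanishes only if every summand does.\<close>

lemma C1_domain_defining_function:
  fixes \<omega> :: "'a::euclidean_space set"
  assumes C1: "C1_domain \<omega>" and bd: "bounded \<omega>"
  obtains \<Theta> \<Theta>' where "\<And>y. has_grad \<Theta> y (\<Theta>' y)" "continuous_on UNIV \<Theta>'" "\<omega> = {y. \<Theta> y < 0}"
    "\<And>y. y \<in> frontier \<omega> \<Longrightarrow> \<Theta>' y \<noteq> 0"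
    "\<And>y w. y \<in> frontier \<omega> \<Longrightarrow> (\<And>\<nu>. outward_normal \<omega> y \<nu> \<Longrightarrow> w \<bullet> \<nu> = 0) \<Longrightarrow> w \<bullet> \<Theta>' y = 0"
proof -
  define P where "P A = (\<exists>(\<theta>' :: 'a \<Rightarrow> 'a) (\<theta> :: 'a \<Rightarrow> real). (\<forall>y. has_grad \<theta> y (\<theta>' y)) \<and> continuous_on UNIV \<theta>' \<and>
     (\<forall>y. y \<in> \<omega> \<longrightarrow> \<theta> y \<le> 0) \<and> (\<forall>y. y \<notin> \<omega> \<longrightarrow> \<theta> y \<ge> 0) \<and> (\<forall>y\<in>\<omega> \<inter> A. \<theta> y < 0) \<and>
     (\<forall>y\<in>frontier \<omega>. outward_or_zero \<omega> y (\<theta>' y)) \<and> (\<forall>y\<in>frontier \<omega> \<inter> A. \<theta>' y \<noteq> 0))" for A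
  have "P (closure \<omega>)"
  proof (rule compact_local_induct)
    show "compact (closure \<omega>)" using bd by simp
    show "\<exists>V. open V \<and> x \<in> V \<and> P V" if "x \<in> closure \<omega>" for x
      using local_datum[OF C1 that] unfolding P_def by blast
    show "P B \<Longrightarrow> A \<subseteq> B \<Longrightarrow> P A" for A B unfolding P_def by blast
    show "P {}" unfolding P_def
      by (intro exI[of _ "\<lambda>_. 0"]) (auto intro!: has_grad_const simp: outward_or_zero_def)
    show "P (A \<union> B)" if PA: "P A" and PB: "P B" for A B
    proof -
      from PA obtain f f' where f: "\<forall>y. has_grad f y (f' y)" "continuous_on UNIV f'"
        "\<forall>y. y \<in> \<omega> \<longrightarrow> f y \<le> 0" "\<forall>y. y \<notin> \<omega> \<longrightarrow> f y \<ge> 0" "\<forall>y\<in>\<omega> \<inter> A. f y < 0"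
        "\<forall>y\<in>frontier \<omega>. outward_or_zero \<omega> y (f' y)" "\<forall>y\<in>frontier \<omega> \<inter> A. f' y \<noteq> 0"
        unfolding P_def by blast
      from PB obtain g g' where g: "\<forall>y. has_grad g y (g' y)" "continuous_on UNIV g'"
        "\<forall>y. y \<in> \<omega> \<longrightarrow> g y \<le> 0" "\<forall>y. y \<notin> \<omega> \<longrightarrow> g y \<ge> 0" "\<forall>y\<in>\<omega> \<inter> B. g y < 0"
        "\<forall>y\<in>frontier \<omega>. outward_or_zero \<omega> y (g' y)" "\<forall>y\<in>frontier \<omega> \<inter> B. g' y \<noteq> 0"
        unfolding P_def by blast
      have comb: "outward_or_zero \<omega> y (f' y + g' y)" "f' y + g' y = 0 \<Longrightarrow> f' y = 0 \<and> g' y = 0"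
        if y: "y \<in> frontier \<omega>" for y
      proof -
        obtain U \<phi> \<phi>' where "local_defining_fun \<omega> y U \<phi> \<phi>'" using C1 y unfolding C1_domain_def by blast
        from outward_or_zero_add[OF _ _ this] f(6) g(6) y
        show "outward_or_zero \<omega> y (f' y + g' y)" "f' y + g' y = 0 \<Longrightarrow> f' y = 0 \<and> g' y = 0" by blast+
      qed
      show ?thesis unfolding P_def
      proof (intro exI[of _ "\<lambda>y. f' y + g' y"] exI[of _ "\<lambda>y. f y + g y"] conjI)
        show "\<forall>y. has_grad (\<lambda>y. f y + g y) y (f' y + g' y)" using f(1) g(1) has_grad_add by blast
        show "continuous_on UNIV (\<lambda>y. f' y + g' y)" using f(2) g(2) by (rule continuous_on_add)
        show "\<forall>y. y \<in> \<omega> \<longrightarrow> f y + g y \<le> 0" using f(3) g(3) by (simp add: add_nonpos_nonpos)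
        show "\<forall>y. y \<notin> \<omega> \<longrightarrow> 0 \<le> f y + g y" using f(4) g(4) by simp
        show "\<forall>y\<in>\<omega> \<inter> (A \<union> B). f y + g y < 0"
          using f(3,5) g(3,5) by (auto intro: add_neg_nonpos add_nonpos_neg)
        show "\<forall>y\<in>frontier \<omega>. outward_or_zero \<omega> y (f' y + g' y)" using comb by blast
        show "\<forall>y\<in>frontier \<omega> \<inter> (A \<union> B). f' y + g' y \<noteq> 0" using comb f(7) g(7) by blast
      qed
    qed
  qed
  then obtain \<theta> \<theta>' where t: "\<forall>y. has_grad \<theta> y (\<theta>' y)" "continuous_on UNIV \<theta>'"
    "\<forall>y. y \<in> \<omega> \<longrightarrow> \<theta> y \<le> 0" "\<forall>y. y \<notin> \<omega> \<longrightarrow> \<theta> y \<ge> 0" "\<forall>y\<in>\<omega> \<inter> closure \<omega>. \<theta> y < 0"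
    "\<forall>y\<in>frontier \<omega>. outward_or_zero \<omega> y (\<theta>' y)" "\<forall>y\<in>frontier \<omega> \<inter> closure \<omega>. \<theta>' y \<noteq> 0"
    unfolding P_def by blast
  show ?thesis
  proof (rule that[of \<theta> \<theta>'])
    show "\<omega> = {y. \<theta> y < 0}" using t(4,5) closure_subset[of \<omega>] by (force simp: not_less[symmetric])
    show "\<theta>' y \<noteq> 0" if "y \<in> frontier \<omega>" for y using t(7) that by (auto simp: frontier_def)
    show "w \<bullet> \<theta>' y = 0" if "y \<in> frontier \<omega>" "\<And>\<nu>. outward_normal \<omega> y \<nu> \<Longrightarrow> w \<bullet> \<nu> = 0" for y w
      using t(6) that unfolding outward_or_zero_def by blast
  qed (use t in auto)
qed

subsection \<open>The weak formulation\<close>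

locale cylinder =
  fixes \<omega> :: "'a::euclidean_space set" and \<Theta> :: "'a \<Rightarrow> real" and \<Theta>' :: "'a \<Rightarrow> 'a"
  assumes Theta_grad: "\<And>y. has_grad \<Theta> y (\<Theta>' y)"
    and Theta'_cont: "continuous_on UNIV \<Theta>'"
    and omega_eq: "\<omega> = {y. \<Theta> y < 0}"
    and Theta'_nz: "\<And>y. y \<in> frontier \<omega> \<Longrightarrow> \<Theta>' y \<noteq> 0"
    and bounded_omega: "bounded \<omega>"
begin

definition Om :: "(real \<times> 'a) set" where "Om = UNIV \<times> \<omega>"
definition X :: "(real \<times> 'a) set" where "X = UNIV \<times> closure \<omega>"
text \<open>Two kinds of bounded pieces: \<open>slab\<close> is open and is what integrals are taken
  over, while \<open>Xslab\<close> is compact, contains its part of the lateral boundary, and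
  supplies uniform bounds.\<close>

definition slab :: "real \<Rightarrow> real \<Rightarrow> (real \<times> 'a) set" where
  "slab c r = {x \<in> Om. \<bar>fst x - c\<bar> < r}"
definition Xslab :: "real \<Rightarrow> (real \<times> 'a) set" where "Xslab T = {-T..T} \<times> closure \<omega>"

lemma Theta_cont: "continuous_on S \<Theta>"
  using Theta_grad has_grad_continuous continuous_at_imp_continuous_on by blast

lemma mem_omega: "y \<in> \<omega> \<longleftrightarrow> \<Theta> y < 0"
  using omega_eq by blast

lemma open_omega: "open \<omega>"
  unfolding omega_eq using Theta_cont by (intro open_Collect_less) auto

lemma open_Om: "open Om"
  unfolding Om_def using open_omega by (intro open_Times) auto

lemma closure_Om: "closure Om = X"
  unfolding Om_def X_def by (simp add: closure_Times)

lemma Om_subset_X: "Om \<subseteq> X"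
  unfolding Om_def X_def using closure_subset by auto

lemma compact_Xslab: "compact (Xslab T)"
  unfolding Xslab_def using bounded_omega by (intro compact_Times) auto

lemma Xslab_eq: "Xslab T = {x \<in> X. \<bar>fst x\<bar> \<le> T}"
  unfolding Xslab_def X_def by (auto simp: abs_le_iff)

lemma Xslab_subset: "Xslab T \<subseteq> X" unfolding Xslab_eq by auto

lemma open_slab: "open (slab c r)"
proof -
  have "slab c r = Om \<inter> {x. \<bar>fst x - c\<bar> < r}" unfolding slab_def by auto
  moreover have "open {x::real \<times> 'a. \<bar>fst x - c\<bar> < r}" by (intro open_Collect_less continuous_intros)
  ultimately show ?thesis using open_Om by auto
qed

lemma bounded_slab: "bounded (slab c r)"
proof (rule bounded_subset)
  show "bounded (Xslab (\<bar>c\<bar> + r))" using compact_Xslab compact_imp_bounded by blast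
  show "slab c r \<subseteq> Xslab (\<bar>c\<bar> + r)" unfolding Xslab_eq slab_def using Om_subset_X by auto
qed

lemma Theta_closure: "y \<in> closure \<omega> \<Longrightarrow> \<Theta> y \<le> 0"
proof -
  assume "y \<in> closure \<omega>"
  moreover have "closed {y. \<Theta> y \<le> 0}" using Theta_cont by (intro closed_Collect_le) auto
  then have "closure \<omega> \<subseteq> {y. \<Theta> y \<le> 0}" by (rule closure_minimal[rotated]) (auto simp: mem_omega)
  ultimately show ?thesis by auto
qed

lemma frontier_iff: "y \<in> frontier \<omega> \<longleftrightarrow> y \<in> closure \<omega> \<and> y \<notin> \<omega>"
  using open_omega by (simp add: frontier_def interior_open)

lemma frontier_eq_zero: "y \<in> closure \<omega> \<Longrightarrow> y \<in> frontier \<omega> \<longleftrightarrow> \<Theta> y = 0"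
  using Theta_closure[of y] unfolding frontier_iff by (auto simp: mem_omega)

lemma mem_Om: "x \<in> Om \<longleftrightarrow> \<Theta> (snd x) < 0"
  unfolding Om_def by (auto simp: mem_Times_iff mem_omega)

section \<open>The volume of a thin boundary layer\<close>

definition layer :: "real \<Rightarrow> 'a set \<Rightarrow> real \<Rightarrow> (real \<times> 'a) set" where
  "layer T U \<epsilon> = {x. \<bar>fst x\<bar> \<le> T \<and> snd x \<in> \<omega> \<inter> U \<and> - \<epsilon> < \<Theta> (snd x)}"

text \<open>Near y0 the gradient of \<Theta> is close to its value g at y0, so \<Theta> has a
  uniformly negative slope in all directions close to -g, and the mean value theorem turns slope
  into decrease. The layer estimate follows the central direction only; the full ball of directions
  provides the interior cone for the Nash inequality.\<close>

lemma inward_directions: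
  assumes y0: "y0 \<in> frontier \<omega>"
  shows "\<exists>U e \<rho> s0 c. open U \<and> y0 \<in> U \<and> \<rho> > 0 \<and> s0 > 0 \<and> c > 0 \<and> norm e + \<rho> \<le> 1 \<and>
    (\<forall>y\<in>U. \<forall>d\<in>ball e \<rho>. \<forall>s\<in>{0..s0}. \<Theta> (y + s *\<^sub>R d) \<le> \<Theta> y - c * s)"
proof -
  define g where "g = \<Theta>' y0"
  \<comment> \<open>The length 1/2 leaves room for a ball of radius 1/4 inside the unit ball. In
    units of |g| the slope is then at most -1/2 + 1/4 + 1/8 = -1/8, the summands being the
    contributions of e, of the deviation of d from e, and of the variation of the gradient.\<close>
  define e where "e = - (1 / (2 * norm g)) *\<^sub>R g"
  have g: "norm g > 0" using Theta'_nz[OF y0] by (simp add: g_def)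
  have ne: "norm e = 1 / 2" using g by (simp add: e_def)
  have "isCont \<Theta>' y0" using Theta'_cont by (simp add: continuous_on_eq_continuous_at)
  then obtain r where r: "r > 0" "\<And>y. dist y y0 < r \<Longrightarrow> dist (\<Theta>' y) g < norm g / 8"
    using g unfolding continuous_at_eps_delta g_def by (metis zero_less_divide_iff zero_less_numeral)
  have slope: "\<Theta>' y \<bullet> d \<le> - (norm g / 8)" if "dist y y0 < r" "d \<in> ball e (1/4)" for y d
  proof -
    have nd: "norm (d - e) \<le> 1 / 4" using that(2) by (simp add: dist_norm norm_minus_commute)
    have "norm d \<le> norm e + norm (d - e)" by (metis add.commute diff_add_cancel norm_triangle_ineq)
    then have d1: "norm d \<le> 1" using nd ne by simp
    have "g \<bullet> e = - (norm g / 2)" using g by (simp add: e_def dot_square_norm power2_eq_square)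
    moreover have "g \<bullet> (d - e) \<le> norm g * (1 / 4)"
      using norm_cauchy_schwarz[of g "d - e"] mult_left_mono[OF nd, of "norm g"] by simp
    moreover have "(\<Theta>' y - g) \<bullet> d \<le> norm g / 8 * 1"
      using norm_cauchy_schwarz[of "\<Theta>' y - g" d] mult_mono[of "norm (\<Theta>' y - g)" "norm g / 8" "norm d" 1]
        r(2)[OF that(1)] d1 g by (simp add: dist_norm)
    moreover have "\<Theta>' y \<bullet> d = g \<bullet> e + g \<bullet> (d - e) + (\<Theta>' y - g) \<bullet> d"
      by (simp add: inner_diff_left inner_diff_right)
    ultimately show ?thesis by simp
  qed
  show ?thesis
  proof (intro exI conjI ballI)
    show "open (ball y0 (r/2))" "y0 \<in> ball y0 (r/2)" "(1/4::real) > 0" "r / 2 > 0" "norm g / 8 > 0"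
      using r g by auto
    show "norm e + 1/4 \<le> 1" using ne by simp
    fix y d s assume y: "y \<in> ball y0 (r/2)" and d: "d \<in> ball e (1/4)" and s: "s \<in> {0..r/2}"
    have nd: "norm d \<le> 1"
      using d ne norm_triangle_ineq[of e "d - e"] by (simp add: dist_norm norm_minus_commute)
    show "\<Theta> (y + s *\<^sub>R d) \<le> \<Theta> y - norm g / 8 * s"
    proof (cases "s = 0")
      case False
      then have s0: "0 < s" using s by simp
      have "\<exists>t>0. t < s \<and> \<Theta> (y + s *\<^sub>R d) - \<Theta> (y + 0 *\<^sub>R d) = (s - 0) * (\<Theta>' (y + t *\<^sub>R d) \<bullet> d)"
        by (rule MVT2[OF s0]) (rule has_grad_line[OF Theta_grad])
      then obtain t where t: "0 < t" "t < s" "\<Theta> (y + s *\<^sub>R d) - \<Theta> y = s * (\<Theta>' (y + t *\<^sub>R d) \<bullet> d)"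
        by auto
      have "norm (t *\<^sub>R d) \<le> r / 2"
        using t s nd mult_mono[of t "r/2" "norm d" 1] by auto
      then have "dist (y + t *\<^sub>R d) y0 < r"
        using y dist_triangle[of "y + t *\<^sub>R d" y0 y] by (simp add: dist_norm norm_minus_commute)
      from mult_left_mono[OF slope[OF this d], of s] t(3) s0 show ?thesis by (simp add: mult.commute)
    qed simp
  qed
qed

text \<open>Translates of the layer of thickness \<open>\<epsilon>\<close> along an inward direction are disjoint, and of order \<open>1 / \<epsilon>\<close> of them fit into
  a bounded slab.\<close>

lemma boundary_layer_local:
  fixes T :: real
  assumes y0: "y0 \<in> closure \<omega>" and T: "T \<ge> 0"
  shows "\<exists>U C. open U \<and> y0 \<in> U \<and> C \<ge> 0 \<and> (\<forall>\<epsilon>>0. \<exists>M\<in>sets lborel.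
     layer T U \<epsilon> \<subseteq> M \<and> emeasure lborel M \<le> ennreal (C * \<epsilon>))"
proof -
  define SL :: "(real \<times> 'a) set" where "SL = slab 0 (T + 1)"
  define m where "m = measure lborel SL"
  have SLm: "SL \<in> sets lborel" unfolding SL_def using open_slab by (simp add: borel_open)
  have SLfin: "emeasure lborel SL < \<infinity>" unfolding SL_def by (rule emeasure_bounded_finite[OF bounded_slab])
  have SLe: "emeasure lborel SL = ennreal m"
    unfolding m_def using SLfin by (simp add: emeasure_eq_ennreal_measure)
  have m0: "m \<ge> 0" by (simp add: m_def)
  have inSL: "x \<in> SL" if "\<bar>fst x\<bar> \<le> T" "snd x \<in> \<omega>" for x
    using that by (auto simp: SL_def slab_def Om_def mem_Times_iff)
  show ?thesis
  proof (cases "y0 \<in> \<omega>")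
    case True
    define a where "a = - \<Theta> y0 / 2"
    have a: "a > 0" using True by (simp add: a_def mem_omega)
    define U where "U = {y. \<Theta> y < - a}"
    have "open U" unfolding U_def using Theta_cont by (intro open_Collect_less) auto
    moreover have "y0 \<in> U" using a by (simp add: U_def a_def)
    \<comment> \<open>On U the function \<Theta> is below -a, so the layer is empty for \<epsilon>
      <= a; for larger \<epsilon> the volume m of the whole slab is at most m / a *
      \<epsilon>.\<close>
    moreover have "\<exists>M\<in>sets lborel. layer T U \<epsilon> \<subseteq> M \<and>
        emeasure lborel M \<le> ennreal (m / a * \<epsilon>)" if "\<epsilon> > 0" for \<epsilon>
    proof (cases "\<epsilon> \<le> a")
      case True
      then have "layer T U \<epsilon> \<subseteq> {}"
        by (auto simp: U_def layer_def)
      then show ?thesis by (intro bexI[of _ "{}"]) auto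
    next
      case False
      have "m \<le> m / a * \<epsilon>"
        using False a m0 by (simp add: divide_simps mult_left_mono)
      then show ?thesis using inSL SLm SLe by (intro bexI[of _ SL]) (auto simp: layer_def intro: ennreal_leI)
    qed
    ultimately show ?thesis using a m0 by (intro exI[of _ U] exI[of _ "m / a"]) auto
  next
    case False
    then have "y0 \<in> frontier \<omega>" using y0 by (simp add: frontier_iff)
    from inward_directions[OF this] obtain U e \<rho> s0 c where D: "open U" "y0 \<in> U" "\<rho> > 0" "s0 > 0" "c > 0"
      "\<And>y d s. y \<in> U \<Longrightarrow> d \<in> ball e \<rho> \<Longrightarrow> s \<in> {0..s0} \<Longrightarrow> \<Theta> (y + s *\<^sub>R d) \<le> \<Theta> y - c * s" by metis
    have De: "\<Theta> (y + s *\<^sub>R e) \<le> \<Theta> y - c * s" if "y \<in> U" "0 \<le> s" "s \<le> s0" for y s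
      using D(6)[OF that(1), of e s] D(3) that by auto
    have "\<exists>M\<in>sets lborel. layer T U \<epsilon> \<subseteq> M \<and>
        emeasure lborel M \<le> ennreal (m / (s0 * c) * \<epsilon>)" if eps: "\<epsilon> > 0" for \<epsilon>
    proof -
      define Z where "Z = layer T U \<epsilon>"
      \<comment> \<open>This counts the steps of length \<epsilon> / c that fit into the admissible
        length s0. One such step lowers \<Theta> by at least \<epsilon> and so carries a point out
        of the layer; hence the translates \<open>F 0\<close>, ..., \<open>F n\<close> are
        disjoint.\<close>
      define n where "n = nat \<lfloor>s0 * c / \<epsilon>\<rfloor>"
      define w :: "nat \<Rightarrow> real \<times> 'a" where "w j = (0, (real j * \<epsilon> / c) *\<^sub>R e)" for j
      define F where "F j = {x. x - w j \<in> Z}" for j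
      have Z1: "Z = {x. \<bar>fst x\<bar> \<le> T} \<inter> (snd -` (\<omega> \<inter> U) \<inter> {x. - \<epsilon> < \<Theta> (snd x)})"
        by (auto simp: Z_def layer_def)
      have cT: "continuous_on UNIV (\<lambda>x::real \<times> 'a. \<Theta> (snd x))"
        by (rule continuous_on_compose2[OF Theta_cont[of UNIV]]) (auto intro: continuous_intros)
      have "open (snd -` (\<omega> \<inter> U) \<inter> {x::real \<times> 'a. - \<epsilon> < \<Theta> (snd x)})"
        using open_omega D(1) cT
        by (intro open_Int open_vimage_snd open_Collect_less) auto
      moreover have "closed {x::real \<times> 'a. \<bar>fst x\<bar> \<le> T}" by (intro closed_Collect_le continuous_intros)
      ultimately have Zm: "Z \<in> sets borel" unfolding Z1 by (intro sets.Int borel_open borel_closed)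
      have "(\<lambda>x. x - w j) \<in> borel_measurable borel" for j by measurable
      then have Fm: "F j \<in> sets lborel" for j
        using measurable_sets[of "\<lambda>x. x - w j" borel borel Z] Zm by (auto simp: F_def vimage_def)
      have Fe: "emeasure lborel (F j) = emeasure lborel Z" for j
      proof -
        have "indicator (F j) = (\<lambda>x. indicator Z (x + - w j) :: ennreal)"
          by (auto simp: F_def indicator_def fun_eq_iff)
        then have "emeasure lborel (F j) = (\<integral>\<^sup>+x. indicator Z (x + - w j) \<partial>lborel)"
          using nn_integral_indicator[OF Fm[of j]] by simp
        also have "\<dots> = (\<integral>\<^sup>+x. indicator Z x \<partial>lborel)"
          by (rule lborel_nn_integral_shift) (use Zm in measurable)
        finally show ?thesis using Zm by simp
      qed
      have nle: "real n * \<epsilon> / c \<le> s0"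
      proof -
        have "real n \<le> s0 * c / \<epsilon>" unfolding n_def using D eps by (intro of_nat_floor) auto
        then show ?thesis using D eps by (simp add: field_simps)
      qed
      have jle: "real j * \<epsilon> / c \<le> s0" if "j \<le> n" for j
      proof -
        have "real j * \<epsilon> / c \<le> real n * \<epsilon> / c" using that D eps by (intro divide_right_mono mult_right_mono) auto
        then show ?thesis using nle by simp
      qed
      have FSL: "F j \<subseteq> SL" if "j \<le> n" for j
      proof
        fix x assume "x \<in> F j"
        then have z: "x - w j \<in> Z" by (simp add: F_def)
        then have "\<Theta> (snd (x - w j) + (real j * \<epsilon> / c) *\<^sub>R e) \<le> \<Theta> (snd (x - w j)) - c * (real j * \<epsilon> / c)"
          using D eps jle[OF that] by (intro De) (auto simp: Z_def layer_def)
        also have "\<dots> < 0"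
          using z D eps by (auto simp: Z_def layer_def mem_omega intro!: add_neg_nonpos)
            (smt (verit) divide_nonneg_nonneg mult_nonneg_nonneg of_nat_0_le_iff)
        finally have "snd x \<in> \<omega>" by (simp add: w_def mem_omega)
        moreover have "\<bar>fst x\<bar> \<le> T" using z by (simp add: Z_def layer_def w_def)
        ultimately show "x \<in> SL" using inSL by blast
      qed
      have disj: "F j \<inter> F k = {}" if "j < k" "k \<le> n" for j k
      proof (rule ccontr)
        assume "F j \<inter> F k \<noteq> {}"
        then obtain x where x: "x - w j \<in> Z" "x - w k \<in> Z" by (auto simp: F_def)
        define s where "s = real (k - j) * \<epsilon> / c"
        have s: "0 \<le> s" "s \<le> s0" "c * s \<ge> \<epsilon>"
          using jle[of "k - j"] that D eps by (auto simp: s_def)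
        have eqs: "snd (x - w j) = snd (x - w k) + s *\<^sub>R e"
          using that by (simp add: w_def s_def of_nat_diff algebra_simps diff_divide_distrib scaleR_diff_left)
        have "snd (x - w k) \<in> U" using x(2) by (simp add: Z_def layer_def)
        then have "\<Theta> (snd (x - w j)) \<le> \<Theta> (snd (x - w k)) - c * s"
          unfolding eqs using s(1,2) by (rule De)
        then show False using x s by (auto simp: Z_def layer_def mem_omega)
      qed
      have "disjoint_family_on F {..n}"
        unfolding disjoint_family_on_def using disj by (metis Int_commute atMost_iff nat_neq_iff)
      then have "(\<Sum>j\<le>n. emeasure lborel (F j)) = emeasure lborel (\<Union>j\<le>n. F j)"
        using Fm by (intro sum_emeasure) auto
      also have "\<dots> \<le> emeasure lborel SL"
        using FSL SLm by (intro emeasure_mono) auto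
      finally have le: "of_nat (Suc n) * emeasure lborel Z \<le> ennreal m" by (simp add: Fe SLe)
      have "Z \<subseteq> SL" using inSL by (auto simp: Z_def layer_def)
      then have "emeasure lborel Z \<le> emeasure lborel SL" using SLm by (rule emeasure_mono)
      then have "emeasure lborel Z < \<infinity>" using SLfin by simp
      then have Ze: "emeasure lborel Z = ennreal (measure lborel Z)" by (simp add: emeasure_eq_ennreal_measure)
      have "ennreal (real (Suc n) * measure lborel Z) \<le> ennreal m"
        using le unfolding Ze by (simp add: ennreal_mult ennreal_of_nat_eq_real_of_nat del: of_nat_Suc)
      then have le2: "real (Suc n) * measure lborel Z \<le> m" using m0 by (simp add: ennreal_le_iff)
      have "s0 * c / \<epsilon> \<le> real (Suc n)" unfolding n_def by linarith
      then have "s0 * c / \<epsilon> * measure lborel Z \<le> m"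
        using le2 mult_right_mono[of "s0 * c / \<epsilon>" "real (Suc n)" "measure lborel Z"] by simp
      then have "measure lborel Z \<le> m / (s0 * c) * \<epsilon>"
        using D eps by (simp add: field_simps)
      then show ?thesis using Ze Zm unfolding Z_def[symmetric]
        by (intro bexI[of _ Z]) (auto intro: ennreal_leI)
    qed
    then show ?thesis using D m0 by (intro exI[of _ U] exI[of _ "m / (s0 * c)"]) auto
  qed
qed

text \<open>The linear dependence on \<epsilon> is the point: it offsets the factor 1/\<epsilon> in
  the gradient of a cut-off living in the layer. The local bounds add up over a finite cover of the
  compact closure.\<close>

lemma boundary_layer:
  assumes T: "T \<ge> 0"
  obtains C where "C \<ge> 0" "\<And>\<epsilon>. \<epsilon> > 0 \<Longrightarrow>
    measure lborel {x \<in> Om. \<bar>fst x\<bar> \<le> T \<and> - \<epsilon> < \<Theta> (snd x)} \<le> C * \<epsilon>"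
    "\<And>\<epsilon>. {x \<in> Om. \<bar>fst x\<bar> \<le> T \<and> - \<epsilon> < \<Theta> (snd x)} \<in> sets lborel"
proof -
  define P where "P A = (\<exists>C\<ge>0. \<forall>\<epsilon>>0. \<exists>M\<in>sets lborel. layer T A \<epsilon> \<subseteq> M \<and>
     emeasure lborel M \<le> ennreal (C * \<epsilon>))" for A
  have "P (closure \<omega>)"
  proof (rule compact_local_induct)
    show "compact (closure \<omega>)" using bounded_omega by simp
    show "\<exists>U. open U \<and> y \<in> U \<and> P U" if "y \<in> closure \<omega>" for y
      using boundary_layer_local[OF that T] unfolding P_def by blast
    show "P {}" unfolding P_def by (intro exI[of _ 0]) (auto simp: layer_def)
    show "P A" if "P B" "A \<subseteq> B" for A B
    proof -
      have "layer T A \<epsilon> \<subseteq> layer T B \<epsilon>" for \<epsilon> using that(2) by (auto simp: layer_def)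
      then show ?thesis using that(1) unfolding P_def by (meson order_trans)
    qed
    show "P (A \<union> B)" if A: "P A" and B: "P B" for A B
    proof -
      obtain C1 where C1: "C1 \<ge> 0" "\<And>\<epsilon>. \<epsilon> > 0 \<Longrightarrow> \<exists>M\<in>sets lborel. layer T A \<epsilon> \<subseteq> M \<and>
         emeasure lborel M \<le> ennreal (C1 * \<epsilon>)" using A unfolding P_def by blast
      obtain C2 where C2: "C2 \<ge> 0" "\<And>\<epsilon>. \<epsilon> > 0 \<Longrightarrow> \<exists>M\<in>sets lborel. layer T B \<epsilon> \<subseteq> M \<and>
         emeasure lborel M \<le> ennreal (C2 * \<epsilon>)" using B unfolding P_def by blast
      have "\<exists>M\<in>sets lborel. layer T (A \<union> B) \<epsilon> \<subseteq> M \<and>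
         emeasure lborel M \<le> ennreal ((C1 + C2) * \<epsilon>)" if eps: "\<epsilon> > 0" for \<epsilon>
      proof -
        obtain M1 where M1: "M1 \<in> sets lborel" "layer T A \<epsilon> \<subseteq> M1"
          "emeasure lborel M1 \<le> ennreal (C1 * \<epsilon>)" using C1(2)[OF eps] by blast
        obtain M2 where M2: "M2 \<in> sets lborel" "layer T B \<epsilon> \<subseteq> M2"
          "emeasure lborel M2 \<le> ennreal (C2 * \<epsilon>)" using C2(2)[OF eps] by blast
        have "emeasure lborel (M1 \<union> M2) \<le> emeasure lborel M1 + emeasure lborel M2"
          using M1 M2 by (intro emeasure_subadditive)
        also have "\<dots> \<le> ennreal (C1 * \<epsilon>) + ennreal (C2 * \<epsilon>)" using M1 M2 by (intro add_mono)
        also have "\<dots> = ennreal ((C1 + C2) * \<epsilon>)"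
          using C1 C2 eps by (simp add: ennreal_plus[symmetric] distrib_right del: ennreal_plus)
        finally show ?thesis
          using M1 M2 by (intro bexI[of _ "M1 \<union> M2"]) (auto simp: layer_def)
      qed
      then show ?thesis unfolding P_def using C1 C2 by (intro exI[of _ "C1 + C2"]) auto
    qed
  qed
  then obtain C where C: "C \<ge> 0" "\<And>\<epsilon>. \<epsilon> > 0 \<Longrightarrow> \<exists>M\<in>sets lborel. layer T (closure \<omega>) \<epsilon> \<subseteq> M \<and>
     emeasure lborel M \<le> ennreal (C * \<epsilon>)" unfolding P_def by blast
  have eq: "layer T (closure \<omega>) \<epsilon> =
    {x \<in> Om. \<bar>fst x\<bar> \<le> T \<and> - \<epsilon> < \<Theta> (snd x)}" for \<epsilon>
    using closure_subset[of \<omega>] by (auto simp: layer_def Om_def mem_Times_iff)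
  show ?thesis
  proof (rule that[OF C(1)])
    fix \<epsilon> :: real
    have cT: "continuous_on UNIV (\<lambda>x::real \<times> 'a. \<Theta> (snd x))"
      by (rule continuous_on_compose2[OF Theta_cont[of UNIV]]) (auto intro: continuous_intros)
    have 1: "{x \<in> Om. \<bar>fst x\<bar> \<le> T \<and> - \<epsilon> < \<Theta> (snd x)} = {x. \<bar>fst x\<bar> \<le> T} \<inter> (Om \<inter> {x. - \<epsilon> < \<Theta> (snd x)})" by auto
    have "open (Om \<inter> {x. - \<epsilon> < \<Theta> (snd x)})" using open_Om cT by (intro open_Int open_Collect_less) auto
    moreover have "closed {x::real \<times> 'a. \<bar>fst x\<bar> \<le> T}" by (intro closed_Collect_le continuous_intros)
    ultimately show "{x \<in> Om. \<bar>fst x\<bar> \<le> T \<and> - \<epsilon> < \<Theta> (snd x)} \<in> sets lborel"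
      unfolding 1 sets_lborel by (intro sets.Int borel_open borel_closed)
    show "measure lborel {x \<in> Om. \<bar>fst x\<bar> \<le> T \<and> - \<epsilon> < \<Theta> (snd x)} \<le> C * \<epsilon>" if eps: "\<epsilon> > 0"
    proof -
      obtain M where M: "M \<in> sets lborel" "{x \<in> Om. \<bar>fst x\<bar> \<le> T \<and> - \<epsilon> < \<Theta> (snd x)} \<subseteq> M"
        "emeasure lborel M \<le> ennreal (C * \<epsilon>)" using C(2)[OF eps] unfolding eq by blast
      have "emeasure lborel {x \<in> Om. \<bar>fst x\<bar> \<le> T \<and> - \<epsilon> < \<Theta> (snd x)} \<le> ennreal (C * \<epsilon>)"
        using emeasure_mono[OF M(2,1)] M(3) by simp
      then show ?thesis unfolding measure_def using C(1) eps by (intro enn2real_leI) auto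
    qed
  qed
qed


lemma integrable_slab_support:
  fixes f :: "real \<times> 'a \<Rightarrow> real"
  assumes f: "continuous_on X f" "\<And>x. x \<in> X \<Longrightarrow> \<bar>fst x\<bar> > T \<Longrightarrow> f x = 0"
  shows "set_integrable lborel Om f"
proof -
  have "continuous_on (Xslab T) f" using f(1) Xslab_subset continuous_on_subset by blast
  then have "set_integrable lborel (Xslab T) f"
    unfolding set_integrable_def by (rule borel_integrable_compact[OF compact_Xslab])
  then have "set_integrable lborel (Om \<inter> Xslab T) f"
    by (rule set_integrable_subset)
      (use open_Om compact_imp_closed[OF compact_Xslab] in \<open>auto intro!: sets.Int borel_open borel_closed\<close>)
  moreover have "(\<lambda>x. indicator (Om \<inter> Xslab T) x *\<^sub>R f x) = (\<lambda>x. indicator Om x *\<^sub>R f x)"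
    using f(2) Om_subset_X by (fastforce simp: fun_eq_iff indicator_def Xslab_eq not_le)
  ultimately show ?thesis unfolding set_integrable_def by simp
qed

section \<open>Weakly divergence-free fields tangent to the boundary\<close>

definition test :: "(real \<times> 'a \<Rightarrow> real) \<Rightarrow> (real \<times> 'a \<Rightarrow> real \<times> 'a) \<Rightarrow> bool" where
  "test \<phi> \<phi>' \<longleftrightarrow> continuous_on X \<phi> \<and> continuous_on X \<phi>' \<and> (\<forall>x\<in>Om. has_grad \<phi> x (\<phi>' x)) \<and>
     (\<exists>T. \<forall>x\<in>X. \<bar>fst x\<bar> > T \<longrightarrow> \<phi> x = 0 \<and> \<phi>' x = 0)"

text \<open>Test functions need not vanish on the lateral boundary, so this one identity encodes
  both zero divergence and zero normal component. It also admits the potential itself, times an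
  axial cut-off, as a test function.\<close>

definition solenoidal :: "(real \<times> 'a \<Rightarrow> real \<times> 'a) \<Rightarrow> bool" where
  "solenoidal v \<longleftrightarrow> continuous_on X v \<and>
     (\<forall>\<phi> \<phi>'. test \<phi> \<phi>' \<longrightarrow> (LINT x:Om|lborel. v x \<bullet> \<phi>' x) = 0)"

text \<open>As div v = 0, the integrand is the divergence of w v. Extended by zero, each component w
  (v . b) is differentiable on the whole space with a bounded derivative supported in K, so its
  derivative in direction b integrates to zero.\<close>

lemma divergence_theorem_compact_support:
  assumes v: "\<And>x. x \<in> Om \<Longrightarrow> (v has_derivative blinfun_apply (Dv x)) (at x)" "continuous_on Om Dv"
    and div: "\<And>x. x \<in> Om \<Longrightarrow> div_of (Dv x) = 0"
    and w: "\<And>x. x \<in> Om \<Longrightarrow> has_grad w x (w' x)" "continuous_on Om w'"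
    and K: "compact K" "K \<subseteq> Om" "\<And>x. x \<in> Om - K \<Longrightarrow> w x = 0"
  shows "(LINT x:Om|lborel. v x \<bullet> w' x) = 0"
proof -
  have cv: "continuous_on Om v" using v(1) has_derivative_continuous continuous_at_imp_continuous_on by blast
  have cw: "continuous_on Om w" using w(1) has_grad_continuous continuous_at_imp_continuous_on by blast
  obtain B1 where B1: "B1 \<ge> 0" "\<forall>x\<in>K. norm (w' x) \<le> B1"
    using continuous_compact_bound[OF K(1) continuous_on_subset[OF w(2) K(2)]] by blast
  obtain B2 where B2: "B2 \<ge> 0" "\<forall>x\<in>K. norm (v x) \<le> B2"
    using continuous_compact_bound[OF K(1) continuous_on_subset[OF cv K(2)]] by blast
  obtain B3 where B3: "B3 \<ge> 0" "\<forall>x\<in>K. norm (w x) \<le> B3"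
    using continuous_compact_bound[OF K(1) continuous_on_subset[OF cw K(2)]] by blast
  obtain B4 where B4: "B4 \<ge> 0" "\<forall>x\<in>K. norm (Dv x) \<le> B4"
    using continuous_compact_bound[OF K(1) continuous_on_subset[OF v(2) K(2)]] by blast
  define f where "f b x = (if x \<in> Om then w x * (v x \<bullet> b) else 0)" for b x
  define f' where "f' b x h = (if x \<in> K then (w' x \<bullet> h) * (v x \<bullet> b) + w x * (blinfun_apply (Dv x) h \<bullet> b) else 0)"
    for b x h
  have opK: "open (- K)" using compact_imp_closed[OF K(1)] by auto
  have D: "(f b has_derivative f' b x) (at x)" for b x
  proof (cases "x \<in> K")
    case True
    then have xO: "x \<in> Om" using K by auto
    have "((\<lambda>x. w x * (v x \<bullet> b)) has_derivative f' b x) (at x)"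
      by (rule has_derivative_eq_rhs, rule has_derivative_mult[OF has_gradD[OF w(1)[OF xO]]
            has_derivative_inner_left[OF v(1)[OF xO]]])
        (use True in \<open>auto simp: f'_def fun_eq_iff\<close>)
    then show ?thesis
      by (rule has_derivative_transform_within_open[OF _ open_Om xO]) (auto simp: f_def)
  next
    case False
    have "((\<lambda>x. 0) has_derivative f' b x) (at x)"
      using False by (simp add: f'_def[abs_def])
    then show ?thesis
      by (rule has_derivative_transform_within_open[OF _ opK]) (use False K(3) in \<open>auto simp: f_def\<close>)
  qed
  have L: "\<bar>f' b x h\<bar> \<le> (B1 * B2 + B3 * B4) * norm h" if "b \<in> Basis" for b x h
  proof (cases "x \<in> K")
    case True
    have b: "norm b = 1" using that by simp
    have "\<bar>w' x \<bullet> h\<bar> \<le> B1 * norm h"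
      using Cauchy_Schwarz_ineq2[of "w' x" h] B1 True by (meson mult_right_mono norm_ge_zero order_trans)
    moreover have "\<bar>v x \<bullet> b\<bar> \<le> B2"
      using Cauchy_Schwarz_ineq2[of "v x" b] B2 True b by force
    ultimately have 1: "\<bar>(w' x \<bullet> h) * (v x \<bullet> b)\<bar> \<le> (B1 * norm h) * B2"
      unfolding abs_mult using B1 by (intro mult_mono) auto
    have "\<bar>blinfun_apply (Dv x) h \<bullet> b\<bar> \<le> norm (blinfun_apply (Dv x) h)"
      using Cauchy_Schwarz_ineq2[of "blinfun_apply (Dv x) h" b] b by simp
    also have "\<dots> \<le> norm (Dv x) * norm h" by (rule norm_blinfun)
    also have "\<dots> \<le> B4 * norm h" using B4 True by (intro mult_right_mono) auto
    finally have "\<bar>w x * (blinfun_apply (Dv x) h \<bullet> b)\<bar> \<le> B3 * (B4 * norm h)"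
      unfolding abs_mult using B3 True by (intro mult_mono) auto
    with 1 show ?thesis using True by (simp add: f'_def algebra_simps)
  next
    case False then show ?thesis using B1 B2 B3 B4 by (simp add: f'_def)
  qed
  have S: "bounded K" "x \<notin> K \<Longrightarrow> f b x = 0" for x b
    using K compact_imp_bounded by (auto simp: f_def)
  have "integral\<^sup>L lborel (\<lambda>x. \<Sum>b\<in>Basis. f' b x b) = (\<Sum>b\<in>Basis. integral\<^sup>L lborel (\<lambda>x. f' b x b))"
    using integral_derivative_zero(1)[OF D L S] by (intro Bochner_Integration.integral_sum) auto
  also have "\<dots> = 0"
    using integral_derivative_zero(2)[OF D L S] by (intro sum.neutral) auto
  finally have "integral\<^sup>L lborel (\<lambda>x. \<Sum>b\<in>Basis. f' b x b) = 0" .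
  moreover have "(\<lambda>x. \<Sum>b\<in>Basis. f' b x b) = (\<lambda>x. indicator Om x *\<^sub>R (v x \<bullet> w' x))"
  proof
    fix x
    show "(\<Sum>b\<in>Basis. f' b x b) = indicator Om x *\<^sub>R (v x \<bullet> w' x)"
    proof (cases "x \<in> K")
      case True
      then have "(\<Sum>b\<in>Basis. f' b x b) = (\<Sum>b\<in>Basis. (v x \<bullet> b) * (w' x \<bullet> b)) + w x * div_of (Dv x)"
        by (simp add: f'_def sum.distrib sum_distrib_left div_of_def mult.commute)
      also have "\<dots> = v x \<bullet> w' x" using div[OF subsetD[OF K(2) True]] by (simp add: euclidean_inner[symmetric])
      finally show ?thesis using True K by auto
    next
      case False
      \<comment> \<open>The function w vanishes on the open set Om - K, so its given gradient is
        zero there as well and the two integrands agree off K.\<close>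
      have "w' x = 0" if xO: "x \<in> Om"
      proof -
        have "((\<lambda>x. 0::real) has_derivative (\<lambda>h. w' x \<bullet> h)) (at x)"
          by (rule has_derivative_transform_within_open[OF has_gradD[OF w(1)[OF xO]], of "Om - K"])
            (use False xO K(3) open_Om opK in \<open>auto intro: open_Diff compact_imp_closed[OF K(1)]\<close>)
        moreover have "((\<lambda>x. 0::real) has_derivative (\<lambda>h. 0)) (at x)" by simp
        ultimately have "(\<lambda>h. w' x \<bullet> h) = (\<lambda>h. 0)" by (rule has_derivative_unique)
        then have "w' x \<bullet> w' x = 0" by (rule fun_cong)
        then show ?thesis by simp
      qed
      then show ?thesis using False by (auto simp: f'_def indicator_def)
    qed
  qed
  ultimately show ?thesis by (simp add: set_lebesgue_integral_def)
qed

text \<open>The part of the compact piece where |u| >= k is compact and misses the frontier, so the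
  maximum of \<Theta> over it is negative; minus this maximum is the required \<epsilon>.\<close>

lemma boundary_vanishing_uniform:
  assumes u: "continuous_on X u" "\<And>x. x \<in> X \<Longrightarrow> snd x \<in> frontier \<omega> \<Longrightarrow> u x = (0::real)" and k: "k > 0"
  obtains \<epsilon> where "\<epsilon> > 0" "\<And>x. x \<in> Xslab T \<Longrightarrow> \<Theta> (snd x) > - \<epsilon> \<Longrightarrow> \<bar>u x\<bar> < k"
proof -
  define A where "A = {x \<in> Xslab T. k \<le> \<bar>u x\<bar>}"
  have "continuous_on (Xslab T) u" using u(1) Xslab_subset continuous_on_subset by blast
  then have "closedin (top_of_set (Xslab T)) (Xslab T \<inter> u -` {y. k \<le> \<bar>y\<bar>})"
    by (rule continuous_closedin_preimage) (intro closed_Collect_le continuous_intros)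
  moreover have "Xslab T \<inter> u -` {y. k \<le> \<bar>y\<bar>} = A" by (auto simp: A_def)
  ultimately have cA: "compact A" using closedin_compact[OF compact_Xslab] by metis
  show ?thesis
  proof (cases "A = {}")
    case True then show ?thesis using that[of 1] by (auto simp: A_def not_le)
  next
    case False
    have "continuous_on A (\<lambda>x. \<Theta> (snd x))"
      by (rule continuous_on_compose2[OF Theta_cont[of UNIV]]) (auto intro: continuous_intros)
    from continuous_attains_sup[OF cA False this]
    obtain x0 where x0: "x0 \<in> A" "\<And>x. x \<in> A \<Longrightarrow> \<Theta> (snd x) \<le> \<Theta> (snd x0)" by blast
    have xX: "x0 \<in> X" using x0 Xslab_subset by (auto simp: A_def)
    then have cl: "snd x0 \<in> closure \<omega>" by (auto simp: X_def mem_Times_iff)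
    have "u x0 \<noteq> 0" using x0(1) k by (auto simp: A_def)
    then have "\<Theta> (snd x0) \<noteq> 0" using u(2)[OF xX] frontier_eq_zero[OF cl] by auto
    then have neg: "\<Theta> (snd x0) < 0" using Theta_closure[OF cl] by simp
    show ?thesis
    proof (rule that[of "- \<Theta> (snd x0)"])
      show "\<bar>u x\<bar> < k" if "x \<in> Xslab T" "- (- \<Theta> (snd x0)) < \<Theta> (snd x)" for x
        using x0(2)[of x] that by (force simp: A_def)
    qed (use neg in simp)
  qed
qed

lemma continuous_snd_comp: "continuous_on UNIV f \<Longrightarrow> continuous_on S (\<lambda>x. f (snd x))"
  by (rule continuous_on_compose2[of UNIV f]) (auto intro: continuous_intros)

text \<open>The test function is multiplied by a step function of \<Theta> that vanishes next to the
  boundary, which makes the compactly supported case applicable. The extra term has size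
  1/\<epsilon> times v . grad \<Theta> on a set of volume O(\<epsilon>); tangency makes v . grad
  \<Theta> uniformly small there, so the term disappears in the limit.\<close>

theorem tangential_solenoidal:
  assumes v: "\<And>x. x \<in> Om \<Longrightarrow> (v has_derivative blinfun_apply (Dv x)) (at x)" "continuous_on Om Dv"
    and div: "\<And>x. x \<in> Om \<Longrightarrow> div_of (Dv x) = 0"
    and cv: "continuous_on X v"
    and tan: "\<And>x. x \<in> X \<Longrightarrow> snd x \<in> frontier \<omega> \<Longrightarrow> v x \<bullet> (0, \<Theta>' (snd x)) = 0"
  shows "solenoidal v"
  unfolding solenoidal_def
proof (intro conjI allI impI cv)
  fix \<phi> \<phi>' assume te: "test \<phi> \<phi>'"
  then obtain T0 where t: "continuous_on X \<phi>" "continuous_on X \<phi>'" "\<And>x. x \<in> Om \<Longrightarrow> has_grad \<phi> x (\<phi>' x)"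
    "\<And>x. x \<in> X \<Longrightarrow> \<bar>fst x\<bar> > T0 \<Longrightarrow> \<phi> x = 0 \<and> \<phi>' x = 0" unfolding test_def by blast
  define T where "T = max T0 0"
  have T: "T \<ge> 0" "\<And>x. x \<in> X \<Longrightarrow> \<bar>fst x\<bar> > T \<Longrightarrow> \<phi> x = 0 \<and> \<phi>' x = 0" using t(4) by (auto simp: T_def)
  obtain B where B: "B \<ge> 0" "\<forall>x\<in>Xslab T. norm (\<phi> x) \<le> B"
    using continuous_compact_bound[OF compact_Xslab continuous_on_subset[OF t(1) Xslab_subset]] by blast
  obtain C where C: "C \<ge> 0" "\<And>\<epsilon>. \<epsilon> > 0 \<Longrightarrow>
    measure lborel {x \<in> Om. \<bar>fst x\<bar> \<le> T \<and> - \<epsilon> < \<Theta> (snd x)} \<le> C * \<epsilon>"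
    "\<And>\<epsilon>. {x \<in> Om. \<bar>fst x\<bar> \<le> T \<and> - \<epsilon> < \<Theta> (snd x)} \<in> sets lborel"
    using boundary_layer[OF T(1)] by blast
  define u where "u x = v x \<bullet> (0, \<Theta>' (snd x))" for x
  have cu: "continuous_on X u" unfolding u_def
    by (intro continuous_intros cv continuous_snd_comp Theta'_cont)
  define \<epsilon> where "\<epsilon> n = 1 / real (Suc n)" for n
  have eps: "\<epsilon> n > 0" for n by (simp add: \<epsilon>_def)
  have eps0: "\<epsilon> \<longlonglongrightarrow> 0" unfolding \<epsilon>_def using LIMSEQ_inverse_real_of_nat by (simp add: inverse_eq_divide)
  \<comment> \<open>Nonpositive where \<Theta> >= -\<epsilon> and at least 1 where \<Theta> <= -2
    \<epsilon>: the transition happens in between, and 2 \<epsilon> is the thickness of the layer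
    that carries the error term.\<close>
  define s where "s n x = (- \<Theta> (snd x) - \<epsilon> n) / \<epsilon> n" for n and x :: "real \<times> 'a"
  define a where "a n x = step (s n x) * (v x \<bullet> \<phi>' x)" for n x
  define r where "r n x = \<phi> x * (step' (s n x) * (- 1 / \<epsilon> n)) * u x" for n x
  have cs: "continuous_on S (s n)" for n S
    unfolding s_def by (intro continuous_intros continuous_snd_comp Theta_cont) (use eps[of n] in auto)
  have ca: "continuous_on X (a n)" for n
    unfolding a_def by (intro continuous_intros cs t cv)
  have cr: "continuous_on X (r n)" for n
    unfolding r_def by (intro continuous_intros cs t cu) (use eps[of n] in auto)
  have ia: "set_integrable lborel Om (a n)" for n
    by (rule integrable_slab_support[OF ca, of T]) (use T in \<open>auto simp: a_def\<close>)
  have ir: "set_integrable lborel Om (r n)" for n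
    by (rule integrable_slab_support[OF cr, of T]) (use T in \<open>auto simp: r_def\<close>)
  have cf: "continuous_on X (\<lambda>x. v x \<bullet> \<phi>' x)" by (intro continuous_intros t cv)
  have ifn: "set_integrable lborel Om (\<lambda>x. v x \<bullet> \<phi>' x)"
    by (rule integrable_slab_support[OF cf, of T]) (use T in auto)
  have zero: "(LINT x:Om|lborel. a n x) + (LINT x:Om|lborel. r n x) = 0" for n
  proof -
    define w where "w x = step (s n x) * \<phi> x" for x
    define w' where "w' x = step (s n x) *\<^sub>R \<phi>' x + \<phi> x *\<^sub>R (step' (s n x) *\<^sub>R ((- 1 / \<epsilon> n) *\<^sub>R (0, \<Theta>' (snd x))))" for x
    have "(LINT x:Om|lborel. v x \<bullet> w' x) = 0"
    proof (rule divergence_theorem_compact_support[OF v div])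
      show "has_grad w x (w' x)" if x: "x \<in> Om" for x
      proof -
        have "has_grad (\<lambda>x. \<Theta> (snd x)) x (0, \<Theta>' (snd x))" by (rule has_grad_snd[OF Theta_grad])
        then have "has_grad (\<lambda>x. (- \<Theta> (snd x) - \<epsilon> n) / \<epsilon> n) x ((- 1 / \<epsilon> n) *\<^sub>R (0, \<Theta>' (snd x)))"
          by (rule has_grad_compose) (use eps[of n] in \<open>auto intro!: derivative_eq_intros\<close>)
        then have "has_grad (s n) x ((- 1 / \<epsilon> n) *\<^sub>R (0, \<Theta>' (snd x)))" by (simp add: s_def[abs_def])
        from has_grad_mult[OF has_grad_compose[OF this step_deriv] t(3)[OF x]]
        show ?thesis by (simp add: w_def[abs_def] w'_def)
      qed
      show "continuous_on Om w'" unfolding w'_def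
        by (intro continuous_intros cs continuous_on_subset[OF t(1) Om_subset_X]
            continuous_on_subset[OF t(2) Om_subset_X] continuous_snd_comp Theta'_cont) (use eps[of n] in auto)
      define K where "K = Xslab T \<inter> {x. \<Theta> (snd x) \<le> - \<epsilon> n}"
      show "compact K" unfolding K_def
        by (intro compact_Int_closed compact_Xslab closed_Collect_le continuous_snd_comp Theta_cont continuous_intros)
      show "K \<subseteq> Om" unfolding K_def using eps[of n] by (force simp: mem_Om)
      show "w x = 0" if "x \<in> Om - K" for x
      proof -
        have "x \<in> X" using that Om_subset_X by auto
        moreover have "x \<notin> Xslab T \<or> \<Theta> (snd x) > - \<epsilon> n" using that by (auto simp: K_def)
        moreover have "s n x \<le> 0" if "\<Theta> (snd x) > - \<epsilon> n" using that eps[of n] by (simp add: s_def divide_simps)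
        ultimately show ?thesis using T(2)[of x] by (auto simp: w_def step_eq_0 Xslab_eq)
      qed
    qed
    moreover have "v x \<bullet> w' x = a n x + r n x" for x
      by (simp add: a_def r_def w'_def u_def inner_add_right) (simp add: inner_prod_def)
    ultimately show ?thesis by (simp add: set_integral_add[OF ia ir])
  qed
  have step_le: "\<bar>step x\<bar> \<le> 1" for x using step_bounds[of x] by auto
  have lima: "(\<lambda>n. LINT x:Om|lborel. a n x) \<longlonglongrightarrow> (LINT x:Om|lborel. v x \<bullet> \<phi>' x)"
    unfolding set_lebesgue_integral_def
  proof (rule integral_dominated_convergence)
    show "integrable lborel (\<lambda>x. \<bar>indicator Om x *\<^sub>R (v x \<bullet> \<phi>' x)\<bar>)"
      using ifn unfolding set_integrable_def by (rule integrable_abs)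
    show "AE x in lborel. (\<lambda>n. indicator Om x *\<^sub>R a n x) \<longlonglongrightarrow> indicator Om x *\<^sub>R (v x \<bullet> \<phi>' x)"
    proof (rule AE_I2)
      fix x
      show "(\<lambda>n. indicator Om x *\<^sub>R a n x) \<longlonglongrightarrow> indicator Om x *\<^sub>R (v x \<bullet> \<phi>' x)"
      proof (cases "x \<in> Om")
        case True
        then have neg: "- \<Theta> (snd x) / 2 > 0" by (simp add: mem_Om)
        have "\<forall>\<^sub>F n in sequentially. indicator Om x *\<^sub>R a n x = indicator Om x *\<^sub>R (v x \<bullet> \<phi>' x)"
        proof (rule eventually_mono[OF order_tendstoD(2)[OF eps0 neg]])
          fix n assume "\<epsilon> n < - \<Theta> (snd x) / 2"
          then have "s n x \<ge> 1" using eps[of n] by (simp add: s_def divide_simps)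
          then show "indicator Om x *\<^sub>R a n x = indicator Om x *\<^sub>R (v x \<bullet> \<phi>' x)"
            by (simp add: a_def step_eq_1)
        qed
        then show ?thesis by (rule tendsto_eventually)
      qed auto
    qed
    show "AE x in lborel. norm (indicator Om x *\<^sub>R a n x) \<le> \<bar>indicator Om x *\<^sub>R (v x \<bullet> \<phi>' x)\<bar>" for n
      using step_le by (intro AE_I2) (auto simp: a_def indicator_def abs_mult mult_left_le_one_le)
    show "(\<lambda>x. indicator Om x *\<^sub>R a n x) \<in> borel_measurable lborel" for n
      using ia[of n] unfolding set_integrable_def by (rule borel_measurable_integrable)
    show "(\<lambda>x. indicator Om x *\<^sub>R (v x \<bullet> \<phi>' x)) \<in> borel_measurable lborel"
      using ifn unfolding set_integrable_def by (rule borel_measurable_integrable)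
  qed
  have limr: "(\<lambda>n. LINT x:Om|lborel. r n x) \<longlonglongrightarrow> 0"
  proof (rule LIMSEQ_I)
    fix e :: real assume e: "e > 0"
    \<comment> \<open>The error will be at most the volume 2 C \<epsilon> times the bound 4 B k /
      \<epsilon>, that is 8 B C k. The added ones keep the denominator positive and the final
      inequality strict.\<close>
    define k where "k = e / (8 * (B + 1) * (C + 1) + 1)"
    have k: "k > 0" using e B C by (auto simp: k_def intro!: divide_pos_pos add_nonneg_pos)
    obtain \<delta> where d: "\<delta> > 0" "\<And>x. x \<in> Xslab T \<Longrightarrow> \<Theta> (snd x) > - \<delta> \<Longrightarrow> \<bar>u x\<bar> < k"
      using boundary_vanishing_uniform[OF cu _ k, of T] tan unfolding u_def by blast
    have "\<forall>\<^sub>F n in sequentially. \<epsilon> n < \<delta> / 2" using d(1) by (intro order_tendstoD(2)[OF eps0]) auto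
    then obtain n0 where n0: "\<And>n. n \<ge> n0 \<Longrightarrow> \<epsilon> n < \<delta> / 2" unfolding eventually_sequentially by blast
    have "\<bar>LINT x:Om|lborel. r n x\<bar> < e" if n: "n \<ge> n0" for n
    proof -
      define Z where "Z = {x \<in> Om. \<bar>fst x\<bar> \<le> T \<and> - (2 * \<epsilon> n) < \<Theta> (snd x)}"
      define b where "b = B * (4 * (1 / \<epsilon> n)) * k"
      have Zm: "Z \<in> sets lborel" unfolding Z_def by (rule C(3))
      have "Z \<subseteq> Xslab T" using Om_subset_X by (auto simp: Z_def Xslab_eq)
      then have "bounded Z" using compact_imp_bounded[OF compact_Xslab] bounded_subset by blast
      then have iZ: "integrable lborel (\<lambda>x. indicator Z x * b)"
        using Zm by (intro integrable_mult_left integrable_real_indicator) (use emeasure_bounded_finite in auto)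
      have pt: "\<bar>indicator Om x *\<^sub>R r n x\<bar> \<le> indicator Z x * b" for x
      proof (cases "x \<in> Z")
        case True
        then have xs: "x \<in> Om" "x \<in> Xslab T" using Om_subset_X by (auto simp: Z_def Xslab_eq)
        have "\<Theta> (snd x) > - \<delta>" using True n0[OF n] by (auto simp: Z_def)
        then have "\<bar>u x\<bar> \<le> k" using d(2)[OF xs(2)] by simp
        moreover have "\<bar>\<phi> x\<bar> \<le> B" using B xs by auto
        moreover have "\<bar>step' (s n x)\<bar> \<le> 4" using step'_nonneg step'_le by simp
        ultimately have "\<bar>r n x\<bar> \<le> b" unfolding r_def b_def abs_mult
          using B eps[of n] by (intro mult_mono) (auto intro!: divide_right_mono mult_nonneg_nonneg)
        then show ?thesis using True xs by simp
      next
        case False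
        have "r n x = 0" if x: "x \<in> Om"
        proof (cases "\<bar>fst x\<bar> \<le> T")
          case True
          then have "\<Theta> (snd x) \<le> - (2 * \<epsilon> n)" using False x by (auto simp: Z_def)
          then have "s n x \<ge> 1" using eps[of n] by (simp add: s_def divide_simps)
          then show ?thesis by (simp add: r_def step'_eq_0')
        next
          case False
          then show ?thesis using T(2)[of x] x Om_subset_X by (auto simp: r_def)
        qed
        then show ?thesis using False by (auto simp: indicator_def)
      qed
      have "\<bar>LINT x:Om|lborel. r n x\<bar> \<le> integral\<^sup>L lborel (\<lambda>x. \<bar>indicator Om x *\<^sub>R r n x\<bar>)"
        unfolding set_lebesgue_integral_def by (rule integral_abs_bound)
      also have "\<dots> \<le> integral\<^sup>L lborel (\<lambda>x. indicator Z x * b)"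
        using ir[of n] iZ pt unfolding set_integrable_def by (intro integral_mono) auto
      also have "\<dots> = measure lborel Z * b" by simp
      also have "\<dots> \<le> (C * (2 * \<epsilon> n)) * b"
        unfolding Z_def using C(2)[of "2 * \<epsilon> n"] eps[of n] B k by (intro mult_right_mono) (auto simp: b_def)
      also have "\<dots> = 8 * B * C * k" using eps[of n] by (simp add: b_def)
      also have "\<dots> < e"
      proof -
        have "8 * B * C \<le> 8 * (B + 1) * (C + 1)" using B C by (simp add: algebra_simps)
        then have "8 * B * C < 8 * (B + 1) * (C + 1) + 1" by linarith
        then have "8 * B * C * k < (8 * (B + 1) * (C + 1) + 1) * k" using k by (rule mult_strict_right_mono)
        also have "\<dots> = e" using B C by (simp add: k_def) (smt (verit) mult_nonneg_nonneg)
        finally show ?thesis .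
      qed
      finally show ?thesis .
    qed
    then show "\<exists>n0. \<forall>n\<ge>n0. norm ((LINT x:Om|lborel. r n x) - 0) < e" by auto
  qed
  have "(\<lambda>n. (LINT x:Om|lborel. a n x) + (LINT x:Om|lborel. r n x)) \<longlonglongrightarrow> (LINT x:Om|lborel. v x \<bullet> \<phi>' x) + 0"
    by (rule tendsto_add[OF lima limr])
  then show "(LINT x:Om|lborel. v x \<bullet> \<phi>' x) = 0" unfolding zero by (simp add: LIMSEQ_const_iff)
qed

subsection \<open>Ascending deformations\<close>

lemma abs_fst_le_norm: "\<bar>fst (x :: real \<times> 'b::real_normed_vector)\<bar> \<le> norm x"
  by (metis norm_fst_le prod.collapse real_norm_def)

lemma norm_scaleR_le_double: "0 \<le> s \<Longrightarrow> s \<le> a \<Longrightarrow> norm w \<le> 2 \<Longrightarrow> norm (s *\<^sub>R w) \<le> a * 2"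
  using mult_mono[of s a "norm w" 2] by simp

lemma section_bound:
  assumes "continuous_on X \<psi>"
  obtains C where "C \<ge> (0::real)" "\<And>x. x \<in> Xslab R \<Longrightarrow> \<bar>\<psi> x\<bar> \<le> C"
  using continuous_compact_bound[OF compact_Xslab continuous_on_subset[OF assms Xslab_subset], of R]
  by (metis real_norm_def)

end

locale potential_flow = cylinder \<omega> \<Theta> \<Theta>'
  for \<omega> :: "'a::euclidean_space set" and \<Theta> :: "'a \<Rightarrow> real" and \<Theta>' :: "'a \<Rightarrow> 'a" +
  fixes v :: "real \<times> 'a \<Rightarrow> real \<times> 'a" and \<psi> :: "real \<times> 'a \<Rightarrow> real" and \<delta> :: real
  assumes v: "continuous_on X v" and psi: "continuous_on X \<psi>" "\<And>x. x \<in> Om \<Longrightarrow> has_grad \<psi> x (v x)"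
    and stag: "\<delta> > 0" "\<And>x. x \<in> X \<Longrightarrow> norm (v x) \<ge> \<delta>"
    and tan: "\<And>x. x \<in> X \<Longrightarrow> snd x \<in> frontier \<omega> \<Longrightarrow> v x \<bullet> (0, \<Theta>' (snd x)) = 0"
begin


text \<open>The gradient is merely continuous up to the boundary, so it has no flow there. Instead it is tilted slightly
  inwards, and every compact set is deformed upwards by Euler steps of one common length.\<close>

lemma ascending_field:
  obtains W where "continuous_on X W" "\<And>x. x \<in> X \<Longrightarrow> norm (W x) \<le> 2"
    "\<And>x. x \<in> X \<Longrightarrow> v x \<bullet> W x \<ge> \<delta> / 2"
    "\<And>x. x \<in> X \<Longrightarrow> snd x \<in> frontier \<omega> \<Longrightarrow> (0, \<Theta>' (snd x)) \<bullet> W x < 0"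
proof -
  have "compact (closure \<omega>)" using bounded_omega by simp
  moreover have "continuous_on (closure \<omega>) \<Theta>'" using Theta'_cont continuous_on_subset by blast
  ultimately obtain M where M: "M \<ge> 0" "\<forall>y\<in>closure \<omega>. norm (\<Theta>' y) \<le> M"
    using continuous_compact_bound by blast
  \<comment> \<open>The tilt has norm at most 1/2, so at least half of the ascent remains. On the
    frontier v is tangential, and the tilt alone contributes -k |\<Theta>'|^2, which is
    negative.\<close>
  define k where "k = 1 / (2 * (M + 1))"
  have k: "k > 0" "k * M \<le> 1 / 2" using M by (auto simp: k_def field_simps)
  define W where "W x = (1 / norm (v x)) *\<^sub>R v x - k *\<^sub>R (0, \<Theta>' (snd x))" for x
  have nz: "norm (v x) > 0" if "x \<in> X" for x
    using stag(1) stag(2)[OF that] by linarith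
  have nT: "norm (k *\<^sub>R (0::real, \<Theta>' (snd x))) \<le> 1 / 2" if "x \<in> X" for x
  proof -
    have "snd x \<in> closure \<omega>" using that by (auto simp: X_def mem_Times_iff)
    then have "k * norm (\<Theta>' (snd x)) \<le> k * M" using M k by (intro mult_left_mono) auto
    moreover have "norm (k *\<^sub>R (0::real, \<Theta>' (snd x))) = k * norm (\<Theta>' (snd x))"
      using k by (simp add: norm_Pair)
    ultimately show ?thesis using k by linarith
  qed
  show ?thesis
  proof (rule that[of W])
    show "continuous_on X W" unfolding W_def
      by (intro continuous_intros v continuous_snd_comp Theta'_cont) (use nz in force)
    fix x assume x: "x \<in> X"
    have "norm (W x) \<le> norm ((1 / norm (v x)) *\<^sub>R v x) + norm (k *\<^sub>R (0::real, \<Theta>' (snd x)))"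
      unfolding W_def by (rule norm_triangle_ineq4)
    then show "norm (W x) \<le> 2" using nT[OF x] nz[OF x] by simp
    have "v x \<bullet> (k *\<^sub>R (0, \<Theta>' (snd x))) \<le> norm (v x) * (1 / 2)"
      using norm_cauchy_schwarz[of "v x" "k *\<^sub>R (0, \<Theta>' (snd x))"] mult_left_mono[OF nT[OF x], of "norm (v x)"]
      by simp
    moreover have "v x \<bullet> ((1 / norm (v x)) *\<^sub>R v x) = norm (v x)"
      using nz[OF x] by (simp add: dot_square_norm power2_eq_square)
    ultimately have "v x \<bullet> W x \<ge> norm (v x) / 2" unfolding W_def inner_diff_right by simp
    then show "v x \<bullet> W x \<ge> \<delta> / 2" using stag(2)[OF x] by simp
    show "(0, \<Theta>' (snd x)) \<bullet> W x < 0" if "snd x \<in> frontier \<omega>"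
    proof -
      have "(0, \<Theta>' (snd x)) \<bullet> W x = - k * (norm (\<Theta>' (snd x)))\<^sup>2"
        using tan[OF x that] unfolding W_def inner_diff_right
        by (simp add: inner_commute[of _ "v x"] dot_square_norm)
      then show ?thesis using k Theta'_nz[OF that] by simp
    qed
  qed
qed

text \<open>A short step lands inside: near interior points by openness, near frontier points
  because \<Theta> strictly decreases along W. The direction is frozen at x while the gradient is
  evaluated further along the segment; continuity limits the resulting loss, and the rate drops from
  \<delta> / 2 to \<delta> / 4.\<close>

lemma euler_step_local:
  assumes W: "continuous_on X W" "\<And>x. x \<in> X \<Longrightarrow> norm (W x) \<le> 2"
    "\<And>x. x \<in> X \<Longrightarrow> v x \<bullet> W x \<ge> \<delta> / 2"
    "\<And>x. x \<in> X \<Longrightarrow> snd x \<in> frontier \<omega> \<Longrightarrow> (0, \<Theta>' (snd x)) \<bullet> W x < 0"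
    and x0: "x0 \<in> X"
  shows "\<exists>U s0. open U \<and> x0 \<in> U \<and> s0 > 0 \<and> (\<forall>x\<in>U \<inter> X. \<forall>s\<in>{0..s0}.
     x + s *\<^sub>R W x \<in> X \<and> \<psi> (x + s *\<^sub>R W x) \<ge> \<psi> x + s * (\<delta> / 4))"
proof -
  have snd0: "snd x0 \<in> closure \<omega>" using x0 by (auto simp: X_def mem_Times_iff)
  have "\<exists>r>0. \<forall>x\<in>X. \<forall>s. dist x x0 < r \<longrightarrow> 0 < s \<longrightarrow> s < r \<longrightarrow> x + s *\<^sub>R W x \<in> Om"
  proof (cases "snd x0 \<in> \<omega>")
    case True
    then have "x0 \<in> Om" using mem_Om mem_omega by blast
    then obtain r where r: "r > 0" "ball x0 r \<subseteq> Om" using open_Om open_contains_ball by blast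
    have "x + s *\<^sub>R W x \<in> Om" if "x \<in> X" "dist x x0 < r / 4" "0 < s" "s < r / 4" for x s
    proof -
      have "norm (s *\<^sub>R W x) \<le> (r / 4) * 2" using that W(2)[OF that(1)] by (intro norm_scaleR_le_double) auto
      then have "dist x0 (x + s *\<^sub>R W x) < r"
        using that r dist_triangle[of x0 "x + s *\<^sub>R W x" x] by (simp add: dist_commute dist_norm)
      then show ?thesis using r by auto
    qed
    then show ?thesis using r by (intro exI[of _ "r / 4"]) auto
  next
    case False
    then have fr: "snd x0 \<in> frontier \<omega>" using snd0 frontier_iff by blast
    \<comment> \<open>Two independent arguments, one for the point where W is frozen and one for the
      point where the gradient of \<Theta> is taken; continuity at the diagonal point (x0, x0)
      controls both together.\<close>
    define h where "h z = (0, \<Theta>' (snd (snd z))) \<bullet> W (fst z)" for z :: "(real \<times> 'a) \<times> (real \<times> 'a)"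
    have ch: "continuous_on (X \<times> UNIV) h" unfolding h_def
      by (intro continuous_intros continuous_on_compose2[OF W(1)] continuous_on_compose2[OF Theta'_cont]) auto
    have "(x0, x0) \<in> X \<times> UNIV" using x0 by auto
    moreover have "h (x0, x0) < 0" using W(4)[OF x0 fr] by (simp add: h_def)
    ultimately obtain r where r: "r > 0" "\<And>z. z \<in> X \<times> UNIV \<Longrightarrow> dist z (x0, x0) < r \<Longrightarrow> dist (h z) (h (x0, x0)) < - h (x0, x0)"
      using ch unfolding continuous_on_iff by (metis neg_0_less_iff_less)
    have hneg: "h z < 0" if "z \<in> X \<times> UNIV" "dist z (x0, x0) < r" for z
      using r(2)[OF that] by (simp add: dist_real_def abs_if split: if_splits)
    have "x + s *\<^sub>R W x \<in> Om" if x: "x \<in> X" "dist x x0 < r / 8" and s: "0 < s" "s < r / 8" for x s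
    proof -
      have D: "((\<lambda>t. \<Theta> (snd (x + t *\<^sub>R W x))) has_real_derivative (0, \<Theta>' (snd (x + t *\<^sub>R W x))) \<bullet> W x) (at t)" for t
        by (rule has_grad_line[OF has_grad_snd[OF Theta_grad]])
      have "\<exists>t>0. t < s \<and> \<Theta> (snd (x + s *\<^sub>R W x)) - \<Theta> (snd (x + 0 *\<^sub>R W x)) = (s - 0) * ((0, \<Theta>' (snd (x + t *\<^sub>R W x))) \<bullet> W x)"
        by (rule MVT2[OF s(1) D])
      then obtain t where t: "0 < t" "t < s"
        "\<Theta> (snd (x + s *\<^sub>R W x)) - \<Theta> (snd x) = s * h (x, x + t *\<^sub>R W x)" by (auto simp: h_def)
      have "norm (t *\<^sub>R W x) \<le> (r / 8) * 2" using t s W(2)[OF x(1)] by (intro norm_scaleR_le_double) auto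
      then have "dist (x + t *\<^sub>R W x) x0 \<le> r / 8 + r / 4"
        using x dist_triangle[of "x + t *\<^sub>R W x" x0 x] by (simp add: dist_commute dist_norm)
      then have "dist (x, x + t *\<^sub>R W x) (x0, x0) < r"
        using x r dist_Pair_Pair[of x "x + t *\<^sub>R W x" x0 x0]
          sqrt_sum_squares_le_sum[of "dist x x0" "dist (x + t *\<^sub>R W x) x0"] by simp
      then have "h (x, x + t *\<^sub>R W x) < 0" using x by (intro hneg) auto
      then have "s * h (x, x + t *\<^sub>R W x) < 0" using s by (simp add: mult_pos_neg)
      moreover have "\<Theta> (snd x) \<le> 0" using x(1) by (intro Theta_closure) (auto simp: X_def mem_Times_iff)
      ultimately show ?thesis using t(3) by (simp add: mem_Om)
    qed
    then show ?thesis using r by (intro exI[of _ "r / 8"]) auto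
  qed
  then obtain r1 where r1: "r1 > 0" "\<And>x s. x \<in> X \<Longrightarrow> dist x x0 < r1 \<Longrightarrow> 0 < s \<Longrightarrow> s < r1 \<Longrightarrow> x + s *\<^sub>R W x \<in> Om"
    by blast
  define g where "g z = v (snd z) \<bullet> W (fst z)" for z :: "(real \<times> 'a) \<times> (real \<times> 'a)"
  have cg: "continuous_on (X \<times> X) g" unfolding g_def
    by (intro continuous_intros continuous_on_compose2[OF W(1)] continuous_on_compose2[OF v]) auto
  have "(x0, x0) \<in> X \<times> X" using x0 by auto
  then obtain r2 where r2: "r2 > 0" "\<And>z. z \<in> X \<times> X \<Longrightarrow> dist z (x0, x0) < r2 \<Longrightarrow> dist (g z) (g (x0, x0)) < \<delta> / 4"
    using cg stag(1) unfolding continuous_on_iff by (metis zero_less_divide_iff zero_less_numeral)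
  have gpos: "g z \<ge> \<delta> / 4" if "z \<in> X \<times> X" "dist z (x0, x0) < r2" for z
    using r2(2)[OF that] W(3)[OF x0] unfolding dist_real_def g_def fst_conv snd_conv by linarith
  define r where "r = min r1 (r2 / 8)"
  have r: "r > 0" "r \<le> r1" "r \<le> r2 / 8" using r1 r2 by (auto simp: r_def)
  have "x + s *\<^sub>R W x \<in> X \<and> \<psi> (x + s *\<^sub>R W x) \<ge> \<psi> x + s * (\<delta> / 4)"
    if x: "x \<in> ball x0 r" "x \<in> X" and s: "s \<in> {0..r / 2}" for x s
  proof (cases "s = 0")
    case True then show ?thesis using x by simp
  next
    case False
    then have s0: "0 < s" "s < r" using s r by auto
    have xd: "dist x x0 < r" using x by (simp add: dist_commute)
    have inO: "x + t *\<^sub>R W x \<in> Om" if "0 < t" "t \<le> s" for t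
      using that s0 r xd x by (intro r1) auto
    have inX: "x + t *\<^sub>R W x \<in> X" if "0 \<le> t" "t \<le> s" for t
      using inO[of t] that x Om_subset_X by (cases "t = 0") auto
    have "continuous_on {0..s} (\<lambda>t. \<psi> (x + t *\<^sub>R W x))"
      by (rule continuous_on_compose2[OF psi(1)]) (use inX in \<open>auto intro!: continuous_intros\<close>)
    moreover have D: "((\<lambda>t. \<psi> (x + t *\<^sub>R W x)) has_real_derivative v (x + t *\<^sub>R W x) \<bullet> W x) (at t)"
      if "0 < t" "t < s" for t
      using that by (intro has_grad_line psi(2) inO) auto
    ultimately obtain l t where t: "0 < t" "t < s" "((\<lambda>t. \<psi> (x + t *\<^sub>R W x)) has_real_derivative l) (at t)"
      "\<psi> (x + s *\<^sub>R W x) - \<psi> (x + 0 *\<^sub>R W x) = (s - 0) * l"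
      using MVT[OF s0(1), of "\<lambda>t. \<psi> (x + t *\<^sub>R W x)"] real_differentiable_def by blast
    have l: "l = g (x, x + t *\<^sub>R W x)" using DERIV_unique[OF t(3) D[OF t(1,2)]] by (simp add: g_def)
    have "norm (t *\<^sub>R W x) \<le> r * 2" using t s0 W(2)[OF x(2)] by (intro norm_scaleR_le_double) auto
    then have "dist (x + t *\<^sub>R W x) x0 \<le> 3 * r"
      using xd dist_triangle[of "x + t *\<^sub>R W x" x0 x] by (simp add: dist_commute dist_norm)
    then have "dist (x, x + t *\<^sub>R W x) (x0, x0) < r2"
      using xd r r2 dist_Pair_Pair[of x "x + t *\<^sub>R W x" x0 x0]
        sqrt_sum_squares_le_sum[of "dist x x0" "dist (x + t *\<^sub>R W x) x0"] by simp
    then have "l \<ge> \<delta> / 4" unfolding l using x inX[of t] t by (intro gpos) auto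
    then have "s * l \<ge> s * (\<delta> / 4)" using s0 by (intro mult_left_mono) auto
    moreover have "\<psi> (x + s *\<^sub>R W x) - \<psi> x = s * l" using t(4) by simp
    ultimately show ?thesis using inX[of s] s0 by (intro conjI) linarith+
  qed
  then show ?thesis using r by (intro exI[of _ "ball x0 r"] exI[of _ "r / 2"]) auto
qed

text \<open>Euler steps of total time \<tau> = 4 c / \<delta>: the rate \<delta> / 4 produces the
  rise c, and the speed bound 2 produces the displacement 8 c / \<delta>. The last clause exploits
  that the potential never falls within a step either: a polygonal path that changes sides meets the
  section \<open>fst y = 0\<close> by the intermediate value theorem, at a height not below that of
  its starting point.\<close>

lemma ascending_deformation:
  assumes c: "c \<ge> 0"
  obtains f where "continuous_on (Xslab R) f" "\<And>x. x \<in> Xslab R \<Longrightarrow> f x \<in> X"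
    "\<And>x. x \<in> Xslab R \<Longrightarrow> \<psi> (f x) \<ge> \<psi> x + c" "\<And>x. x \<in> Xslab R \<Longrightarrow> norm (f x - x) \<le> 8 * c / \<delta>"
    "\<And>x. x \<in> Xslab R \<Longrightarrow> fst x * fst (f x) \<le> 0 \<Longrightarrow> \<exists>y\<in>X. fst y = 0 \<and> \<psi> y \<ge> \<psi> x"
proof -
  obtain W where W: "continuous_on X W" "\<And>x. x \<in> X \<Longrightarrow> norm (W x) \<le> 2"
    "\<And>x. x \<in> X \<Longrightarrow> v x \<bullet> W x \<ge> \<delta> / 2"
    "\<And>x. x \<in> X \<Longrightarrow> snd x \<in> frontier \<omega> \<Longrightarrow> (0, \<Theta>' (snd x)) \<bullet> W x < 0"
    using ascending_field by blast
  define \<tau> where "\<tau> = 4 * c / \<delta>"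
  have tau: "\<tau> \<ge> 0" using c stag by (simp add: \<tau>_def)
  \<comment> \<open>The paths starting in \<open>Xslab R\<close> remain in this larger compact
    piece, on which one step length serves all points.\<close>
  define K where "K = Xslab (R + 2 * \<tau>)"
  define P where "P A = (\<exists>s0>0. \<forall>x\<in>A \<inter> X. \<forall>s\<in>{0..s0}. x + s *\<^sub>R W x \<in> X \<and> \<psi> (x + s *\<^sub>R W x) \<ge> \<psi> x + s * (\<delta> / 4))" for A
  have "P K"
  proof (rule compact_local_induct)
    show "compact K" unfolding K_def by (rule compact_Xslab)
    show "\<exists>U. open U \<and> x \<in> U \<and> P U" if "x \<in> K" for x
      using euler_step_local[OF W, of x] that Xslab_subset unfolding P_def K_def by blast
    show "P {}" unfolding P_def by (auto intro: exI[of _ 1])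
    show "P A" if "P B" "A \<subseteq> B" for A B using that unfolding P_def by blast
    show "P (A \<union> B)" if A: "P A" and B: "P B" for A B
    proof -
      from A obtain s1 where 1: "s1 > 0" "\<And>x s. x \<in> A \<inter> X \<Longrightarrow> s \<in> {0..s1} \<Longrightarrow>
        x + s *\<^sub>R W x \<in> X \<and> \<psi> (x + s *\<^sub>R W x) \<ge> \<psi> x + s * (\<delta> / 4)" unfolding P_def by blast
      from B obtain s2 where 2: "s2 > 0" "\<And>x s. x \<in> B \<inter> X \<Longrightarrow> s \<in> {0..s2} \<Longrightarrow>
        x + s *\<^sub>R W x \<in> X \<and> \<psi> (x + s *\<^sub>R W x) \<ge> \<psi> x + s * (\<delta> / 4)" unfolding P_def by blast
      show ?thesis unfolding P_def
      proof (intro exI[of _ "min s1 s2"] conjI ballI)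
        fix x s assume x: "x \<in> (A \<union> B) \<inter> X" and s: "s \<in> {0..min s1 s2}"
        have "x + s *\<^sub>R W x \<in> X \<and> \<psi> (x + s *\<^sub>R W x) \<ge> \<psi> x + s * (\<delta> / 4)"
          using 1(2)[of x s] 2(2)[of x s] x s by auto
        then show "x + s *\<^sub>R W x \<in> X" "\<psi> x + s * (\<delta> / 4) \<le> \<psi> (x + s *\<^sub>R W x)" by auto
      qed (use 1 2 in auto)
    qed
  qed
  then obtain s0 where s0: "s0 > 0" "\<And>x s. x \<in> K \<Longrightarrow> s \<in> {0..s0} \<Longrightarrow>
    x + s *\<^sub>R W x \<in> X \<and> \<psi> (x + s *\<^sub>R W x) \<ge> \<psi> x + s * (\<delta> / 4)"
    unfolding P_def using Xslab_subset K_def by (metis IntI subsetD)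
  obtain n where n: "real n > \<tau> / s0" "n > 0" using reals_Archimedean2[of "max (\<tau> / s0) 0"] by auto
  define s where "s = \<tau> / real n"
  have s: "0 \<le> s" "s \<le> s0" "real n * s = \<tau>"
    using n s0 tau by (auto simp: s_def field_simps)
  define g where "g x = x + s *\<^sub>R W x" for x
  define G where "G i = g ^^ i" for i
  have step: "x + t *\<^sub>R W x \<in> X \<and> \<psi> (x + t *\<^sub>R W x) \<ge> \<psi> x + t * (\<delta> / 4)" if "x \<in> K" "0 \<le> t" "t \<le> s" for x t
    using s0(2)[OF that(1), of t] that s by auto
  have main: "i \<le> n \<Longrightarrow> continuous_on (Xslab R) (G i) \<and> (\<forall>x\<in>Xslab R. G i x \<in> X \<and> norm (G i x - x) \<le> 2 * (real i * s) \<and>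
     \<psi> (G i x) \<ge> \<psi> x + real i * s * (\<delta> / 4) \<and> (fst x * fst (G i x) \<le> 0 \<longrightarrow> (\<exists>y\<in>X. fst y = 0 \<and> \<psi> y \<ge> \<psi> x)))" for i
  proof (induction i)
    case 0
    have "fst x = 0" if "fst x * fst x \<le> 0" for x :: "real \<times> 'a" using that by (auto simp: mult_le_0_iff)
    moreover have "G 0 = (\<lambda>x. x)" by (simp add: G_def id_def)
    ultimately show ?case using Xslab_subset[of R] by (auto intro!: bexI)
  next
    case (Suc i)
    then have IH: "continuous_on (Xslab R) (G i)" "\<And>x. x \<in> Xslab R \<Longrightarrow> G i x \<in> X"
      "\<And>x. x \<in> Xslab R \<Longrightarrow> norm (G i x - x) \<le> 2 * (real i * s)"
      "\<And>x. x \<in> Xslab R \<Longrightarrow> \<psi> (G i x) \<ge> \<psi> x + real i * s * (\<delta> / 4)"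
      "\<And>x. x \<in> Xslab R \<Longrightarrow> fst x * fst (G i x) \<le> 0 \<Longrightarrow> \<exists>y\<in>X. fst y = 0 \<and> \<psi> y \<ge> \<psi> x" by auto
    have GS: "G (Suc i) x = G i x + s *\<^sub>R W (G i x)" for x by (simp add: G_def g_def)
    have iK: "G i x \<in> K" if x: "x \<in> Xslab R" for x
    proof -
      have "real i * s \<le> \<tau>" using Suc.prems s(1) unfolding s(3)[symmetric] by (intro mult_right_mono) auto
      then have "norm (G i x - x) \<le> 2 * \<tau>" using IH(3)[OF x] by simp
      then have "\<bar>fst (G i x) - fst x\<bar> \<le> 2 * \<tau>" using abs_fst_le_norm[of "G i x - x"] by simp
      then show ?thesis using x IH(2)[OF x] unfolding K_def Xslab_eq by auto
    qed
    have "continuous_on (Xslab R) (G (Suc i))" unfolding GS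
      by (intro continuous_intros IH(1) continuous_on_compose2[OF W(1)]) (use IH(2) in auto)
    moreover have "G (Suc i) x \<in> X \<and> norm (G (Suc i) x - x) \<le> 2 * (real (Suc i) * s) \<and>
      \<psi> (G (Suc i) x) \<ge> \<psi> x + real (Suc i) * s * (\<delta> / 4) \<and>
      (fst x * fst (G (Suc i) x) \<le> 0 \<longrightarrow> (\<exists>y\<in>X. fst y = 0 \<and> \<psi> y \<ge> \<psi> x))" if x: "x \<in> Xslab R" for x
    proof (intro conjI impI)
      show "G (Suc i) x \<in> X" using step[OF iK[OF x], of s] s by (simp add: GS)
      have "norm (s *\<^sub>R W (G i x)) \<le> s * 2" using W(2)[OF IH(2)[OF x]] s by (intro norm_scaleR_le_double) auto
      then show "norm (G (Suc i) x - x) \<le> 2 * (real (Suc i) * s)"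
        using IH(3)[OF x] norm_triangle_ineq[of "G i x - x" "s *\<^sub>R W (G i x)"]
        by (simp add: GS algebra_simps)
      have "\<psi> (G (Suc i) x) \<ge> \<psi> (G i x) + s * (\<delta> / 4)" using step[OF iK[OF x], of s] s by (simp add: GS)
      then show "\<psi> (G (Suc i) x) \<ge> \<psi> x + real (Suc i) * s * (\<delta> / 4)"
        using IH(4)[OF x] by (simp add: algebra_simps add_divide_distrib)
      assume cross: "fst x * fst (G (Suc i) x) \<le> 0"
      show "\<exists>y\<in>X. fst y = 0 \<and> \<psi> y \<ge> \<psi> x"
      proof (cases "fst x * fst (G i x) \<le> 0")
        case True then show ?thesis using IH(5)[OF x] by blast
      next
        case False
        define k where "k t = fst x * fst (G i x + t *\<^sub>R W (G i x))" for t
        have "continuous_on {0..s} k" unfolding k_def by (intro continuous_intros)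
        moreover have "k s \<le> 0" "0 \<le> k 0" using cross False by (auto simp: k_def GS)
        ultimately obtain t where t: "0 \<le> t" "t \<le> s" "k t = 0" using IVT2'[of k s 0 0] s(1) by blast
        have "fst x \<noteq> 0" using False by auto
        then have "fst (G i x + t *\<^sub>R W (G i x)) = 0" using t(3) by (simp add: k_def)
        moreover have "\<psi> (G i x + t *\<^sub>R W (G i x)) \<ge> \<psi> (G i x) + t * (\<delta> / 4)" "G i x + t *\<^sub>R W (G i x) \<in> X"
          using step[OF iK[OF x] t(1,2)] by auto
        moreover have "t * (\<delta> / 4) \<ge> 0" "real i * s * (\<delta> / 4) \<ge> 0" using t s stag by auto
        ultimately show ?thesis using IH(4)[OF x] by (intro bexI[of _ "G i x + t *\<^sub>R W (G i x)"]) auto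
      qed
    qed
    ultimately show ?case by blast
  qed
  have eqs: "real n * s * (\<delta> / 4) = c" "2 * (real n * s) = 8 * c / \<delta>" using stag by (auto simp: s(3) \<tau>_def)
  show ?thesis by (rule that[of "G n"]) (use main[of n, unfolded eqs] in blast)+
qed

text \<open>With B bounding the potential on the compact piece and C on the section
  \<open>fst x = 0\<close>, a rise by C + B + 1 puts every image above C and hence off the section;
  connectedness then leaves all images on one side. A point that started on the other side has
  crossed the section, so its value is at most C, a bound independent of the piece.\<close>

lemma bounded_above_on_one_side:
  assumes conn: "connected \<omega>"
  obtains C \<sigma> where "\<sigma> = 1 \<or> \<sigma> = (-1::real)" "\<And>x. x \<in> X \<Longrightarrow> \<sigma> * fst x \<ge> 0 \<Longrightarrow> \<psi> x \<le> C"
proof -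
  obtain C where C: "C \<ge> 0" "\<And>x. x \<in> Xslab 0 \<Longrightarrow> \<bar>\<psi> x\<bar> \<le> C" using section_bound[OF psi(1)] by blast
  have C0: "\<psi> x \<le> C" if "x \<in> X" "fst x = 0" for x using C(2)[of x] that by (auto simp: Xslab_eq)
  have step: "\<exists>\<sigma>. (\<sigma> = 1 \<or> \<sigma> = (-1::real)) \<and> (\<forall>x\<in>Xslab R. \<sigma> * fst x \<ge> 0 \<longrightarrow> \<psi> x \<le> C)" for R
  proof (cases "Xslab R = {}")
    case False
    obtain B where B: "B \<ge> 0" "\<And>x. x \<in> Xslab R \<Longrightarrow> \<bar>\<psi> x\<bar> \<le> B" using section_bound[OF psi(1)] by blast
    have "C + B + 1 \<ge> 0" using B C by simp
    obtain f where f: "continuous_on (Xslab R) f" "\<And>x. x \<in> Xslab R \<Longrightarrow> f x \<in> X"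
      "\<And>x. x \<in> Xslab R \<Longrightarrow> \<psi> (f x) \<ge> \<psi> x + (C + B + 1)"
      "\<And>x. x \<in> Xslab R \<Longrightarrow> norm (f x - x) \<le> 8 * (C + B + 1) / \<delta>"
      "\<And>x. x \<in> Xslab R \<Longrightarrow> fst x * fst (f x) \<le> 0 \<Longrightarrow> \<exists>y\<in>X. fst y = 0 \<and> \<psi> y \<ge> \<psi> x"
      by (rule ascending_deformation[OF \<open>C + B + 1 \<ge> 0\<close>]) blast+
    have nz: "fst (f x) \<noteq> 0" if "x \<in> Xslab R" for x
      using C0[OF f(2)[OF that]] f(3)[OF that] B(2)[OF that] by force
    have "connected (Xslab R)" unfolding Xslab_def using conn by (intro connected_Times connected_imp_connected_closure) auto
    then have "connected ((\<lambda>x. fst (f x)) ` Xslab R)"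
      by (intro connected_continuous_image continuous_intros f)
    then have "(\<forall>x\<in>Xslab R. fst (f x) > 0) \<or> (\<forall>x\<in>Xslab R. fst (f x) < 0)"
      using nz unfolding connected_iff_interval by (smt (verit, best) image_iff)
    then obtain \<sigma> where \<sigma>: "\<sigma> = 1 \<or> \<sigma> = (-1::real)" "\<And>x. x \<in> Xslab R \<Longrightarrow> \<sigma> * fst (f x) < 0"
      by (metis mult_1 mult_minus1 neg_less_0_iff_less)
    have "\<psi> x \<le> C" if x: "x \<in> Xslab R" "\<sigma> * fst x \<ge> 0" for x
    proof -
      have "fst x * fst (f x) \<le> 0" using \<sigma>(1) \<sigma>(2)[OF x(1)] x(2) by (auto simp: mult_le_0_iff)
      then show ?thesis using f(5)[OF x(1)] C0 by force
    qed
    then show ?thesis using \<sigma> by blast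
  qed auto
  \<comment> \<open>The side obtained for a piece may depend on the piece. Since the pieces are
    nested, a failure of the right side at n and of the left side at m would make both fail at the
    larger of n and m.\<close>
  have "(\<forall>n::nat. \<forall>x\<in>Xslab (real n). 1 * fst x \<ge> 0 \<longrightarrow> \<psi> x \<le> C) \<or> (\<forall>n::nat. \<forall>x\<in>Xslab (real n). -1 * fst x \<ge> 0 \<longrightarrow> \<psi> x \<le> C)"
  proof (rule ccontr)
    assume "\<not> ?thesis"
    then obtain n m :: nat and x y where
      n: "x \<in> Xslab (real n)" "1 * fst x \<ge> 0" "\<not> \<psi> x \<le> C" and m: "y \<in> Xslab (real m)" "-1 * fst y \<ge> 0" "\<not> \<psi> y \<le> C" by blast
    have "x \<in> Xslab (real (max n m))" "y \<in> Xslab (real (max n m))" using n m by (auto simp: Xslab_eq)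
    then show False using step[of "real (max n m)"] n m by blast
  qed
  then obtain \<sigma> where \<sigma>: "\<sigma> = 1 \<or> \<sigma> = (-1::real)" "\<And>n x. x \<in> Xslab (real n) \<Longrightarrow> \<sigma> * fst x \<ge> 0 \<Longrightarrow> \<psi> x \<le> C" by metis
  have "\<psi> x \<le> C" if "x \<in> X" "\<sigma> * fst x \<ge> 0" for x
  proof -
    obtain n :: nat where "\<bar>fst x\<bar> \<le> real n" using real_arch_simple by blast
    then show ?thesis using \<sigma>(2)[of x n] that by (auto simp: Xslab_eq)
  qed
  then show ?thesis using that \<sigma>(1) by blast
qed

text \<open>A two-sided bound on one half is impossible, as the potential can be raised by any amount within a fixed distance.\<close>

theorem one_signed_on_halves:
  assumes conn: "connected \<omega>" and ne: "\<omega> \<noteq> {}"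
  obtains C \<sigma> where "\<sigma> = 1 \<or> \<sigma> = (-1::real)" "C \<ge> 0" "\<And>x. x \<in> X \<Longrightarrow> fst x \<ge> 0 \<Longrightarrow> \<sigma> * \<psi> x \<ge> - C"
    "\<And>x. x \<in> X \<Longrightarrow> fst x \<le> 0 \<Longrightarrow> - \<sigma> * \<psi> x \<ge> - C"
proof -
  obtain C1 \<sigma>1 where 1: "\<sigma>1 = 1 \<or> \<sigma>1 = (-1::real)" "\<And>x. x \<in> X \<Longrightarrow> \<sigma>1 * fst x \<ge> 0 \<Longrightarrow> \<psi> x \<le> C1"
    by (rule bounded_above_on_one_side[OF conn]) blast+
  interpret neg: potential_flow \<omega> \<Theta> \<Theta>' "\<lambda>x. - v x" "\<lambda>x. - \<psi> x" \<delta>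
    by unfold_locales
      (use v psi(1) stag tan has_grad_minus[OF psi(2)] in \<open>auto intro: continuous_on_minus simp del: Pair_le\<close>)
  obtain C2 \<sigma>2 where 2: "\<sigma>2 = 1 \<or> \<sigma>2 = (-1::real)" "\<And>x. x \<in> X \<Longrightarrow> \<sigma>2 * fst x \<ge> 0 \<Longrightarrow> - \<psi> x \<le> C2"
    by (rule neg.bounded_above_on_one_side[OF conn]) blast+
  have neq: "\<sigma>1 \<noteq> \<sigma>2"
  proof
    assume eq: "\<sigma>1 = \<sigma>2"
    obtain y where y: "y \<in> \<omega>" using ne by blast
    \<comment> \<open>The point x lies at axial distance 8 c / \<delta> from the section, so the
      deformation cannot move it out of its half; a rise by c would exceed the width allowed by the
      two bounds C1 and C2.\<close>
    define c where "c = \<bar>C1\<bar> + \<bar>C2\<bar> + 1"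
    define x where "x = (\<sigma>1 * (8 * c / \<delta>), y)"
    have c: "c \<ge> 0" by (simp add: c_def)
    have cd: "8 * c / \<delta> \<ge> 0" using c stag by simp
    have xX: "x \<in> X" using y closure_subset by (auto simp: x_def X_def)
    have xK: "x \<in> Xslab (8 * c / \<delta>)" using 1(1) cd xX by (auto simp: Xslab_eq x_def)
    obtain f where f: "continuous_on (Xslab (8 * c / \<delta>)) f" "\<And>x. x \<in> Xslab (8 * c / \<delta>) \<Longrightarrow> f x \<in> X"
      "\<And>x. x \<in> Xslab (8 * c / \<delta>) \<Longrightarrow> \<psi> (f x) \<ge> \<psi> x + c" "\<And>x. x \<in> Xslab (8 * c / \<delta>) \<Longrightarrow> norm (f x - x) \<le> 8 * c / \<delta>"
      "\<And>x. x \<in> Xslab (8 * c / \<delta>) \<Longrightarrow> fst x * fst (f x) \<le> 0 \<Longrightarrow> \<exists>y\<in>X. fst y = 0 \<and> \<psi> y \<ge> \<psi> x"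
      by (rule ascending_deformation[OF c]) blast+
    have "\<bar>fst (f x) - fst x\<bar> \<le> 8 * c / \<delta>" using f(4)[OF xK] abs_fst_le_norm[of "f x - x"] by simp
    then have "\<sigma>1 * fst (f x) \<ge> 0" using 1(1) by (auto simp: x_def)
    then have "\<psi> (f x) \<le> C1" using 1(2)[OF f(2)[OF xK]] by blast
    moreover have "\<sigma>2 * fst x \<ge> 0" using 1(1) cd eq by (auto simp: x_def)
    then have "- \<psi> x \<le> C2" using 2(2)[OF xX] by blast
    ultimately show False using f(3)[OF xK] by (simp add: c_def)
  qed
  define C where "C = max 0 (max C1 C2)"
  have C: "C \<ge> 0" "C1 \<le> C" "C2 \<le> C" by (auto simp: C_def)
  show ?thesis
  proof (cases "\<sigma>1 = 1")
    case True
    then have "\<sigma>2 = -1" using neq 2(1) by auto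
    then show ?thesis using True 1(2) 2(2) C by (intro that[of "-1" C]) (auto, force+)
  next
    case False
    then have "\<sigma>1 = -1" "\<sigma>2 = 1" using neq 1(1) 2(1) by auto
    then show ?thesis using 1(2) 2(2) C by (intro that[of 1 C]) (auto, force+)
  qed
qed

end

subsection \<open>Local estimates for potentials\<close>

lemma set_integral_nonneg_real:
  "(\<And>x. x \<in> S \<Longrightarrow> 0 \<le> f x) \<Longrightarrow> 0 \<le> (LINT x:S|M. f x :: real)"
  unfolding set_lebesgue_integral_def by (intro integral_nonneg_AE AE_I2) (simp add: indicator_def)

lemma measurable_indicator_ennreal:
  fixes f :: "'b::topological_space \<Rightarrow> real"
  assumes "S \<in> sets borel" "continuous_on S f"
  shows "(\<lambda>x. indicator S x * ennreal (f x)) \<in> borel_measurable borel"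
proof -
  have "(\<lambda>x. indicator S x *\<^sub>R f x) \<in> borel_measurable borel"
    using assms by (rule borel_measurable_continuous_on_indicator)
  then have "(\<lambda>x. ennreal (indicator S x *\<^sub>R f x)) \<in> borel_measurable borel" by measurable
  moreover have "(\<lambda>x. ennreal (indicator S x *\<^sub>R f x)) = (\<lambda>x. indicator S x * ennreal (f x))"
    by (auto simp: indicator_def)
  ultimately show ?thesis by (simp only:)
qed

lemma set_nn_integral_eq:
  fixes f :: "'b \<Rightarrow> real"
  assumes "set_integrable M S f" "\<And>x. x \<in> S \<Longrightarrow> 0 \<le> f x"
  shows "(\<integral>\<^sup>+x. indicator S x * ennreal (f x) \<partial>M) = ennreal (LINT x:S|M. f x)"
proof -
  have "(\<integral>\<^sup>+x. indicator S x * ennreal (f x) \<partial>M) = (\<integral>\<^sup>+x. ennreal (indicator S x *\<^sub>R f x) \<partial>M)"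
    by (intro nn_integral_cong) (auto simp: indicator_def)
  also have "\<dots> = ennreal (LINT x:S|M. f x)"
    unfolding set_lebesgue_integral_def
    using assms by (intro nn_integral_eq_integral) (auto simp: set_integrable_def indicator_def)
  finally show ?thesis .
qed

text \<open>Jensen's inequality on the unit interval for the derivative along the segment, obtained
  by expanding the integral of (h - m)^2 >= 0 and then applying Cauchy-Schwarz. The right side is a
  nonnegative extended integral, ready for an exchange of integrals.\<close>

lemma difference_squared_le_integral:
  fixes f :: "'b::euclidean_space \<Rightarrow> real"
  assumes gr: "\<And>\<tau>. \<tau> \<in> {0..1} \<Longrightarrow> has_grad f (x + \<tau> *\<^sub>R d) (g (x + \<tau> *\<^sub>R d))"
    and cg: "continuous_on {0..1} (\<lambda>\<tau>. g (x + \<tau> *\<^sub>R d))"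
  shows "ennreal ((f (x + d) - f x)\<^sup>2) \<le>
    (\<integral>\<^sup>+\<tau>. indicator {0..1::real} \<tau> * ennreal ((norm d)\<^sup>2 * (norm (g (x + \<tau> *\<^sub>R d)))\<^sup>2) \<partial>lborel)"
proof -
  define h where "h \<tau> = g (x + \<tau> *\<^sub>R d) \<bullet> d" for \<tau>
  define m where "m = f (x + d) - f x"
  have ch: "continuous_on {0..1} h" unfolding h_def by (intro continuous_intros cg)
  have "integral\<^sup>L lborel (\<lambda>\<tau>. indicator {0..1} \<tau> *\<^sub>R h \<tau>) = f (x + 1 *\<^sub>R d) - f (x + 0 *\<^sub>R d)"
  proof (rule integral_FTC_Icc[OF _ _ ch])
    fix \<tau> :: real assume t: "0 \<le> \<tau>" "\<tau> \<le> 1"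
    have "((\<lambda>\<tau>. f (x + \<tau> *\<^sub>R d)) has_real_derivative h \<tau>) (at \<tau>)"
      unfolding h_def using t by (intro has_grad_line gr) auto
    then show "((\<lambda>\<tau>. f (x + \<tau> *\<^sub>R d)) has_vector_derivative h \<tau>) (at \<tau> within {0..1})"
      by (simp add: has_real_derivative_iff_has_vector_derivative has_vector_derivative_at_within)
  qed simp
  then have m: "(LINT \<tau>:{0..1}|lborel. h \<tau>) = m" by (simp add: m_def set_lebesgue_integral_def)
  have int: "set_integrable lborel {0..1::real} k" if "continuous_on {0..1} k" for k :: "real \<Rightarrow> real"
    using borel_integrable_atLeastAtMost'[OF that] .
  have ih: "set_integrable lborel {0..1} h" "set_integrable lborel {0..1} (\<lambda>\<tau>. (h \<tau>)\<^sup>2)"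
    by (intro int ch continuous_intros)+
  have "0 \<le> (LINT \<tau>:{0..1}|lborel. (h \<tau> - m)\<^sup>2)"
    by (rule set_integral_nonneg_real) simp
  also have "\<dots> = (LINT \<tau>:{0..1}|lborel. ((h \<tau>)\<^sup>2 - 2 * m * h \<tau>) + m\<^sup>2)"
    by (simp add: power2_diff algebra_simps)
  also have "\<dots> = (LINT \<tau>:{0..1}|lborel. (h \<tau>)\<^sup>2 - 2 * m * h \<tau>) + (LINT \<tau>:{0..1::real}|lborel. m\<^sup>2)"
    by (intro set_integral_add int continuous_intros ch)
  also have "(LINT \<tau>:{0..1}|lborel. (h \<tau>)\<^sup>2 - 2 * m * h \<tau>) =
      (LINT \<tau>:{0..1}|lborel. (h \<tau>)\<^sup>2) - (LINT \<tau>:{0..1}|lborel. 2 * m * h \<tau>)"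
    by (intro set_integral_diff int continuous_intros ch)
  also have "(LINT \<tau>:{0..1::real}|lborel. m\<^sup>2) = m\<^sup>2" by (simp add: set_lebesgue_integral_def)
  also have "(LINT \<tau>:{0..1}|lborel. 2 * m * h \<tau>) = 2 * m * (LINT \<tau>:{0..1}|lborel. h \<tau>)" by simp
  finally have "m\<^sup>2 \<le> (LINT \<tau>:{0..1}|lborel. (h \<tau>)\<^sup>2)" unfolding m by (simp add: power2_eq_square)
  then have "ennreal (m\<^sup>2) \<le> (\<integral>\<^sup>+\<tau>. indicator {0..1} \<tau> * ennreal ((h \<tau>)\<^sup>2) \<partial>lborel)"
    using ih by (subst set_nn_integral_eq) (auto intro: ennreal_leI)
  also have "\<dots> \<le> (\<integral>\<^sup>+\<tau>. indicator {0..1} \<tau> * ennreal ((norm d)\<^sup>2 * (norm (g (x + \<tau> *\<^sub>R d)))\<^sup>2) \<partial>lborel)"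
  proof (intro nn_integral_mono mult_left_mono ennreal_leI)
    fix \<tau>
    show "(h \<tau>)\<^sup>2 \<le> (norm d)\<^sup>2 * (norm (g (x + \<tau> *\<^sub>R d)))\<^sup>2"
      using Cauchy_Schwarz_ineq[of "g (x + \<tau> *\<^sub>R d)" d] by (simp add: h_def power2_norm_eq_inner mult.commute)
  qed auto
  finally show ?thesis by (simp add: m_def)
qed

text \<open>Tonelli and translation invariance: for each fixed \<tau> the shifted squared gradient,
  extended by zero off B, has the same integral, and \<tau> runs over an interval of length
  one.\<close>

lemma shift_L2_estimate:
  fixes f :: "'b::euclidean_space \<Rightarrow> real"
  assumes A: "A \<in> sets borel" and B: "open B" and seg: "\<And>x \<tau>. x \<in> A \<Longrightarrow> \<tau> \<in> {0..1} \<Longrightarrow> x + \<tau> *\<^sub>R d \<in> B"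
    and gr: "\<And>x. x \<in> B \<Longrightarrow> has_grad f x (g x)" and cg: "continuous_on B g"
  shows "(\<integral>\<^sup>+x. indicator A x * ennreal ((f (x + d) - f x)\<^sup>2) \<partial>lborel) \<le>
    ennreal ((norm d)\<^sup>2) * (\<integral>\<^sup>+x. indicator B x * ennreal ((norm (g x))\<^sup>2) \<partial>lborel)"
proof -
  define G where "G x = indicator B x * ennreal ((norm (g x))\<^sup>2)" for x
  have Gm[measurable]: "G \<in> borel_measurable borel"
    unfolding G_def[abs_def] using B by (intro measurable_indicator_ennreal continuous_intros cg) auto
  have "(\<integral>\<^sup>+x. indicator A x * ennreal ((f (x + d) - f x)\<^sup>2) \<partial>lborel) \<le>
    (\<integral>\<^sup>+x. (\<integral>\<^sup>+\<tau>. indicator {0..1::real} \<tau> * (ennreal ((norm d)\<^sup>2) * G (x + \<tau> *\<^sub>R d)) \<partial>lborel) \<partial>lborel)"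
  proof (rule nn_integral_mono)
    fix x
    show "indicator A x * ennreal ((f (x + d) - f x)\<^sup>2) \<le>
      (\<integral>\<^sup>+\<tau>. indicator {0..1::real} \<tau> * (ennreal ((norm d)\<^sup>2) * G (x + \<tau> *\<^sub>R d)) \<partial>lborel)"
    proof (cases "x \<in> A")
      case True
      have "continuous_on {0..1} (\<lambda>\<tau>. g (x + \<tau> *\<^sub>R d))"
        by (rule continuous_on_compose2[OF cg]) (use seg[OF True] in \<open>auto intro!: continuous_intros\<close>)
      then have "ennreal ((f (x + d) - f x)\<^sup>2) \<le>
        (\<integral>\<^sup>+\<tau>. indicator {0..1::real} \<tau> * ennreal ((norm d)\<^sup>2 * (norm (g (x + \<tau> *\<^sub>R d)))\<^sup>2) \<partial>lborel)"
        by (intro difference_squared_le_integral gr seg[OF True])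
      also have "\<dots> = (\<integral>\<^sup>+\<tau>. indicator {0..1::real} \<tau> * (ennreal ((norm d)\<^sup>2) * G (x + \<tau> *\<^sub>R d)) \<partial>lborel)"
        using seg[OF True] by (intro nn_integral_cong) (auto simp: indicator_def G_def ennreal_mult)
      finally show ?thesis using True by simp
    qed simp
  qed
  also have "\<dots> = (\<integral>\<^sup>+\<tau>. (\<integral>\<^sup>+x. indicator {0..1::real} \<tau> * (ennreal ((norm d)\<^sup>2) * G (x + \<tau> *\<^sub>R d)) \<partial>lborel) \<partial>lborel)"
  by (rule lborel_pair.Fubini'[symmetric]) measurable
  also have "\<dots> = (\<integral>\<^sup>+\<tau>. indicator {0..1::real} \<tau> * (ennreal ((norm d)\<^sup>2) * integral\<^sup>N lborel G) \<partial>lborel)"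
  proof (intro nn_integral_cong)
    fix \<tau> :: real
    have "(\<integral>\<^sup>+x. G (x + \<tau> *\<^sub>R d) \<partial>lborel) = integral\<^sup>N lborel G" by (rule lborel_nn_integral_shift) measurable
    then show "(\<integral>\<^sup>+x. indicator {0..1::real} \<tau> * (ennreal ((norm d)\<^sup>2) * G (x + \<tau> *\<^sub>R d)) \<partial>lborel) =
      indicator {0..1::real} \<tau> * (ennreal ((norm d)\<^sup>2) * integral\<^sup>N lborel G)"
      by (simp add: nn_integral_cmult)
  qed
  also have "\<dots> = ennreal ((norm d)\<^sup>2) * integral\<^sup>N lborel G"
    by (simp add: nn_integral_multc)
  finally show ?thesis unfolding G_def[abs_def] .
qed

context cylinder begin

section \<open>Integral quantities on slabs and the Nash inequality\<close>

definition potential :: "(real \<times> 'a \<Rightarrow> real) \<Rightarrow> (real \<times> 'a \<Rightarrow> real \<times> 'a) \<Rightarrow> bool" where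
  "potential f g \<longleftrightarrow> continuous_on X f \<and> continuous_on X g \<and> (\<forall>x\<in>Om. has_grad f x (g x))"

text \<open>Here \<open>L2\<close> and \<open>energy\<close> are squares of norms while
  \<open>L1\<close> is a norm, which is why \<open>L1\<close> appears squared next to them.\<close>

abbreviation L1 :: "(real \<times> 'a \<Rightarrow> real) \<Rightarrow> real \<Rightarrow> real \<Rightarrow> real" where
  "L1 f c r \<equiv> (LINT x:slab c r|lborel. \<bar>f x\<bar>)"
abbreviation L2 :: "(real \<times> 'a \<Rightarrow> real) \<Rightarrow> real \<Rightarrow> real \<Rightarrow> real" where
  "L2 f c r \<equiv> (LINT x:slab c r|lborel. (f x)\<^sup>2)"
abbreviation energy :: "(real \<times> 'a \<Rightarrow> real \<times> 'a) \<Rightarrow> real \<Rightarrow> real \<Rightarrow> real" where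
  "energy g c r \<equiv> (LINT x:slab c r|lborel. (norm (g x))\<^sup>2)"

lemma slab_subset_Xslab: "slab c r \<subseteq> Xslab (\<bar>c\<bar> + r)"
  unfolding Xslab_eq slab_def using Om_subset_X by auto

lemma set_integrable_slab_part:
  fixes f :: "real \<times> 'a \<Rightarrow> real"
  assumes f: "continuous_on X f" and A: "A \<in> sets borel" "A \<subseteq> slab c r"
  shows "set_integrable lborel A f"
proof -
  have "continuous_on (Xslab (\<bar>c\<bar> + r)) f" using f Xslab_subset continuous_on_subset by blast
  then have "set_integrable lborel (Xslab (\<bar>c\<bar> + r)) f"
    unfolding set_integrable_def by (rule borel_integrable_compact[OF compact_Xslab])
  then show ?thesis by (rule set_integrable_subset) (use A slab_subset_Xslab in auto)
qed

lemma slab_borel: "slab c r \<in> sets borel" using open_slab by (rule borel_open)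

lemma slab_part_borel: "open V \<Longrightarrow> {x \<in> slab c r. snd x \<in> V} \<in> sets borel"
proof -
  assume V: "open V"
  have "{x \<in> slab c r. snd x \<in> V} = slab c r \<inter> snd -` V" by auto
  then show ?thesis using open_slab open_vimage_snd[OF V] by (auto intro: borel_open open_Int)
qed

lemma set_integrable_slab: "continuous_on X f \<Longrightarrow> set_integrable lborel (slab c r) (f :: real \<times> 'a \<Rightarrow> real)"
  by (rule set_integrable_slab_part[OF _ slab_borel order_refl])

lemma slab_integral_mono_set:
  fixes f :: "real \<times> 'a \<Rightarrow> real"
  assumes f: "continuous_on X f" "\<And>x. x \<in> X \<Longrightarrow> 0 \<le> f x"
    and A: "A \<in> sets borel" "A \<subseteq> B" and B: "B \<in> sets borel" "B \<subseteq> slab c r"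
  shows "(LINT x:A|lborel. f x) \<le> (LINT x:B|lborel. f x)"
proof -
  have "A \<subseteq> slab c r" using A B by auto
  then have "set_integrable lborel A f" "set_integrable lborel B f"
    using set_integrable_slab_part[OF f(1)] A B by auto
  moreover have "indicator A x *\<^sub>R f x \<le> indicator B x *\<^sub>R f x" for x
    using f(2)[of x] A(2) B(2) Om_subset_X by (auto simp: indicator_def slab_def)
  ultimately show ?thesis unfolding set_lebesgue_integral_def set_integrable_def by (intro integral_mono) auto
qed

lemma slab_mono: "r \<le> r' \<Longrightarrow> slab c r \<subseteq> slab c r'" by (auto simp: slab_def)

text \<open>At frontier points the directions of uniform decrease of \<Theta> serve, since they keep
  \<Theta> negative; at interior points every direction of the unit ball does.\<close>

lemma interior_cone:
  assumes y0: "y0 \<in> closure \<omega>"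
  shows "\<exists>U e \<rho> s0. open U \<and> y0 \<in> U \<and> \<rho> > 0 \<and> s0 > 0 \<and> norm e + \<rho> \<le> 1 \<and>
    (\<forall>y\<in>U \<inter> \<omega>. \<forall>d\<in>ball e \<rho>. \<forall>s\<in>{0..s0}. y + s *\<^sub>R d \<in> \<omega>)"
proof (cases "y0 \<in> \<omega>")
  case True
  then obtain r where r: "r > 0" "ball y0 r \<subseteq> \<omega>" using open_omega open_contains_ball by blast
  have "y + s *\<^sub>R d \<in> \<omega>" if "y \<in> ball y0 (r/2)" "d \<in> ball 0 1" "s \<in> {0..r/2}" for y d s
  proof -
    have "norm (s *\<^sub>R d) \<le> (r/2) * 1" unfolding norm_scaleR using that r by (intro mult_mono) auto
    then have "dist y0 (y + s *\<^sub>R d) < r"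
      using that(1) dist_triangle[of y0 "y + s *\<^sub>R d" y] by (simp add: dist_norm)
    then show ?thesis using r by auto
  qed
  then show ?thesis using r by (intro exI[of _ "ball y0 (r/2)"] exI[of _ 0] exI[of _ 1] exI[of _ "r/2"]) auto
next
  case False
  then have "y0 \<in> frontier \<omega>" using y0 frontier_iff by blast
  from inward_directions[OF this] obtain U e \<rho> s0 c where D: "open U" "y0 \<in> U" "\<rho> > 0" "s0 > 0" "c > 0" "norm e + \<rho> \<le> 1"
    "\<forall>y\<in>U. \<forall>d\<in>ball e \<rho>. \<forall>s\<in>{0..s0}. \<Theta> (y + s *\<^sub>R d) \<le> \<Theta> y - c * s" by metis
  have "y + s *\<^sub>R d \<in> \<omega>" if y: "y \<in> U \<inter> \<omega>" and d: "d \<in> ball e \<rho>" and s: "s \<in> {0..s0}" for y d s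
  proof -
    have "\<Theta> (y + s *\<^sub>R d) \<le> \<Theta> y - c * s" using D(7) y d s by blast
    moreover have "c * s \<ge> 0" using D(5) s by simp
    ultimately show ?thesis using y by (simp add: mem_omega)
  qed
  then show ?thesis using D by blast
qed

text \<open>The inequality \<open>(f x)\<^sup>2 \<le> (f (x + w) - f x)\<^sup>2 + 2 * \<bar>f x\<bar> * \<bar>f (x + w)\<bar>\<close> is integrated in \<open>x\<close> and then averaged over the
  vectors \<open>w\<close> of size \<open>s\<close> in an interior cone.\<close>

lemma nash_local:
  assumes y0: "y0 \<in> closure \<omega>"
  shows "\<exists>U C s0. open U \<and> y0 \<in> U \<and> C \<ge> 0 \<and> s0 > 0 \<and> (\<forall>s f g c r. 0 < s \<longrightarrow> s \<le> s0 \<longrightarrow> potential f g \<longrightarrow>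
    (LINT x:{x \<in> slab c r. snd x \<in> U}|lborel. (f x)\<^sup>2) \<le> C * s\<^sup>2 * (energy g c (r + s))
       + C / s ^ DIM(real \<times> 'a) * (L1 f c (r + s))\<^sup>2)"
proof -
  obtain U e \<rho> s0 where D: "open U" "y0 \<in> U" "\<rho> > 0" "s0 > 0" "norm e + \<rho> \<le> 1"
    "\<And>y d s. y \<in> U \<inter> \<omega> \<Longrightarrow> d \<in> ball e \<rho> \<Longrightarrow> s \<in> {0..s0} \<Longrightarrow> y + s *\<^sub>R d \<in> \<omega>"
    using interior_cone[OF y0] by metis
  let ?N = "DIM(real \<times> 'a)"
  define \<beta> where "\<beta> = measure lborel (ball (0::real \<times> 'a) \<rho>)"
  have b: "\<beta> > 0" using D by (simp add: \<beta>_def)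
  define C where "C = max 1 (2 / \<beta>)"
  have C: "C \<ge> 1" "C \<ge> 2 / \<beta>" by (auto simp: C_def)
  have "(LINT x:{x \<in> slab c r. snd x \<in> U}|lborel. (f x)\<^sup>2) \<le> C * s\<^sup>2 * (energy g c (r + s))
       + C / s ^ ?N * (L1 f c (r + s))\<^sup>2"
    if s: "0 < s" "s \<le> s0" and fg: "potential f g" for s f g c r
  proof -
    have cf: "continuous_on X f" and cg: "continuous_on X g" and gr: "\<And>x. x \<in> Om \<Longrightarrow> has_grad f x (g x)"
      using fg by (auto simp: potential_def)
    define A where "A = {x \<in> slab c r. snd x \<in> U}"
    define B where "B = slab c (r + s)"
    \<comment> \<open>The set of admissible translations: the ball of directions scaled by s. Its
      vectors have norm at most s, whence the factor s^2 in front of the energy, and its volume is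
      proportional to s to the power N, whence the division by that power in the L1 term.\<close>
    define K where "K = ball (0 :: real, s *\<^sub>R e) (s * \<rho>)"
    define a where "a = (LINT x:A|lborel. (f x)\<^sup>2)"
    define b1 where "b1 = (LINT x:B|lborel. (norm (g x))\<^sup>2)"
    define l where "l = (LINT x:B|lborel. \<bar>f x\<bar>)"
    have Ab: "A \<in> sets borel" unfolding A_def by (rule slab_part_borel[OF D(1)])
    have Bo: "open B" unfolding B_def by (rule open_slab)
    have AB: "A \<subseteq> B" using s by (auto simp: A_def B_def slab_def)
    have BO: "B \<subseteq> Om" "B \<subseteq> X" using Om_subset_X by (auto simp: B_def slab_def)
    have seg: "x + \<tau> *\<^sub>R w \<in> B" if x: "x \<in> A" and w: "w \<in> K" and t: "\<tau> \<in> {0..1}" for x \<tau> w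
    proof -
      define d where "d = (1 / s) *\<^sub>R snd w"
      have dist: "dist (0, s *\<^sub>R e) w < s * \<rho>" using w by (simp add: K_def)
      have "dist (s *\<^sub>R e) (snd w) < s * \<rho>" using dist_snd_le[of "(0, s *\<^sub>R e)" w] dist by simp
      moreover have "s *\<^sub>R e - snd w = s *\<^sub>R (e - d)" using s by (simp add: d_def scaleR_diff_right)
      ultimately have "s * norm (e - d) < s * \<rho>" using s by (simp add: dist_norm)
      then have dd: "d \<in> ball e \<rho>" using s by (simp add: dist_norm)
      have "\<tau> * s \<le> 1 * s0" using t s by (intro mult_mono) auto
      then have "snd x + (\<tau> * s) *\<^sub>R d \<in> \<omega>"
        using x t s by (intro D(6)[OF _ dd]) (auto simp: A_def slab_def Om_def mem_Times_iff)
      then have "snd (x + \<tau> *\<^sub>R w) \<in> \<omega>" using s by (simp add: d_def)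
      moreover have "\<bar>fst w\<bar> < s * \<rho>" using dist_fst_le[of "(0, s *\<^sub>R e)" w] dist by (simp add: dist_real_def)
      then have "\<bar>fst w\<bar> \<le> s" using s D(3,5) mult_left_mono[of \<rho> 1 s] by (smt (verit) norm_ge_zero mult_cancel_left2)
      then have "\<bar>\<tau> * fst w\<bar> \<le> 1 * s" unfolding abs_mult using t by (intro mult_mono) auto
      ultimately show ?thesis using x by (auto simp: A_def B_def slab_def Om_def mem_Times_iff)
    qed
    have nw: "norm w \<le> s" if "w \<in> K" for w
    proof -
      have "norm w \<le> norm (0::real, s *\<^sub>R e) + dist (0, s *\<^sub>R e) w"
        using norm_triangle_ineq4[of "(0, s *\<^sub>R e)" "(0, s *\<^sub>R e) - w"] by (simp add: dist_norm)
      also have "\<dots> \<le> s * norm e + s * \<rho>" using that s by (simp add: K_def norm_Pair)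
      also have "\<dots> \<le> s * 1" using D(5) s by (simp add: distrib_left[symmetric])
      finally show ?thesis by simp
    qed
    define F where "F x = indicator B x * ennreal \<bar>f x\<bar>" for x
    define H where "H x = indicator A x * ennreal \<bar>f x\<bar>" for x
    have cB: "continuous_on B (\<lambda>x. \<bar>f x\<bar>)" "continuous_on A f"
      using continuous_on_subset[OF cf BO(2)] continuous_on_subset[OF cf subset_trans[OF AB BO(2)]]
      by (auto intro: continuous_intros)
    have Fm[measurable]: "F \<in> borel_measurable borel"
      unfolding F_def[abs_def] using Bo cB by (intro measurable_indicator_ennreal) auto
    have Hm[measurable]: "H \<in> borel_measurable borel"
      unfolding H_def[abs_def] using Ab cB by (intro measurable_indicator_ennreal continuous_intros)
    have Km: "K \<in> sets borel" by (simp add: K_def)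
    have Ao: "A \<subseteq> slab c r" by (auto simp: A_def)
    have ca: "continuous_on X (\<lambda>x. (f x)\<^sup>2)" "continuous_on X (\<lambda>x. \<bar>f x\<bar>)" "continuous_on X (\<lambda>x. (norm (g x))\<^sup>2)"
      by (intro continuous_intros cf cg)+
    have ea: "(\<integral>\<^sup>+x. indicator A x * ennreal ((f x)\<^sup>2) \<partial>lborel) = ennreal a"
      unfolding a_def by (rule set_nn_integral_eq[OF set_integrable_slab_part[OF ca(1) Ab Ao]]) simp
    have eb: "(\<integral>\<^sup>+x. indicator B x * ennreal ((norm (g x))\<^sup>2) \<partial>lborel) = ennreal b1"
      unfolding b1_def B_def by (rule set_nn_integral_eq[OF set_integrable_slab[OF ca(3)]]) simp
    have el: "integral\<^sup>N lborel F = ennreal l"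
      unfolding l_def F_def[abs_def] B_def by (rule set_nn_integral_eq[OF set_integrable_slab[OF ca(2)]]) simp
    have HF: "integral\<^sup>N lborel H \<le> integral\<^sup>N lborel F"
      using AB by (intro nn_integral_mono) (auto simp: F_def H_def indicator_def)
    have pos: "0 \<le> a" "0 \<le> b1" "0 \<le> l" unfolding a_def b1_def l_def by (auto intro: set_integral_nonneg_real)
    have one: "ennreal a \<le> ennreal (s\<^sup>2 * b1) + 2 * (\<integral>\<^sup>+x. H x * F (x + w) \<partial>lborel)" if w: "w \<in> K" for w
    proof -
      have "ennreal a \<le> (\<integral>\<^sup>+x. indicator A x * ennreal ((f (x + w) - f x)\<^sup>2) + 2 * (H x * F (x + w)) \<partial>lborel)"
        unfolding ea[symmetric]
      proof (rule nn_integral_mono)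
        fix x
        show "indicator A x * ennreal ((f x)\<^sup>2) \<le> indicator A x * ennreal ((f (x + w) - f x)\<^sup>2) + 2 * (H x * F (x + w))"
        proof (cases "x \<in> A")
          case True
          have xB: "x + w \<in> B" using seg[OF True w, of 1] by simp
          have "f (x + w) * f x \<le> \<bar>f x\<bar> * \<bar>f (x + w)\<bar>" by (metis abs_ge_self abs_mult mult.commute)
          moreover have "0 \<le> (f (x + w))\<^sup>2" by simp
          ultimately have "(f x)\<^sup>2 \<le> (f (x + w) - f x)\<^sup>2 + 2 * (\<bar>f x\<bar> * \<bar>f (x + w)\<bar>)"
            unfolding power2_diff by linarith
          then have "ennreal ((f x)\<^sup>2) \<le> ennreal ((f (x + w) - f x)\<^sup>2 + 2 * (\<bar>f x\<bar> * \<bar>f (x + w)\<bar>))"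
            by (rule ennreal_leI)
          also have "\<dots> = ennreal ((f (x + w) - f x)\<^sup>2) + 2 * (ennreal \<bar>f x\<bar> * ennreal \<bar>f (x + w)\<bar>)"
            by (simp add: ennreal_mult)
          finally show ?thesis using True xB by (simp add: H_def F_def)
        qed simp
      qed
      also have "\<dots> = (\<integral>\<^sup>+x. indicator A x * ennreal ((f (x + w) - f x)\<^sup>2) \<partial>lborel) + 2 * (\<integral>\<^sup>+x. H x * F (x + w) \<partial>lborel)"
      proof -
        have "continuous_on A (\<lambda>x. f (x + w))"
          by (rule continuous_on_compose2[OF cf]) (use seg[OF _ w, of _ 1] BO in \<open>auto intro!: continuous_intros\<close>)
        then have "(\<lambda>x. indicator A x * ennreal ((f (x + w) - f x)\<^sup>2)) \<in> borel_measurable borel"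
          using Ab cB(2) by (intro measurable_indicator_ennreal continuous_intros)
        then have m1: "(\<lambda>x. indicator A x * ennreal ((f (x + w) - f x)\<^sup>2)) \<in> borel_measurable lborel"
          by (simp only: measurable_lborel1 measurable_lborel2)
        have m2: "(\<lambda>x. H x * F (x + w)) \<in> borel_measurable lborel" by measurable
        then have m3: "(\<lambda>x. 2 * (H x * F (x + w))) \<in> borel_measurable lborel" by measurable
        show ?thesis using nn_integral_add[OF m1 m3] nn_integral_cmult[OF m2] by simp
      qed
      also have "(\<integral>\<^sup>+x. indicator A x * ennreal ((f (x + w) - f x)\<^sup>2) \<partial>lborel) \<le> ennreal ((norm w)\<^sup>2) * ennreal b1"
        unfolding eb[symmetric]
        by (rule shift_L2_estimate[OF Ab Bo]) (use seg[OF _ w] gr BO cg continuous_on_subset in blast)+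
      also have "ennreal ((norm w)\<^sup>2) * ennreal b1 \<le> ennreal (s\<^sup>2 * b1)"
        using nw[OF w] pos s by (simp add: ennreal_mult[symmetric] del: ennreal_power) (auto intro!: ennreal_leI mult_right_mono power_mono)
      finally show ?thesis by (simp add: add_right_mono)
    qed
    have vK: "emeasure lborel K = ennreal (s ^ ?N * \<beta>)"
    proof -
      have "measure lborel K = s ^ ?N * \<beta>"
        using s D(3) by (simp add: K_def \<beta>_def content_ball power_mult_distrib)
      moreover have "emeasure lborel K < \<infinity>" unfolding K_def by (rule emeasure_bounded_finite[OF bounded_ball])
      ultimately show ?thesis by (metis emeasure_eq_ennreal_measure infinity_ennreal_def less_top)
    qed
    \<comment> \<open>Integration over w in K multiplies the left side by the volume of K. In the
      product term w may run over the whole space, where Tonelli decouples it into the integral of H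
      times that of F, at most the square of the L1 norm.\<close>
    have "ennreal (s ^ ?N * \<beta>) * ennreal a = (\<integral>\<^sup>+w. indicator K w * ennreal a \<partial>lborel)"
      using Km by (simp add: nn_integral_multc vK)
    also have "\<dots> \<le> (\<integral>\<^sup>+w. indicator K w * ennreal (s\<^sup>2 * b1) + 2 * (\<integral>\<^sup>+x. H x * F (x + w) \<partial>lborel) \<partial>lborel)"
      using one by (intro nn_integral_mono) (auto simp: indicator_def)
    also have "\<dots> = (\<integral>\<^sup>+w. indicator K w * ennreal (s\<^sup>2 * b1) \<partial>lborel) + 2 * (\<integral>\<^sup>+w. (\<integral>\<^sup>+x. H x * F (x + w) \<partial>lborel) \<partial>lborel)"
    proof -
      have m1: "(\<lambda>w. indicator K w * ennreal (s\<^sup>2 * b1)) \<in> borel_measurable lborel" using Km by measurable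
      have m2: "(\<lambda>w. (\<integral>\<^sup>+x. H x * F (x + w) \<partial>lborel)) \<in> borel_measurable lborel" by measurable
      then have m3: "(\<lambda>w. 2 * (\<integral>\<^sup>+x. H x * F (x + w) \<partial>lborel)) \<in> borel_measurable lborel" by measurable
      show ?thesis using nn_integral_add[OF m1 m3] nn_integral_cmult[OF m2] by simp
    qed
    also have "(\<integral>\<^sup>+w. indicator K w * ennreal (s\<^sup>2 * b1) \<partial>lborel) = ennreal (s ^ ?N * \<beta>) * ennreal (s\<^sup>2 * b1)"
      using Km by (simp add: nn_integral_multc vK)
    also have "(\<integral>\<^sup>+w. (\<integral>\<^sup>+x. H x * F (x + w) \<partial>lborel) \<partial>lborel) = (\<integral>\<^sup>+x. (\<integral>\<^sup>+w. H x * F (x + w) \<partial>lborel) \<partial>lborel)"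
    by (rule lborel_pair.Fubini') measurable
    also have "\<dots> = (\<integral>\<^sup>+x. H x * integral\<^sup>N lborel F \<partial>lborel)"
    proof (intro nn_integral_cong)
      fix x
      have "(\<integral>\<^sup>+w. F (x + w) \<partial>lborel) = integral\<^sup>N lborel F"
        using lborel_nn_integral_shift[OF Fm, of x] by (simp add: add.commute)
      then show "(\<integral>\<^sup>+w. H x * F (x + w) \<partial>lborel) = H x * integral\<^sup>N lborel F"
        by (simp add: nn_integral_cmult)
    qed
    also have "\<dots> = integral\<^sup>N lborel H * ennreal l" by (simp add: nn_integral_multc el)
    also have "\<dots> \<le> ennreal l * ennreal l" using HF el by (intro mult_right_mono) auto
    finally have "ennreal (s ^ ?N * \<beta>) * ennreal a \<le> ennreal (s ^ ?N * \<beta>) * ennreal (s\<^sup>2 * b1) + 2 * (ennreal l * ennreal l)"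
      by (simp add: add_left_mono mult_left_mono)
    also have "\<dots> = ennreal (s ^ ?N * \<beta> * (s\<^sup>2 * b1) + 2 * (l * l))"
      using pos s b by (simp add: ennreal_mult)
    finally have "ennreal (s ^ ?N * \<beta> * a) \<le> ennreal (s ^ ?N * \<beta> * (s\<^sup>2 * b1) + 2 * (l * l))"
      using pos s b by (simp add: ennreal_mult)
    then have ineq: "s ^ ?N * \<beta> * a \<le> s ^ ?N * \<beta> * (s\<^sup>2 * b1) + 2 * (l * l)"
      using pos s b by (subst (asm) ennreal_le_iff) auto
    have sN: "s ^ ?N > 0" using s by simp
    define p where "p = s ^ ?N * \<beta>"
    have p: "p > 0" using sN b by (simp add: p_def)
    then have "p * a \<le> p * (s\<^sup>2 * b1 + 2 * (l * l) / p)"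
      using ineq unfolding p_def[symmetric] by (simp add: distrib_left)
    then have "a \<le> s\<^sup>2 * b1 + 2 * (l * l) / p" using p by (simp only: mult_le_cancel_left_pos)
    also have "2 * (l * l) / p = (2 / \<beta>) / s ^ ?N * l\<^sup>2" by (simp add: p_def power2_eq_square)
    also have "s\<^sup>2 * b1 + (2 / \<beta>) / s ^ ?N * l\<^sup>2 \<le> C * (s\<^sup>2 * b1) + C / s ^ ?N * l\<^sup>2"
    proof (intro add_mono mult_right_mono divide_right_mono)
      show "s\<^sup>2 * b1 \<le> C * (s\<^sup>2 * b1)" using mult_right_mono[of 1 C "s\<^sup>2 * b1"] C pos by simp
    qed (use C sN in auto)
    finally show ?thesis by (simp add: a_def b1_def l_def A_def B_def mult.assoc)
  qed
  then show ?thesis using D C by (intro exI[of _ U] exI[of _ C] exI[of _ s0]) auto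
qed

end

section \<open>Axial cut-offs, the Caccioppoli inequality and the passage from L1 to L2\<close>

lemma cutoff_exists:
  fixes c r \<sigma> :: real
  assumes s: "\<sigma> > 0" and r: "r \<ge> 0"
  obtains e e' where "\<And>t. (e has_real_derivative e' t) (at t)" "continuous_on UNIV e'"
    "\<And>t. 0 \<le> e t" "\<And>t. e t \<le> 1" "\<And>t. \<bar>e' t\<bar> \<le> 8 / \<sigma>" "\<And>t. \<bar>t - c\<bar> \<le> r \<Longrightarrow> e t = 1"
    "\<And>t. \<bar>t - c\<bar> \<ge> r + \<sigma> \<Longrightarrow> e t = 0" "\<And>t. \<bar>t - c\<bar> \<ge> r + \<sigma> \<Longrightarrow> e' t = 0"
proof -
  define a where "a t = (r + \<sigma> - (t - c)) / \<sigma>" for t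
  define b where "b t = (r + \<sigma> + (t - c)) / \<sigma>" for t
  define e where "e t = step (a t) * step (b t)" for t
  define e' where "e' t = step (a t) * (step' (b t) * (1 / \<sigma>)) + step' (a t) * (- 1 / \<sigma>) * step (b t)" for t
  have ca: "continuous_on UNIV a" "continuous_on UNIV b"
    unfolding a_def b_def by (intro continuous_intros; use s in simp)+
  have out: "a t \<le> 0 \<or> b t \<le> 0" if "\<bar>t - c\<bar> \<ge> r + \<sigma>" for t
    using that s by (auto simp: a_def b_def divide_simps abs_if split: if_splits)
  show ?thesis
  proof (rule that[of e e'])
    show "(e has_real_derivative e' t) (at t)" for t
    proof -
      have da: "(a has_real_derivative - 1 / \<sigma>) (at t)" unfolding a_def using s by (auto intro!: derivative_eq_intros)
      have db: "(b has_real_derivative 1 / \<sigma>) (at t)" unfolding b_def using s by (auto intro!: derivative_eq_intros)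
      show ?thesis unfolding e_def e'_def
        using DERIV_mult'[OF DERIV_chain2[OF step_deriv da] DERIV_chain2[OF step_deriv db]] by simp
    qed
    show "continuous_on UNIV e'" unfolding e'_def by (intro continuous_intros ca) (use s in auto)
    show "0 \<le> e t" for t unfolding e_def by (intro mult_nonneg_nonneg step_bounds)
    show "e t \<le> 1" for t unfolding e_def by (intro mult_le_one step_bounds)
    \<comment> \<open>The cut-off is the product of a descending and an ascending transition of
      width \<sigma>, each with slope at most 4 / \<sigma>; the crude sum of the two is
      kept.\<close>
    show "\<bar>e' t\<bar> \<le> 8 / \<sigma>" for t
    proof -
      have "step (a t) * step' (b t) \<le> 1 * 4" "step' (a t) * step (b t) \<le> 4 * 1"
        by (intro mult_mono step_bounds step'_le step'_nonneg; simp)+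
      moreover have "0 \<le> step (a t) * step' (b t)" "0 \<le> step' (a t) * step (b t)"
        by (intro mult_nonneg_nonneg step_bounds step'_nonneg)+
      ultimately have "\<bar>step (a t) * step' (b t) - step' (a t) * step (b t)\<bar> \<le> 8" by linarith
      moreover have "e' t = (step (a t) * step' (b t) - step' (a t) * step (b t)) / \<sigma>"
        by (simp add: e'_def diff_divide_distrib)
      ultimately show ?thesis using s by (simp add: divide_right_mono)
    qed
    show "e t = 1" if "\<bar>t - c\<bar> \<le> r" for t
    proof -
      have "a t \<ge> 1" "b t \<ge> 1" using that s by (auto simp: a_def b_def divide_simps)
      then show ?thesis by (simp add: e_def step_eq_1)
    qed
    show "e t = 0" if "\<bar>t - c\<bar> \<ge> r + \<sigma>" for t using out[OF that] by (auto simp: e_def step_eq_0)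
    show "e' t = 0" if "\<bar>t - c\<bar> \<ge> r + \<sigma>" for t using out[OF that] by (auto simp: e'_def step_eq_0 step'_eq_0)
  qed
qed

text \<open>After n steps the remainder is \<kappa>^n times a bounded quantity and vanishes in the
  limit. The inhomogeneities sum to D times a geometric series in \<kappa> M, at most 2 D: they may
  grow like M^k as long as \<kappa> compensates for it.\<close>

lemma geometric_iteration:
  fixes a :: "nat \<Rightarrow> real"
  assumes a: "\<And>k. a k \<le> \<kappa> * a (Suc k) + D * M ^ k" and bd: "\<And>k. a k \<le> A"
    and k: "0 \<le> \<kappa>" "\<kappa> \<le> 1 / 2" "\<kappa> * M \<le> 1 / 2" "0 \<le> M" and D: "0 \<le> D"
  shows "a 0 \<le> 2 * D"
proof -
  have s: "a 0 \<le> \<kappa> ^ n * a n + D * (2 - 2 * (1 / 2) ^ n)" for n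
  proof (induction n)
    case (Suc n)
    have "(\<kappa> * M) ^ n \<le> (1 / 2) ^ n" using k by (intro power_mono) auto
    then have "D * (\<kappa> * M) ^ n \<le> D * (1 / 2) ^ n" using D by (intro mult_left_mono) auto
    moreover have "\<kappa> ^ n * a n \<le> \<kappa> ^ n * (\<kappa> * a (Suc n) + D * M ^ n)"
      using a k by (intro mult_left_mono) auto
    ultimately have "\<kappa> ^ n * a n \<le> \<kappa> ^ Suc n * a (Suc n) + D * (1 / 2) ^ n"
      by (simp add: algebra_simps power_mult_distrib)
    then show ?case using Suc by (simp add: algebra_simps)
  qed simp
  have "a 0 \<le> (1 / 2) ^ n * \<bar>A\<bar> + 2 * D" for n
  proof -
    have "\<kappa> ^ n * a n \<le> \<kappa> ^ n * \<bar>A\<bar>" using bd[of n] k by (intro mult_left_mono) auto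
    also have "\<dots> \<le> (1 / 2) ^ n * \<bar>A\<bar>" using k by (intro mult_right_mono power_mono) auto
    finally have "\<kappa> ^ n * a n \<le> (1 / 2) ^ n * \<bar>A\<bar>" .
    moreover have "D * (2 - 2 * (1 / 2) ^ n) \<le> D * 2" using D by (intro mult_left_mono) auto
    ultimately show ?thesis using s[of n] by linarith
  qed
  moreover have "(\<lambda>n. (1 / 2) ^ n * \<bar>A\<bar> + 2 * D) \<longlonglongrightarrow> 0 * \<bar>A\<bar> + 2 * D"
    by (intro tendsto_intros LIMSEQ_power_zero) simp
  ultimately show ?thesis by (intro LIMSEQ_le_const[of _ "2 * D"]) auto
qed

context cylinder begin

text \<open>The local inequality is summed over a finite cover of the closed cross-section, the
  integrals on the right being over whole slabs already. The scale s stays free, so that the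
  coefficient of the energy can be made small at the price of the L1 term.\<close>

lemma nash_inequality:
  obtains C s0 where "C \<ge> 0" "s0 > 0" "\<And>s f g c r. 0 < s \<Longrightarrow> s \<le> s0 \<Longrightarrow> potential f g \<Longrightarrow>
    (L2 f c r) \<le> C * s\<^sup>2 * (energy g c (r + s))
       + C / s ^ DIM(real \<times> 'a) * (L1 f c (r + s))\<^sup>2"
proof -
  let ?N = "DIM(real \<times> 'a)"
  define R where "R C s f g c r = C * s\<^sup>2 * (energy g c (r + s))
       + C / s ^ ?N * (L1 f c (r + s))\<^sup>2"
    for C s :: real and f :: "real \<times> 'a \<Rightarrow> real" and g :: "real \<times> 'a \<Rightarrow> real \<times> 'a" and c r :: real
  \<comment> \<open>The open superset V makes the domain of integration measurable even though A is
    an arbitrary set.\<close>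
  define P where "P A = (\<exists>V C s0. open V \<and> A \<subseteq> V \<and> C \<ge> 0 \<and> s0 > 0 \<and>
    (\<forall>s f g c r. 0 < s \<longrightarrow> s \<le> s0 \<longrightarrow> potential f g \<longrightarrow> (LINT x:{x \<in> slab c r. snd x \<in> V}|lborel. (f x)\<^sup>2) \<le> R C s f g c r))" for A
  have "P (closure \<omega>)"
  proof (rule compact_local_induct)
    show "compact (closure \<omega>)" using bounded_omega by simp
    show "\<exists>U. open U \<and> y \<in> U \<and> P U" if "y \<in> closure \<omega>" for y
      using nash_local[OF that] unfolding P_def R_def by blast
    show "P {}" unfolding P_def
      by (intro exI[of _ "{}"] exI[of _ 0] exI[of _ 1]) (auto simp: R_def set_lebesgue_integral_def)
    show "P A" if "P B" "A \<subseteq> B" for A B using that unfolding P_def by (meson subset_trans)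
    show "P (A \<union> B)" if A: "P A" and B: "P B" for A B
    proof -
      obtain V1 C1 s1 where 1: "open V1" "A \<subseteq> V1" "C1 \<ge> 0" "s1 > 0"
        "\<And>s f g c r. 0 < s \<Longrightarrow> s \<le> s1 \<Longrightarrow> potential f g \<Longrightarrow> (LINT x:{x \<in> slab c r. snd x \<in> V1}|lborel. (f x)\<^sup>2) \<le> R C1 s f g c r"
        using A unfolding P_def by blast
      obtain V2 C2 s2 where 2: "open V2" "B \<subseteq> V2" "C2 \<ge> 0" "s2 > 0"
        "\<And>s f g c r. 0 < s \<Longrightarrow> s \<le> s2 \<Longrightarrow> potential f g \<Longrightarrow> (LINT x:{x \<in> slab c r. snd x \<in> V2}|lborel. (f x)\<^sup>2) \<le> R C2 s f g c r"
        using B unfolding P_def by blast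
      have "(LINT x:{x \<in> slab c r. snd x \<in> V1 \<union> V2}|lborel. (f x)\<^sup>2) \<le> R (C1 + C2) s f g c r"
        if s: "0 < s" "s \<le> min s1 s2" and fg: "potential f g" for s f g c r
      proof -
        have c2: "continuous_on X (\<lambda>x. (f x)\<^sup>2)" using fg by (auto simp: potential_def intro!: continuous_intros)
        have i: "set_integrable lborel {x \<in> slab c r. snd x \<in> V} (\<lambda>x. (f x)\<^sup>2)" if "open V" for V
          by (rule set_integrable_slab_part[OF c2 slab_part_borel[OF that]]) auto
        have "(LINT x:{x \<in> slab c r. snd x \<in> V1 \<union> V2}|lborel. (f x)\<^sup>2) \<le>
          (LINT x:{x \<in> slab c r. snd x \<in> V1}|lborel. (f x)\<^sup>2) + (LINT x:{x \<in> slab c r. snd x \<in> V2}|lborel. (f x)\<^sup>2)"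
        proof -
          let ?I = "\<lambda>V x. indicator {x \<in> slab c r. snd x \<in> V} x *\<^sub>R (f x)\<^sup>2"
          have "integral\<^sup>L lborel (?I (V1 \<union> V2)) \<le> integral\<^sup>L lborel (\<lambda>x. ?I V1 x + ?I V2 x)"
            using i[OF 1(1)] i[OF 2(1)] i[OF open_Un[OF 1(1) 2(1)]] unfolding set_integrable_def
            by (intro integral_mono Bochner_Integration.integrable_add) (auto simp: indicator_def)
          then show ?thesis
            using Bochner_Integration.integral_add[OF i[OF 1(1), unfolded set_integrable_def] i[OF 2(1), unfolded set_integrable_def]]
            unfolding set_lebesgue_integral_def by simp
        qed
        also have "\<dots> \<le> R C1 s f g c r + R C2 s f g c r" using 1 2 s fg by (intro add_mono) auto
        also have "\<dots> = R (C1 + C2) s f g c r" by (simp add: R_def algebra_simps add_divide_distrib)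
        finally show ?thesis .
      qed
      then show ?thesis unfolding P_def using 1 2
        by (intro exI[of _ "V1 \<union> V2"] exI[of _ "C1 + C2"] exI[of _ "min s1 s2"]) auto
    qed
  qed
  then obtain V C s0 where V: "open V" "closure \<omega> \<subseteq> V" "C \<ge> 0" "s0 > 0"
    "\<And>s f g c r. 0 < s \<Longrightarrow> s \<le> s0 \<Longrightarrow> potential f g \<Longrightarrow> (LINT x:{x \<in> slab c r. snd x \<in> V}|lborel. (f x)\<^sup>2) \<le> R C s f g c r"
    unfolding P_def by blast
  have "{x \<in> slab c r. snd x \<in> V} = slab c r" for c r
    using V(2) closure_subset[of \<omega>] by (auto simp: slab_def Om_def mem_Times_iff)
  then show ?thesis using V by (intro that[of C s0]) (auto simp: R_def)
qed

text \<open>The weak form of a harmonic function with homogeneous Neumann condition on the lateral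
  boundary; second derivatives of f do not occur.\<close>

definition harm :: "(real \<times> 'a \<Rightarrow> real) \<Rightarrow> (real \<times> 'a \<Rightarrow> real \<times> 'a) \<Rightarrow> bool" where
  "harm f g \<longleftrightarrow> potential f g \<and> solenoidal g"

lemma continuous_fst_comp: "continuous_on UNIV f \<Longrightarrow> continuous_on S (\<lambda>x. f (fst x))"
  by (rule continuous_on_compose2[of UNIV f]) (auto intro: continuous_intros)

text \<open>The test function is E^2 f with an axial cut-off E, so the cross term involves only the
  first component of g. Completing the square (E g1 + 2 E' f)^2 >= 0 absorbs it into half of the
  main term. The constant is 256 = 4 * 8^2, where 8 / \<sigma> bounds the slope of the
  cut-off.\<close>

lemma caccioppoli:
  assumes h: "harm f g" and r: "r \<ge> 0" and s: "\<sigma> > 0"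
  shows "(energy g c r) \<le> 256 / \<sigma>\<^sup>2 * (L2 f c (r + \<sigma>))"
proof -
  have cf: "continuous_on X f" and cg: "continuous_on X g" and gr: "\<And>x. x \<in> Om \<Longrightarrow> has_grad f x (g x)"
    and sol: "\<And>\<phi> \<phi>'. test \<phi> \<phi>' \<Longrightarrow> (LINT x:Om|lborel. g x \<bullet> \<phi>' x) = 0"
    using h by (auto simp: harm_def potential_def solenoidal_def)
  obtain e e' where e: "\<And>t. (e has_real_derivative e' t) (at t)" "continuous_on UNIV e'"
    "\<And>t. 0 \<le> e t" "\<And>t. e t \<le> 1" "\<And>t. \<bar>e' t\<bar> \<le> 8 / \<sigma>" "\<And>t. \<bar>t - c\<bar> \<le> r \<Longrightarrow> e t = 1"
    "\<And>t. \<bar>t - c\<bar> \<ge> r + \<sigma> \<Longrightarrow> e t = 0" "\<And>t. \<bar>t - c\<bar> \<ge> r + \<sigma> \<Longrightarrow> e' t = 0"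
    using cutoff_exists[OF s r, of c] by metis
  have ce: "continuous_on UNIV e" using e(1) DERIV_isCont continuous_at_imp_continuous_on by blast
  define E where "E x = e (fst x)" for x :: "real \<times> 'a"
  define E' where "E' x = e' (fst x)" for x :: "real \<times> 'a"
  have cE: "continuous_on S E" "continuous_on S E'" for S
    unfolding E_def E'_def by (intro continuous_fst_comp ce e)+
  define \<phi>' where "\<phi>' x = (E x * E x) *\<^sub>R g x + f x *\<^sub>R (E x *\<^sub>R (E' x *\<^sub>R (1, 0)) + E x *\<^sub>R (E' x *\<^sub>R (1, 0)))" for x
  define J where "J x = g x \<bullet> \<phi>' x" for x
  have "test (\<lambda>x. E x * E x * f x) \<phi>'"
    unfolding test_def
  proof (intro conjI ballI)
    show "continuous_on X (\<lambda>x. E x * E x * f x)" "continuous_on X \<phi>'"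
      unfolding \<phi>'_def by (intro continuous_intros cE cf cg)+
    show "has_grad (\<lambda>x. E x * E x * f x) x (\<phi>' x)" if "x \<in> Om" for x
    proof -
      have "has_grad E x (E' x *\<^sub>R (1, 0))" unfolding E_def E'_def by (rule has_grad_compose[OF has_grad_fst e(1)])
      from has_grad_mult[OF has_grad_mult[OF this this] gr[OF that]] show ?thesis by (simp add: \<phi>'_def)
    qed
    show "\<exists>T. \<forall>x\<in>X. T < \<bar>fst x\<bar> \<longrightarrow> E x * E x * f x = 0 \<and> \<phi>' x = 0"
    proof (intro exI[of _ "\<bar>c\<bar> + r + \<sigma>"] ballI impI)
      fix x :: "real \<times> 'a" assume "\<bar>c\<bar> + r + \<sigma> < \<bar>fst x\<bar>"
      then have "\<bar>fst x - c\<bar> \<ge> r + \<sigma>" by linarith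
      then show "E x * E x * f x = 0 \<and> \<phi>' x = 0" using e(7,8) by (simp add: E_def E'_def \<phi>'_def zero_prod_def)
    qed
  qed
  from sol[OF this] have J0: "(LINT x:Om|lborel. J x) = 0" by (simp add: J_def)
  have cJ: "continuous_on X J" unfolding J_def \<phi>'_def by (intro continuous_intros cE cf cg)
  have Jeq: "J x = (E x)\<^sup>2 * (norm (g x))\<^sup>2 + 2 * (f x * E x * E' x * fst (g x))" for x
  proof -
    have "g x \<bullet> (1, 0) = fst (g x)" by (simp add: inner_prod_def)
    then show ?thesis
      unfolding J_def \<phi>'_def inner_add_right inner_scaleR_right dot_square_norm
      by (simp add: power2_eq_square algebra_simps)
  qed
  have Jz: "J x = 0" if "\<bar>fst x - c\<bar> \<ge> r + \<sigma>" for x using e(7)[OF that] by (simp add: Jeq E_def)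
  have iJ: "set_integrable lborel Om J"
    by (rule integrable_slab_support[OF cJ, of "\<bar>c\<bar> + r + \<sigma>"]) (auto intro!: Jz)
  have c2: "continuous_on X (\<lambda>x. (f x)\<^sup>2)" "continuous_on X (\<lambda>x. (norm (g x))\<^sup>2)" by (intro continuous_intros cf cg)+
  have pt: "indicator (slab c r) x *\<^sub>R (norm (g x))\<^sup>2 \<le>
    2 * (indicator Om x *\<^sub>R J x) + 256 / \<sigma>\<^sup>2 * (indicator (slab c (r + \<sigma>)) x *\<^sub>R (f x)\<^sup>2)" for x
  proof (cases "x \<in> slab c (r + \<sigma>)")
    case True
    have "(fst (g x))\<^sup>2 \<le> (norm (g x))\<^sup>2" using abs_fst_le_norm[of "g x"] by (simp add: abs_le_square_iff[symmetric])
    then have "(E x)\<^sup>2 * (fst (g x))\<^sup>2 \<le> (E x)\<^sup>2 * (norm (g x))\<^sup>2" by (intro mult_left_mono) auto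
    moreover have "0 \<le> (E x * fst (g x) + 2 * (E' x * f x))\<^sup>2" by simp
    ultimately have 1: "(E x)\<^sup>2 * (norm (g x))\<^sup>2 \<le> 2 * J x + 4 * ((E' x)\<^sup>2 * (f x)\<^sup>2)"
      unfolding Jeq by (simp add: power2_sum power_mult_distrib algebra_simps)
    have "(E' x)\<^sup>2 \<le> (8 / \<sigma>)\<^sup>2" using e(5)[of "fst x"] power_mono[of "\<bar>E' x\<bar>" "8 / \<sigma>" 2] by (simp add: E'_def)
    then have "(E' x)\<^sup>2 * (f x)\<^sup>2 \<le> (8 / \<sigma>)\<^sup>2 * (f x)\<^sup>2" by (intro mult_right_mono) auto
    then have 2: "(E x)\<^sup>2 * (norm (g x))\<^sup>2 \<le> 2 * J x + 256 / \<sigma>\<^sup>2 * (f x)\<^sup>2"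
      using 1 by (simp add: power_divide)
    have "indicator (slab c r) x *\<^sub>R (norm (g x))\<^sup>2 \<le> (E x)\<^sup>2 * (norm (g x))\<^sup>2"
      using e(6)[of "fst x"] by (auto simp: indicator_def slab_def E_def)
    then show ?thesis using 2 True by (auto simp: slab_def)
  next
    case False
    then have z: "indicator Om x *\<^sub>R J x = 0" "x \<notin> slab c r"
      using Jz[of x] s by (auto simp: slab_def indicator_def)
    then show ?thesis unfolding z(1) using False by simp
  qed
  have "(energy g c r) \<le>
    integral\<^sup>L lborel (\<lambda>x. 2 * (indicator Om x *\<^sub>R J x) + 256 / \<sigma>\<^sup>2 * (indicator (slab c (r + \<sigma>)) x *\<^sub>R (f x)\<^sup>2))"
    unfolding set_lebesgue_integral_def
    using set_integrable_slab[OF c2(2), of c r] set_integrable_slab[OF c2(1), of c "r + \<sigma>"] iJ pt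
    unfolding set_integrable_def by (intro integral_mono) auto
  also have "\<dots> = 2 * (LINT x:Om|lborel. J x) + 256 / \<sigma>\<^sup>2 * (L2 f c (r + \<sigma>))"
    using set_integrable_slab[OF c2(1), of c "r + \<sigma>"] iJ
    unfolding set_integrable_def set_lebesgue_integral_def
    by (subst Bochner_Integration.integral_add) auto
  finally show ?thesis by (simp add: J0)
qed

text \<open>Nash and Caccioppoli are iterated over slabs with geometrically shrinking gaps.\<close>

lemma L1_L2_estimate:
  obtains C where "C \<ge> 0" "\<And>f g c. harm f g \<Longrightarrow>
    (L2 f c 1) \<le> C * (L1 f c 2)\<^sup>2"
proof -
  let ?N = "DIM(real \<times> 'a)"
  obtain C s0 where C: "C \<ge> 0" "s0 > 0" "\<And>s f g c r. 0 < s \<Longrightarrow> s \<le> s0 \<Longrightarrow> potential f g \<Longrightarrow>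
    (L2 f c r) \<le> C * s\<^sup>2 * (energy g c (r + s))
       + C / s ^ ?N * (L1 f c (r + s))\<^sup>2"
    using nash_inequality by blast
  define q where "q = 256 * C * 2 * 2 ^ ?N + 1"
  have q: "q \<ge> 1" using C by (simp add: q_def)
  \<comment> \<open>Nash at scale \<theta> \<sigma> followed by Caccioppoli with gap \<sigma> gives
    the factor \<kappa> = 256 C \<theta>^2, independent of \<sigma>. The choice of \<theta> brings
    \<kappa> 2^N below 1/2, where 2^N is the growth of the L1 coefficient each time \<sigma> is
    halved.\<close>
  define \<theta> where "\<theta> = min (min 1 s0) (1 / q)"
  have th: "0 < \<theta>" "\<theta> \<le> 1" "\<theta> \<le> s0" "\<theta> \<le> 1 / q" using C q by (auto simp: \<theta>_def)
  define \<kappa> where "\<kappa> = 256 * C * \<theta>\<^sup>2"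
  have k0: "0 \<le> \<kappa>" using C by (simp add: \<kappa>_def)
  have kM: "\<kappa> * 2 ^ ?N \<le> 1 / 2"
  proof -
    have "\<theta>\<^sup>2 \<le> \<theta> * 1" unfolding power2_eq_square using th by (intro mult_left_mono) auto
    then have t: "\<theta>\<^sup>2 \<le> 1 / q" using th by simp
    have "\<kappa> * 2 ^ ?N * 2 = (256 * C * 2 * 2 ^ ?N) * \<theta>\<^sup>2" by (simp add: \<kappa>_def)
    also have "\<dots> \<le> q * (1 / q)" using t C q by (intro mult_mono) (auto simp: q_def)
    finally show ?thesis using q by simp
  qed
  have k12: "\<kappa> \<le> 1 / 2"
  proof -
    have "\<kappa> * 1 \<le> \<kappa> * 2 ^ ?N" using k0 by (intro mult_left_mono) (auto simp del: DIM_prod)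
    then show ?thesis using kM by linarith
  qed
  define D where "D = C * 4 ^ ?N / \<theta> ^ ?N"
  have D0: "D \<ge> 0" using C th by (simp add: D_def)
  have "(L2 f c 1) \<le> (2 * D) * (L1 f c 2)\<^sup>2" if h: "harm f g" for f g c
  proof -
    have pot: "potential f g" and cf: "continuous_on X f" and cg: "continuous_on X g"
      using h by (auto simp: harm_def potential_def)
    \<comment> \<open>The half-widths rise from 1 towards 2, and \<open>r (Suc k) - r k\<close>
      equals 2 \<sigma> k: one \<sigma> k pays for the Nash enlargement \<theta> \<sigma> k, the
      other for the gap in Caccioppoli.\<close>
    define r where "r k = 2 - (1 / 2 :: real) ^ k" for k :: nat
    define \<sigma> where "\<sigma> k = (1 / 2 :: real) ^ (k + 2)" for k :: nat
    define L where "L = (L1 f c 2)"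
    define a where "a k = (L2 f c (r k))" for k
    have c2: "continuous_on X (\<lambda>x. (f x)\<^sup>2)" "continuous_on X (\<lambda>x. \<bar>f x\<bar>)" by (intro continuous_intros cf)+
    have r1: "1 \<le> r k" "r k \<le> 2" for k by (auto simp: r_def power_le_one)
    have sg: "\<sigma> k > 0" "\<sigma> k \<le> 1" for k unfolding \<sigma>_def by (simp, rule power_le_one) auto
    have gap: "r k + \<theta> * \<sigma> k + \<sigma> k \<le> r (Suc k)" for k
    proof -
      have "\<theta> * \<sigma> k \<le> 1 * \<sigma> k" using th sg[of k] by (intro mult_right_mono) auto
      moreover have "r k + \<sigma> k + \<sigma> k = r (Suc k)" by (simp add: r_def \<sigma>_def)
      ultimately show ?thesis by simp
    qed
    have step: "a k \<le> \<kappa> * a (Suc k) + (D * L\<^sup>2) * (2 ^ ?N) ^ k" for k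
    proof -
      let ?s = "\<theta> * \<sigma> k"
      have s: "0 < ?s" "?s \<le> s0" using th sg[of k] mult_mono[of \<theta> s0 "\<sigma> k" 1] C by auto
      have n1: "a k \<le> C * ?s\<^sup>2 * (energy g c (r k + ?s))
        + C / ?s ^ ?N * (L1 f c (r k + ?s))\<^sup>2"
        unfolding a_def by (rule C(3)[OF s pot])
      have "(energy g c (r k + ?s)) \<le> 256 / (\<sigma> k)\<^sup>2 * (L2 f c (r k + ?s + \<sigma> k))"
        using r1[of k] s sg by (intro caccioppoli[OF h]) auto
      also have "\<dots> \<le> 256 / (\<sigma> k)\<^sup>2 * a (Suc k)"
        unfolding a_def using gap[of k]
        by (intro mult_left_mono slab_integral_mono_set[OF c2(1)] slab_borel slab_mono order_refl) auto
      finally have n2: "C * ?s\<^sup>2 * (energy g c (r k + ?s)) \<le> C * ?s\<^sup>2 * (256 / (\<sigma> k)\<^sup>2 * a (Suc k))"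
        using C by (intro mult_left_mono) auto
      have n3: "C * ?s\<^sup>2 * (256 / (\<sigma> k)\<^sup>2 * a (Suc k)) = \<kappa> * a (Suc k)"
        using sg[of k] by (simp add: \<kappa>_def power_mult_distrib)
      have "(L1 f c (r k + ?s)) \<le> L"
        unfolding L_def using gap[of k] sg[of k] r1[of "Suc k"]
        by (intro slab_integral_mono_set[OF c2(2)] slab_borel slab_mono order_refl) auto
      moreover have "0 \<le> (L1 f c (r k + ?s))"
        by (rule set_integral_nonneg_real) simp
      ultimately have "(L1 f c (r k + ?s))\<^sup>2 \<le> L\<^sup>2" by (intro power_mono)
      then have n4: "C / ?s ^ ?N * (L1 f c (r k + ?s))\<^sup>2 \<le> C / ?s ^ ?N * L\<^sup>2"
        using C s by (intro mult_left_mono) auto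
      have "1 / ?s = 4 * 2 ^ k / \<theta>" by (simp add: \<sigma>_def power_divide)
      then have "(1 / ?s) ^ ?N = (4 * 2 ^ k / \<theta>) ^ ?N" by (rule arg_cong)
      then have "1 / ?s ^ ?N = 4 ^ ?N * (2 ^ ?N) ^ k / \<theta> ^ ?N"
        by (simp only: power_divide power_one power_mult_distrib power_mult[symmetric] mult.commute[of k])
      then have "C * (1 / ?s ^ ?N) = D * (2 ^ ?N) ^ k" by (simp only: D_def times_divide_eq_right times_divide_eq_left mult.assoc)
      then have "C / ?s ^ ?N = D * (2 ^ ?N) ^ k" by (simp only: times_divide_eq_right mult_1_right)
      then have "C / ?s ^ ?N * L\<^sup>2 = (D * L\<^sup>2) * (2 ^ ?N) ^ k" by (simp only: mult_ac)
      with n1 n2 n3 n4 show ?thesis by linarith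
    qed
    \<comment> \<open>Boundedness alone removes the remainder of the iteration; the size of this
      bound does not enter the estimate.\<close>
    have bd: "a k \<le> (L2 f c 2)" for k
      unfolding a_def using r1
      by (intro slab_integral_mono_set[OF c2(1)] slab_borel slab_mono order_refl) auto
    have "a 0 \<le> 2 * (D * L\<^sup>2)"
      by (rule geometric_iteration[OF step bd k0 k12 kM]) (use D0 in auto)
    moreover have "r 0 = 1" by (simp add: r_def)
    ultimately show ?thesis by (simp add: a_def L_def mult.assoc)
  qed
  then show ?thesis using D0 by (intro that[of "2 * D"]) auto
qed

end

subsection \<open>Linear growth in the mean\<close>

text \<open>The tent of height 1 on [-1, 1], written as a second difference of the positive
  part.\<close>

definition hat :: "real \<Rightarrow> real" where
  "hat t = max 0 (t + 1) - 2 * max 0 t + max 0 (t - 1)"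

lemma hat_nonneg: "0 \<le> hat t" by (simp add: hat_def max_def)
lemma hat_eq_0: "\<bar>t\<bar> \<ge> 1 \<Longrightarrow> hat t = 0" by (auto simp: hat_def max_def)
lemma continuous_hat [continuous_intros]: "continuous_on S f \<Longrightarrow> continuous_on S (\<lambda>x. hat (f x))"
  unfolding hat_def by (intro continuous_intros)
lemma hat_partition:
  "\<bar>t\<bar> < 2 \<Longrightarrow> hat (t - 2) + hat (t - 1) + hat t + hat (t + 1) + hat (t + 2) = 1"
  by (auto simp: hat_def max_def abs_less_iff)

text \<open>The witness is the cubic B-spline.\<close>

lemma spline_exists:
  obtains \<eta> \<eta>1 where "\<And>t. (\<eta> has_real_derivative \<eta>1 t) (at t)"
    "\<And>t. (\<eta>1 has_real_derivative hat (t - 1) - 2 * hat t + hat (t + 1)) (at t)"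
    "\<And>t. \<bar>t\<bar> \<ge> 2 \<Longrightarrow> \<eta> t = 0" "\<And>t. \<bar>t\<bar> \<ge> 2 \<Longrightarrow> \<eta>1 t = 0"
proof -
  define q where "q n a t = (max 0 (t + a)) ^ n" for n and a t :: real
  \<comment> \<open>A fourth difference of cubed positive parts. The weights 1, -4, 6, -4, 1
    annihilate polynomials of degree at most three, hence the bounded support. Differentiating twice
    leaves the fourth difference of the positive part, which is the second difference of the
    tent.\<close>
  define \<eta> where "\<eta> t = (q 3 2 t - 4 * q 3 1 t + 6 * q 3 0 t - 4 * q 3 (-1) t + q 3 (-2) t) / 6" for t
  define \<eta>1 where "\<eta>1 t = (q 2 2 t - 4 * q 2 1 t + 6 * q 2 0 t - 4 * q 2 (-1) t + q 2 (-2) t) / 2" for t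
  have dq: "((\<lambda>t. q n a t) has_real_derivative real n * q (n - 1) a t) (at t)" if "n \<ge> 2" for n a t
    unfolding q_def using DERIV_shift[of "\<lambda>s. max 0 s ^ n" _ t a] pos_part_power_deriv[OF that, of "t + a"] by simp
  have d3: "((\<lambda>t. q 3 a t) has_real_derivative 3 * q 2 a t) (at t)" for a t using dq[of 3 a t] by simp
  have d2: "((\<lambda>t. q 2 a t) has_real_derivative 2 * q 1 a t) (at t)" for a t using dq[of 2 a t] by simp
  show ?thesis
  proof (rule that[of \<eta> \<eta>1])
    fix t :: real
    show "(\<eta> has_real_derivative \<eta>1 t) (at t)" unfolding \<eta>_def \<eta>1_def
      by (rule derivative_eq_intros d3 refl | simp)+
    have "(\<eta>1 has_real_derivative q 1 2 t - 4 * q 1 1 t + 6 * q 1 0 t - 4 * q 1 (-1) t + q 1 (-2) t) (at t)"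
      unfolding \<eta>1_def by (rule derivative_eq_intros d2 refl | simp)+
    moreover have "q 1 2 t - 4 * q 1 1 t + 6 * q 1 0 t - 4 * q 1 (-1) t + q 1 (-2) t = hat (t - 1) - 2 * hat t + hat (t + 1)"
      by (simp add: hat_def q_def add.commute)
    ultimately show "(\<eta>1 has_real_derivative hat (t - 1) - 2 * hat t + hat (t + 1)) (at t)" by simp
    consider "t \<ge> 2" | "t \<le> -2" | "\<bar>t\<bar> < 2" by linarith
    then show "\<eta> t = 0" if "\<bar>t\<bar> \<ge> 2"
      using that by cases (auto simp: \<eta>_def q_def power3_eq_cube algebra_simps)
    consider "t \<ge> 2" | "t \<le> -2" | "\<bar>t\<bar> < 2" by linarith
    then show "\<eta>1 t = 0" if "\<bar>t\<bar> \<ge> 2"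
      using that by cases (auto simp: \<eta>1_def q_def power2_eq_square algebra_simps)
  qed
qed

lemma int_sequence_affine:
  fixes m :: "int \<Rightarrow> real"
  assumes "\<And>k. m (k + 1) - 2 * m k + m (k - 1) = 0"
  shows "m k = m 0 + of_int k * (m 1 - m 0)"
proof -
  have "m k = m 0 + of_int k * (m 1 - m 0) \<and> m (k + 1) = m 0 + of_int (k + 1) * (m 1 - m 0)"
  proof (induction k rule: int_induct[where k = 0])
    case base then show ?case by simp
  next
    case (step1 i)
    then show ?case using assms[of "i + 1"] by (simp add: algebra_simps)
  next
    case (step2 i)
    then show ?case using assms[of i] by (simp add: algebra_simps)
  qed
  then show ?thesis ..
qed

context cylinder begin

section \<open>Axial translations and the growth of means\<close>

lemma shift_X: "x + (h, 0) \<in> X \<longleftrightarrow> x \<in> X" by (auto simp: X_def mem_Times_iff)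
lemma shift_Om: "x + (h, 0) \<in> Om \<longleftrightarrow> x \<in> Om" by (auto simp: Om_def mem_Times_iff)

lemma continuous_on_X_shift:
  fixes f :: "real \<times> 'a \<Rightarrow> 'b::topological_space"
  assumes "continuous_on X f" shows "continuous_on X (\<lambda>x. f (x + (h, 0)))"
  by (rule continuous_on_compose2[OF assms]) (auto intro!: continuous_intros simp: X_def)

lemma Om_integral_shift:
  assumes "set_integrable lborel Om F"
  shows "(LINT x:Om|lborel. F (x + (h, 0))) = (LINT x:Om|lborel. F x :: real)"
proof -
  have m: "(\<lambda>x. indicator Om x *\<^sub>R F x) \<in> borel_measurable borel"
    using borel_measurable_integrable[OF assms[unfolded set_integrable_def]] by simp
  have "(\<lambda>x. indicator Om x *\<^sub>R F (x + (h, 0))) = (\<lambda>x. (\<lambda>x. indicator Om x *\<^sub>R F x) (x + (h, 0)))"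
    by (auto simp: indicator_def shift_Om)
  then show ?thesis unfolding set_lebesgue_integral_def using lborel_integral_shift[OF m, of "(h, 0)"] by simp
qed

lemma test_integrable:
  assumes "test \<phi> \<phi>'" "continuous_on X v"
  shows "set_integrable lborel Om (\<lambda>x. v x \<bullet> \<phi>' x)"
proof -
  obtain T where T: "\<And>x. x \<in> X \<Longrightarrow> \<bar>fst x\<bar> > T \<Longrightarrow> \<phi>' x = 0" using assms(1) unfolding test_def by blast
  show ?thesis
    by (rule integrable_slab_support[of _ T]) (use assms T in \<open>auto simp: test_def intro!: continuous_intros\<close>)
qed

lemma test_shift:
  assumes "test \<phi> \<phi>'" shows "test (\<lambda>x. \<phi> (x + (h, 0))) (\<lambda>x. \<phi>' (x + (h, 0)))"
proof -
  obtain T where T: "\<And>x. x \<in> X \<Longrightarrow> \<bar>fst x\<bar> > T \<Longrightarrow> \<phi> x = 0 \<and> \<phi>' x = 0" using assms(1) unfolding test_def by blast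
  have "\<phi> (x + (h, 0)) = 0 \<and> \<phi>' (x + (h, 0)) = 0" if "x \<in> X" "\<bar>fst x\<bar> > T + \<bar>h\<bar>" for x
    using that by (intro T) (auto simp: shift_X)
  then have "\<exists>T. \<forall>x\<in>X. \<bar>fst x\<bar> > T \<longrightarrow> \<phi> (x + (h, 0)) = 0 \<and> \<phi>' (x + (h, 0)) = 0" by blast
  then show ?thesis using assms unfolding test_def
    by (auto intro!: continuous_on_X_shift has_grad_shift simp del: add_Pair) (simp_all add: shift_Om del: add_Pair)
qed

lemma solenoidal_shift:
  assumes "solenoidal v" shows "solenoidal (\<lambda>x. v (x + (h, 0)))"
  unfolding solenoidal_def
proof (intro conjI allI impI)
  have cv: "continuous_on X v" using assms by (simp add: solenoidal_def)
  then show "continuous_on X (\<lambda>x. v (x + (h, 0)))" by (rule continuous_on_X_shift)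
  fix \<phi> \<phi>' assume t: "test \<phi> \<phi>'"
  have t': "test (\<lambda>x. \<phi> (x + (-h, 0))) (\<lambda>x. \<phi>' (x + (-h, 0)))" by (rule test_shift[OF t])
  have sh: "x + (h, 0) + (-h, 0) = x" for x :: "real \<times> 'a" by (simp add: prod_eq_iff)
  have "(LINT x:Om|lborel. v (x + (h, 0)) \<bullet> \<phi>' x) = (LINT x:Om|lborel. v (x + (h, 0)) \<bullet> \<phi>' (x + (h, 0) + (-h, 0)))"
    by (simp only: sh)
  also have "\<dots> = (LINT x:Om|lborel. v x \<bullet> \<phi>' (x + (-h, 0)))"
    by (rule Om_integral_shift[OF test_integrable[OF t' cv]])
  also have "\<dots> = 0" using assms t' unfolding solenoidal_def by blast
  finally show "(LINT x:Om|lborel. v (x + (h, 0)) \<bullet> \<phi>' x) = 0" .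
qed

lemma solenoidal_diff:
  assumes "solenoidal v" "solenoidal w" shows "solenoidal (\<lambda>x. v x - w x)"
  unfolding solenoidal_def
proof (intro conjI allI impI)
  have c: "continuous_on X v" "continuous_on X w" using assms by (auto simp: solenoidal_def)
  then show "continuous_on X (\<lambda>x. v x - w x)" by (rule continuous_on_diff)
  fix \<phi> \<phi>' assume t: "test \<phi> \<phi>'"
  have "(LINT x:Om|lborel. (v x - w x) \<bullet> \<phi>' x) = (LINT x:Om|lborel. v x \<bullet> \<phi>' x - w x \<bullet> \<phi>' x)"
    by (simp add: inner_diff_left)
  also have "\<dots> = (LINT x:Om|lborel. v x \<bullet> \<phi>' x) - (LINT x:Om|lborel. w x \<bullet> \<phi>' x)"
    by (rule set_integral_diff(2)[OF test_integrable[OF t c(1)] test_integrable[OF t c(2)]])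
  also have "\<dots> = 0" using assms t unfolding solenoidal_def by simp
  finally show "(LINT x:Om|lborel. (v x - w x) \<bullet> \<phi>' x) = 0" .
qed

text \<open>The constant axial field is divergence-free and tangent to the boundary. Testing it says
  that axial derivatives of test functions integrate to zero, which is integration by parts along
  the axis.\<close>

lemma solenoidal_axis: "solenoidal (\<lambda>x. (1, 0))"
proof (rule tangential_solenoidal[of _ "\<lambda>_. 0"])
  show "((\<lambda>x. (1, 0)) has_derivative blinfun_apply 0) (at x)" for x :: "real \<times> 'a"
    by (simp add: zero_blinfun.rep_eq)
  show "div_of (0 :: (real \<times> 'a) \<Rightarrow>\<^sub>L (real \<times> 'a)) = 0" by (simp add: div_of_def)
qed (auto simp: inner_prod_def)

lemma harm_shift_diff:
  assumes "harm f g" shows "harm (\<lambda>x. f (x + (h, 0)) - f x) (\<lambda>x. g (x + (h, 0)) - g x)"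
proof -
  have p: "continuous_on X f" "continuous_on X g" "\<And>x. x \<in> Om \<Longrightarrow> has_grad f x (g x)" "solenoidal g"
    using assms by (auto simp: harm_def potential_def)
  have "potential (\<lambda>x. f (x + (h, 0)) - f x) (\<lambda>x. g (x + (h, 0)) - g x)"
    unfolding potential_def
  proof (intro conjI ballI)
    show "continuous_on X (\<lambda>x. f (x + (h, 0)) - f x)" "continuous_on X (\<lambda>x. g (x + (h, 0)) - g x)"
      by (intro continuous_on_diff continuous_on_X_shift p)+
    fix x assume x: "x \<in> Om"
    show "has_grad (\<lambda>x. f (x + (h, 0)) - f x) x (g (x + (h, 0)) - g x)"
      by (intro has_grad_diff has_grad_shift p x) (simp only: shift_Om x)
  qed
  then show ?thesis unfolding harm_def using solenoidal_diff[OF solenoidal_shift[OF p(4)] p(4)] by blast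
qed

text \<open>The weak form of the fact that cross-sectional means have zero second derivative.
  Testing g with the spline gives that the integral of g1 \<eta>' vanishes; testing the axial field
  with \<eta>' f gives the same for g1 \<eta>' + f \<eta>''. The difference is the integral of f
  \<eta>'', and \<eta>'' is a second difference of tents.\<close>

lemma hat_integral_second_difference:
  assumes h: "harm f g"
  shows "(LINT x:Om|lborel. f x * hat (fst x - (t + 1))) - 2 * (LINT x:Om|lborel. f x * hat (fst x - t))
    + (LINT x:Om|lborel. f x * hat (fst x - (t - 1))) = 0"
proof -
  have p: "continuous_on X f" "continuous_on X g" "\<And>x. x \<in> Om \<Longrightarrow> has_grad f x (g x)" "solenoidal g"
    using h by (auto simp: harm_def potential_def)
  obtain \<eta> \<eta>1 where e: "\<And>t. (\<eta> has_real_derivative \<eta>1 t) (at t)"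
    "\<And>t. (\<eta>1 has_real_derivative hat (t - 1) - 2 * hat t + hat (t + 1)) (at t)"
    "\<And>t. \<bar>t\<bar> \<ge> 2 \<Longrightarrow> \<eta> t = 0" "\<And>t. \<bar>t\<bar> \<ge> 2 \<Longrightarrow> \<eta>1 t = 0" using spline_exists by metis
  define \<eta>2 where "\<eta>2 t = hat (t - 1) - 2 * hat t + hat (t + 1)" for t
  have c: "continuous_on UNIV \<eta>" "continuous_on UNIV \<eta>1" "continuous_on UNIV \<eta>2"
  proof -
    have cd: "continuous_on UNIV k" if "\<And>s. (k has_real_derivative k' s) (at s)" for k k' :: "real \<Rightarrow> real"
      by (rule continuous_at_imp_continuous_on) (use DERIV_isCont[OF that] in blast)
    show "continuous_on UNIV \<eta>" by (rule cd[OF e(1)])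
    show "continuous_on UNIV \<eta>1" by (rule cd[OF e(2)])
    show "continuous_on UNIV \<eta>2" unfolding \<eta>2_def by (intro continuous_intros)
  qed
  have cs: "continuous_on X (\<lambda>x. k (fst x - t))" if "continuous_on UNIV k" for k :: "real \<Rightarrow> real"
    by (rule continuous_fst_comp[of "\<lambda>s. k (s - t)"]) (rule continuous_on_compose2[OF that], auto intro: continuous_intros)
  have d: "has_grad (\<lambda>x. k (fst x - t)) x (k' (fst x - t) *\<^sub>R (1, 0))"
    if "\<And>s. (k has_real_derivative k' s) (at s)" for k k' and x :: "real \<times> 'a"
  proof -
    have "((\<lambda>s. k (s - t)) has_real_derivative k' (fst x - t) * 1) (at (fst x))"
      by (rule DERIV_chain2[OF that]) (auto intro!: derivative_eq_intros)
    from has_grad_compose[OF has_grad_fst this] show ?thesis by simp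
  qed
  have far: "\<bar>s - t\<bar> \<ge> 2" if "\<bar>s\<bar> > \<bar>t\<bar> + 2" for s :: real using that by linarith
  have z2: "\<eta>2 s = 0" if "\<bar>s\<bar> \<ge> 2" for s using that by (auto simp: \<eta>2_def hat_def max_def)
  have t1: "test (\<lambda>x. \<eta> (fst x - t)) (\<lambda>x. \<eta>1 (fst x - t) *\<^sub>R (1, 0))"
    unfolding test_def
    by (intro conjI ballI d e(1) cs c continuous_intros exI[of _ "\<bar>t\<bar> + 2"] impI)
      (use far e(3,4) in \<open>auto simp: zero_prod_def\<close>)
  have t2: "test (\<lambda>x. \<eta>1 (fst x - t) * f x) (\<lambda>x. \<eta>1 (fst x - t) *\<^sub>R g x + f x *\<^sub>R (\<eta>2 (fst x - t) *\<^sub>R (1, 0)))"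
    unfolding test_def
  proof (intro conjI ballI exI[of _ "\<bar>t\<bar> + 2"] impI)
    show "has_grad (\<lambda>x. \<eta>1 (fst x - t) * f x) x (\<eta>1 (fst x - t) *\<^sub>R g x + f x *\<^sub>R (\<eta>2 (fst x - t) *\<^sub>R (1, 0)))"
      if "x \<in> Om" for x
      by (rule has_grad_mult[OF d p(3)[OF that]]) (use e(2) in \<open>simp add: \<eta>2_def\<close>)
  qed (use far e(4) z2 in \<open>auto intro!: continuous_intros cs c p simp: zero_prod_def\<close>)
  have i1: "(LINT x:Om|lborel. g x \<bullet> (\<eta>1 (fst x - t) *\<^sub>R (1, 0))) = 0"
    using p(4) t1 unfolding solenoidal_def by blast
  have i2: "(LINT x:Om|lborel. (1, 0) \<bullet> (\<eta>1 (fst x - t) *\<^sub>R g x + f x *\<^sub>R (\<eta>2 (fst x - t) *\<^sub>R (1, 0)))) = 0"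
    using solenoidal_axis t2 unfolding solenoidal_def by blast
  have i3: "set_integrable lborel Om (\<lambda>x. f x * \<eta>2 (fst x - t))"
    by (rule integrable_slab_support[of _ "\<bar>t\<bar> + 2"]) (use far z2 in \<open>auto intro!: continuous_intros p cs c\<close>)
  have "(1, 0) \<bullet> (\<eta>1 (fst x - t) *\<^sub>R g x + f x *\<^sub>R (\<eta>2 (fst x - t) *\<^sub>R (1, 0))) =
    g x \<bullet> (\<eta>1 (fst x - t) *\<^sub>R (1, 0)) + f x * \<eta>2 (fst x - t)" for x
    by (simp add: inner_prod_def)
  then have "(LINT x:Om|lborel. f x * \<eta>2 (fst x - t)) = 0"
    using i1 i2 set_integral_add(2)[OF test_integrable[OF t1 p(2)] i3] by simp
  moreover have "f x * \<eta>2 (fst x - t) = f x * hat (fst x - (t + 1)) - 2 * (f x * hat (fst x - t)) + f x * hat (fst x - (t - 1))" for x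
    by (simp add: \<eta>2_def algebra_simps)
  moreover have ih: "set_integrable lborel Om (\<lambda>x. f x * hat (fst x - s))" for s
    by (rule integrable_slab_support[of _ "\<bar>s\<bar> + 1"])
      (auto intro!: continuous_intros p hat_eq_0)
  ultimately show ?thesis
    by (simp add: set_integral_add(2) set_integral_diff(2) set_integral_diff(1) ih)
qed

lemma hat_integrable:
  assumes "continuous_on X f"
  shows "set_integrable lborel Om (\<lambda>x. f x * hat (fst x - s))"
  by (rule integrable_slab_support[of _ "\<bar>s\<bar> + 1"]) (auto intro!: continuous_intros assms hat_eq_0)

text \<open>A tent centred at a nonzero integer sees one half only, so the sign bound converts its
  weighted L1 norm into plus or minus the mean, up to 2 C V with V the integral of a tent; and the
  means are affine. The tent at 0 meets both halves and is absorbed into the constant.\<close>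

lemma L1_growth:
  assumes h: "harm f g" and \<sigma>: "\<sigma> = 1 \<or> \<sigma> = (-1::real)" and C: "C \<ge> 0"
    and right: "\<And>x. x \<in> X \<Longrightarrow> fst x \<ge> 0 \<Longrightarrow> \<sigma> * f x \<ge> - C"
    and left: "\<And>x. x \<in> X \<Longrightarrow> fst x \<le> 0 \<Longrightarrow> - \<sigma> * f x \<ge> - C"
  obtains K where "K \<ge> 0" "\<And>k::int. (L1 f (of_int k) 2) \<le> K * (1 + \<bar>of_int k\<bar>)"
proof -
  have cf: "continuous_on X f" using h by (auto simp: harm_def potential_def)
  define m where "m k = (LINT x:Om|lborel. f x * hat (fst x - of_int k))" for k :: int
  define A where "A k = (LINT x:Om|lborel. \<bar>f x\<bar> * hat (fst x - of_int k))" for k :: int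
  define V where "V = (LINT x:Om|lborel. 1 * hat (fst x - 0))"
  have ca: "continuous_on X (\<lambda>x. \<bar>f x\<bar>)" by (intro continuous_intros cf)
  have V: "(LINT x:Om|lborel. 1 * hat (fst x - of_int k)) = V" for k :: int
    using Om_integral_shift[OF hat_integrable[of "\<lambda>_. 1" 0], of "- of_int k"] unfolding V_def by simp
  have V0: "V \<ge> 0" unfolding V_def by (rule set_integral_nonneg_real) (simp add: hat_nonneg)
  have aff: "m k = m 0 + of_int k * (m 1 - m 0)" for k
    by (rule int_sequence_affine) (use hat_integral_second_difference[OF h] in \<open>simp add: m_def\<close>)
  have mb: "\<bar>m k\<bar> \<le> \<bar>m 0\<bar> + \<bar>of_int k\<bar> * \<bar>m 1 - m 0\<bar>" for k
    unfolding aff[of k] using abs_triangle_ineq[of "m 0" "of_int k * (m 1 - m 0)"] by (simp add: abs_mult)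
  have half: "A k \<le> \<tau> * m k + 2 * C * V"
    if t: "\<tau> = 1 \<or> \<tau> = (-1::real)" and b: "\<And>x. x \<in> X \<Longrightarrow> \<bar>fst x - of_int k\<bar> < 1 \<Longrightarrow> \<tau> * f x \<ge> - C" for k :: int and \<tau>
  proof -
    have "A k \<le> (LINT x:Om|lborel. \<tau> * (f x * hat (fst x - of_int k)) + 2 * C * (1 * hat (fst x - of_int k)))"
      unfolding A_def
    proof (rule set_integral_mono)
      fix x assume "x \<in> Om"
      then have x: "x \<in> X" using Om_subset_X by auto
      show "\<bar>f x\<bar> * hat (fst x - of_int k) \<le> \<tau> * (f x * hat (fst x - of_int k)) + 2 * C * (1 * hat (fst x - of_int k))"
      proof (cases "\<bar>fst x - of_int k\<bar> < 1")
        case True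
        have "\<bar>f x\<bar> \<le> \<tau> * f x + 2 * C" using b[OF x True] C t by auto
        then have "\<bar>f x\<bar> * hat (fst x - of_int k) \<le> (\<tau> * f x + 2 * C) * hat (fst x - of_int k)"
          by (rule mult_right_mono[OF _ hat_nonneg])
        then show ?thesis by (simp add: algebra_simps)
      qed (simp add: hat_eq_0)
    qed (intro hat_integrable[OF ca] set_integral_add(1) set_integrable_mult_right impI hat_integrable cf continuous_on_const)+
    also have "\<dots> = \<tau> * m k + 2 * C * V"
      unfolding V[of k, symmetric] m_def
      by (subst set_integral_add(2)) (auto intro!: set_integrable_mult_right hat_integrable cf simp del: mult_1)
    finally show ?thesis .
  qed
  define K0 where "K0 = \<bar>m 0\<bar> + \<bar>m 1 - m 0\<bar> + 2 * C * V + A 0"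
  have A0: "A k \<ge> 0" for k unfolding A_def by (rule set_integral_nonneg_real) (simp add: hat_nonneg)
  have K0: "K0 \<ge> 0" using A0[of 0] V0 C by (simp add: K0_def)
  have AK: "A k \<le> K0 * (1 + \<bar>of_int k\<bar>)" for k
  proof -
    have main: "A k \<le> K0 * (1 + \<bar>of_int k\<bar>)" if "A k \<le> \<tau> * m k + 2 * C * V" "\<tau> = 1 \<or> \<tau> = (-1::real)" for \<tau>
    proof -
      have "\<tau> * m k \<le> \<bar>m k\<bar>" using that(2) by auto
      then have "A k \<le> \<bar>m 0\<bar> + \<bar>of_int k\<bar> * \<bar>m 1 - m 0\<bar> + 2 * C * V" using that(1) mb[of k] by linarith
      also have "\<dots> \<le> K0 + K0 * \<bar>of_int k\<bar>"
      proof -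
        have "0 \<le> 2 * C * V" using V0 C by simp
        then have a: "\<bar>m 1 - m 0\<bar> \<le> K0" "\<bar>m 0\<bar> + 2 * C * V \<le> K0" using A0[of 0] by (auto simp: K0_def)
        show ?thesis using mult_left_mono[OF a(1), of "\<bar>of_int k\<bar>"] a(2) by (simp add: mult.commute)
      qed
      finally show ?thesis by (simp add: algebra_simps)
    qed
    consider "k = 0" | "k \<ge> 1" | "k \<le> -1" by linarith
    then show ?thesis
    proof cases
      case 1
      have "0 \<le> 2 * C * V" using V0 C by simp
      then show ?thesis using 1 by (simp add: K0_def)
    next
      case 2
      then have "of_int k \<ge> (1::real)" by simp
      then have "\<sigma> * f x \<ge> - C" if "x \<in> X" "\<bar>fst x - of_int k\<bar> < 1" for x using that by (intro right) auto
      from main[OF half[OF \<sigma> this] \<sigma>] show ?thesis .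
    next
      case 3
      then have "of_int k \<le> (-1::real)" by simp
      then have b: "(- \<sigma>) * f x \<ge> - C" if "x \<in> X" "\<bar>fst x - of_int k\<bar> < 1" for x using that by (intro left) auto
      have s: "- \<sigma> = 1 \<or> - \<sigma> = (-1::real)" using \<sigma> by auto
      from main[OF half[OF s b] s] show ?thesis .
    qed
  qed
  \<comment> \<open>Five neighbouring tents sum to one on the slab. Each is bounded by K0 (3 + |k|),
    at most 3 K0 (1 + |k|), whence 15 = 5 * 3.\<close>
  have "(L1 f (of_int k) 2) \<le> (15 * K0) * (1 + \<bar>of_int k\<bar>)" for k
  proof -
    let ?h = "\<lambda>j x. \<bar>f x\<bar> * hat (fst x - of_int (k + j))"
    have ih: "set_integrable lborel Om (?h j)" for j by (rule hat_integrable[OF ca])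
    have "(L1 f (of_int k) 2) \<le> (LINT x:Om|lborel. ?h 2 x + ?h 1 x + ?h 0 x + ?h (-1) x + ?h (-2) x)"
    proof -
      have "indicator (slab (of_int k) 2) x *\<^sub>R \<bar>f x\<bar> \<le> indicator Om x *\<^sub>R (?h 2 x + ?h 1 x + ?h 0 x + ?h (-1) x + ?h (-2) x)" for x
      proof (cases "x \<in> slab (of_int k) 2")
        case True
        then have x: "x \<in> Om" "\<bar>fst x - of_int k\<bar> < 2" by (auto simp: slab_def)
        have "\<bar>f x\<bar> * (hat (fst x - of_int k - 2) + hat (fst x - of_int k - 1) + hat (fst x - of_int k)
           + hat (fst x - of_int k + 1) + hat (fst x - of_int k + 2)) = \<bar>f x\<bar>"
          using hat_partition[OF x(2)] by simp
        then show ?thesis using True x by (simp add: algebra_simps)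
      qed (auto simp: indicator_def intro!: add_nonneg_nonneg mult_nonneg_nonneg hat_nonneg)
      moreover have "set_integrable lborel Om (\<lambda>x. ?h 2 x + ?h 1 x + ?h 0 x + ?h (-1) x + ?h (-2) x)"
        by (intro set_integral_add(1) ih)
      ultimately show ?thesis using set_integrable_slab[OF ca, of "of_int k" 2]
        unfolding set_integrable_def set_lebesgue_integral_def by (intro integral_mono) auto
    qed
    also have "\<dots> = A (k + 2) + A (k + 1) + A (k + 0) + A (k + (-1)) + A (k + (-2))"
      unfolding A_def by (simp only: set_integral_add ih)
    also have "\<dots> \<le> K0 * (3 + \<bar>of_int k\<bar>) * 5"
    proof -
      have "A (k + j) \<le> K0 * (3 + \<bar>of_int k\<bar>)" if "\<bar>j\<bar> \<le> 2" for j
      proof -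
        have "\<bar>of_int (k + j)\<bar> \<le> (2 + \<bar>of_int k\<bar> :: real)" using that by linarith
        then have "K0 * (1 + \<bar>of_int (k + j)\<bar>) \<le> K0 * (3 + \<bar>of_int k\<bar>)" using K0 by (intro mult_left_mono) auto
        then show ?thesis using AK[of "k + j"] by linarith
      qed
      from this[of 2] this[of 1] this[of 0] this[of "-1"] this[of "-2"] show ?thesis by simp
    qed
    also have "\<dots> \<le> (15 * K0) * (1 + \<bar>of_int k\<bar>)"
      using K0 by (simp add: algebra_simps)
    finally show ?thesis .
  qed
  then show ?thesis using K0 by (intro that[of "15 * K0"]) auto
qed

text \<open>The slab is covered by 2 n + 1 unit slabs, each contributing at most the square of a
  linear bound by the passage from L1 to L2.\<close>

lemma L2_growth:
  assumes h: "harm f g" and K: "K \<ge> 0"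
    and L1_bound: "\<And>k::int. (L1 f (of_int k) 2) \<le> K * (1 + \<bar>of_int k\<bar>)"
  obtains C where "C \<ge> 0" "\<And>n::nat. n \<ge> 1 \<Longrightarrow> (L2 f 0 (real n)) \<le> C * real n ^ 3"
proof -
  have cf: "continuous_on X f" using h by (auto simp: harm_def potential_def)
  then have c2: "continuous_on X (\<lambda>x. (f x)\<^sup>2)" by (intro continuous_intros)
  obtain C where C: "C \<ge> 0" "\<And>c. (L2 f c 1) \<le> C * (L1 f c 2)\<^sup>2"
    using L1_L2_estimate h by metis
  have "(L2 f 0 (real n)) \<le> (12 * C * K\<^sup>2) * real n ^ 3" if n: "n \<ge> 1" for n :: nat
  proof -
    let ?I = "{- int n..int n}"
    have int: "integrable lborel (\<lambda>x. indicator (slab c r) x *\<^sub>R (f x)\<^sup>2)" for c r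
      using set_integrable_slab[OF c2, of c r] unfolding set_integrable_def .
    have "(L2 f 0 (real n)) \<le> integral\<^sup>L lborel (\<lambda>x. \<Sum>k\<in>?I. indicator (slab (of_int k) 1) x *\<^sub>R (f x)\<^sup>2)"
      unfolding set_lebesgue_integral_def
    proof (rule integral_mono[OF int])
      show "integrable lborel (\<lambda>x. \<Sum>k\<in>?I. indicator (slab (of_int k) 1) x *\<^sub>R (f x)\<^sup>2)" by (intro Bochner_Integration.integrable_sum int)
      fix x
      show "indicator (slab 0 (real n)) x *\<^sub>R (f x)\<^sup>2 \<le> (\<Sum>k\<in>?I. indicator (slab (of_int k) 1) x *\<^sub>R (f x)\<^sup>2)"
      proof (cases "x \<in> slab 0 (real n)")
        case True
        define k where "k = \<lfloor>fst x\<rfloor>"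
        have x: "x \<in> Om" "\<bar>fst x\<bar> < real n" using True by (auto simp: slab_def)
        have "k \<in> ?I" using x(2) unfolding k_def by (auto simp: le_floor_iff floor_le_iff abs_less_iff)
        moreover have "\<bar>fst x - of_int k\<bar> < 1" unfolding k_def by linarith
        then have "indicator (slab (of_int k) 1) x *\<^sub>R (f x)\<^sup>2 = (f x)\<^sup>2" using x by (simp add: slab_def)
        ultimately have "(f x)\<^sup>2 \<le> (\<Sum>k\<in>?I. indicator (slab (of_int k) 1) x *\<^sub>R (f x)\<^sup>2)"
          by (metis (no_types, lifting) finite_atLeastAtMost_int member_le_sum scaleR_nonneg_nonneg indicator_pos_le zero_le_power2)
        then show ?thesis using True by simp
      qed (auto intro!: sum_nonneg)
    qed
    also have "\<dots> = (\<Sum>k\<in>?I. LINT x:slab (of_int k) 1|lborel. (f x)\<^sup>2)"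
      unfolding set_lebesgue_integral_def by (intro Bochner_Integration.integral_sum int)
    also have "\<dots> \<le> (\<Sum>k\<in>?I. C * (K * (2 * real n))\<^sup>2)"
    proof (rule sum_mono)
      fix k :: int assume k: "k \<in> ?I"
      have "\<bar>k\<bar> \<le> int n" using k by auto
      then have "\<bar>of_int k\<bar> \<le> (real n)" by (metis of_int_abs of_int_le_iff of_int_of_nat_eq)
      then have "1 + \<bar>of_int k\<bar> \<le> 2 * real n" using n by linarith
      then have "K * (1 + \<bar>of_int k\<bar>) \<le> K * (2 * real n)" using K by (intro mult_left_mono)
      then have "(L1 f (of_int k) 2) \<le> K * (2 * real n)" using L1_bound[of k] by linarith
      moreover have "0 \<le> (L1 f (of_int k) 2)"
        by (rule set_integral_nonneg_real) simp
      ultimately have "(L1 f (of_int k) 2)\<^sup>2 \<le> (K * (2 * real n))\<^sup>2" by (intro power_mono)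
      then have "C * (L1 f (of_int k) 2)\<^sup>2 \<le> C * (K * (2 * real n))\<^sup>2" using C by (intro mult_left_mono)
      then show "(L2 f (of_int k) 1) \<le> C * (K * (2 * real n))\<^sup>2" using C(2)[of "of_int k"] by linarith
    qed
    also have "\<dots> = (2 * real n + 1) * (C * (K * (2 * real n))\<^sup>2)" by simp
    also have "\<dots> \<le> (3 * real n) * (C * (K * (2 * real n))\<^sup>2)" using n C by (intro mult_right_mono) auto
    also have "\<dots> = (12 * C * K\<^sup>2) * real n ^ 3" by (simp add: power2_eq_square power3_eq_cube)
    finally show ?thesis .
  qed
  then show ?thesis using C by (intro that[of "12 * C * K\<^sup>2"]) auto
qed

lemma slab_integral_zero:
  fixes F :: "real \<times> 'a \<Rightarrow> real"
  assumes F: "continuous_on X F" "\<And>x. x \<in> X \<Longrightarrow> 0 \<le> F x" and z: "(LINT x:slab c r|lborel. F x) \<le> 0" and x: "x \<in> slab c r"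
  shows "F x = 0"
proof (rule ccontr)
  assume "F x \<noteq> 0"
  moreover have sX: "slab c r \<subseteq> X" using Om_subset_X by (auto simp: slab_def)
  ultimately have pos: "F x > 0" using F(2)[of x] x by force
  have "continuous_on (slab c r) F" using F(1) sX by (rule continuous_on_subset)
  then have "isCont F x" using open_slab x by (simp add: continuous_on_eq_continuous_at)
  then obtain d where d: "d > 0" "\<And>y. dist y x < d \<Longrightarrow> dist (F y) (F x) < F x / 2"
    using pos unfolding continuous_at_eps_delta by (metis half_gt_zero)
  obtain e where e: "e > 0" "ball x e \<subseteq> slab c r" using open_slab x open_contains_ball by blast
  define B where "B = ball x (min d e)"
  have "measure lborel B > 0" using d e by (simp add: B_def)
  have BS: "B \<subseteq> slab c r" using e by (auto simp: B_def)
  have big: "F y \<ge> F x / 2" if "y \<in> B" for y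
  proof -
    have "\<bar>F y - F x\<bar> < F x / 2" using d(2)[of y] that by (simp add: B_def dist_real_def dist_commute)
    then show ?thesis by linarith
  qed
  have "emeasure lborel B < \<infinity>" unfolding B_def by (rule emeasure_bounded_finite[OF bounded_ball])
  then have iB: "integrable lborel (\<lambda>y. indicator B y * (F x / 2))"
    by (intro integrable_mult_left integrable_real_indicator) (auto simp: B_def)
  have "measure lborel B * (F x / 2) = integral\<^sup>L lborel (\<lambda>y. indicator B y * (F x / 2))" by (simp add: B_def)
  also have "\<dots> \<le> (LINT x:slab c r|lborel. F x)"
    unfolding set_lebesgue_integral_def
    using set_integrable_slab[OF F(1), of c r] iB BS sX big F(2) unfolding set_integrable_def
    by (intro integral_mono) (auto simp: indicator_def)
  finally have "measure lborel B * (F x / 2) \<le> 0" using z by linarith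
  then show False using \<open>measure lborel B > 0\<close> pos by (simp add: mult_le_0_iff)
qed

subsection \<open>The Liouville theorem\<close>


text \<open>Axial segments never leave the cylinder, so the general shift estimate costs only a
  widening of the slab by m.\<close>

lemma shift_difference_L2:
  assumes p: "potential f g" and m: "m \<ge> \<bar>h\<bar>"
  shows "(LINT x:slab 0 r|lborel. (f (x + (h, 0)) - f x)\<^sup>2) \<le> h\<^sup>2 * (energy g 0 (r + m))"
proof -
  have pp: "continuous_on X f" "continuous_on X g" "\<And>x. x \<in> Om \<Longrightarrow> has_grad f x (g x)"
    using p by (auto simp: potential_def)
  have sO: "slab 0 s \<subseteq> Om" for s by (auto simp: slab_def)
  have c: "continuous_on X (\<lambda>x. (f (x + (h, 0)) - f x)\<^sup>2)" "continuous_on X (\<lambda>x. (norm (g x))\<^sup>2)"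
    by (intro continuous_intros continuous_on_X_shift pp)+
  have nn: "0 \<le> (energy g 0 s)" for s
    by (rule set_integral_nonneg_real) simp
  have seg: "x + \<tau> *\<^sub>R (h, 0) \<in> slab 0 (r + m)" if x: "x \<in> slab 0 r" and t: "\<tau> \<in> {0..1}" for x \<tau>
  proof -
    have "\<bar>\<tau> * h\<bar> \<le> 1 * m" unfolding abs_mult using t m by (intro mult_mono) auto
    then show ?thesis using x by (auto simp: slab_def Om_def mem_Times_iff)
  qed
  have "ennreal (LINT x:slab 0 r|lborel. (f (x + (h, 0)) - f x)\<^sup>2) \<le>
    ennreal ((norm (h, 0::'a))\<^sup>2) * ennreal (energy g 0 (r + m))"
    unfolding set_nn_integral_eq[OF set_integrable_slab[OF c(1)] zero_le_power2, symmetric]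
      set_nn_integral_eq[OF set_integrable_slab[OF c(2)] zero_le_power2, symmetric]
    by (rule shift_L2_estimate[OF slab_borel open_slab seg])
      (use pp(3) sO continuous_on_subset[OF pp(2) subset_trans[OF sO Om_subset_X]] in auto)
  also have "\<dots> = ennreal (h\<^sup>2 * (energy g 0 (r + m)))"
    using nn by (simp add: ennreal_mult norm_Pair)
  finally show ?thesis using nn by (subst (asm) ennreal_le_iff) auto
qed

text \<open>On the slab of half-width n the energy of the potential is O(n), hence a shift difference has squared L2 norm O(n)
  and, by Caccioppoli once more, energy O(1/n).\<close>

lemma velocity_translation_invariant:
  assumes h: "harm f g" and C: "C \<ge> 0"
    and L2_bound: "\<And>n::nat. n \<ge> 1 \<Longrightarrow> (L2 f 0 (real n)) \<le> C * real n ^ 3"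
    and x: "x \<in> Om"
  shows "g (x + (t, 0)) = g x"
proof -
  have pp: "continuous_on X f" "continuous_on X g" "potential f g"
    using h by (auto simp: harm_def potential_def)
  \<comment> \<open>Caccioppoli between the half-widths n and 2 n; the constant is 2048 = 256 * 2^3
    because the cubic bound is used at 2 n.\<close>
  have energy: "(energy g 0 (real n)) \<le> 2048 * C * real n" if n: "n \<ge> 1" for n :: nat
  proof -
    have "(energy g 0 (real n)) \<le> 256 / (real n)\<^sup>2 * (L2 f 0 (real n + real n))"
      using n by (intro caccioppoli[OF h]) auto
    also have "(L2 f 0 (real n + real n)) \<le> C * (real n + real n) ^ 3"
      using L2_bound[of "n + n"] n by simp
    also have "256 / (real n)\<^sup>2 * (C * (real n + real n) ^ 3) = 2048 * C * real n"
      using n by (simp add: field_simps power2_eq_square power3_eq_cube)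
    finally show ?thesis by (simp add: divide_right_mono)
  qed
  let ?z = "\<lambda>x. f (x + (t, 0)) - f x" and ?w = "\<lambda>x. g (x + (t, 0)) - g x"
  have hz: "harm ?z ?w" by (rule harm_shift_diff[OF h])
  obtain m :: nat where m: "real m \<ge> \<bar>t\<bar>" using real_arch_simple by blast
  have cw: "continuous_on X (\<lambda>x. (norm (?w x))\<^sup>2)"
    by (intro continuous_intros continuous_on_X_shift pp)
  define D where "D = 256 * t\<^sup>2 * (2048 * C)"
  have D: "D \<ge> 0" using C by (simp add: D_def)
  have decay: "(energy ?w 0 (real n)) \<le> D * ((2 + real m) / real n)" if n: "n \<ge> 1" for n :: nat
  proof -
    have "(L2 ?z 0 (real n + real n)) \<le> t\<^sup>2 * (energy g 0 (real n + real n + real m))"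
      by (rule shift_difference_L2[OF pp(3) m])
    also have "\<dots> \<le> t\<^sup>2 * (2048 * C * real (n + n + m))"
      using energy[of "n + n + m"] n by (intro mult_left_mono) auto
    finally have z: "(L2 ?z 0 (real n + real n)) \<le> t\<^sup>2 * (2048 * C * real (n + n + m))" .
    have "(energy ?w 0 (real n)) \<le> 256 / (real n)\<^sup>2 * (L2 ?z 0 (real n + real n))"
      using n by (intro caccioppoli[OF hz]) auto
    also have "\<dots> \<le> 256 / (real n)\<^sup>2 * (t\<^sup>2 * (2048 * C * real (n + n + m)))"
      using z by (intro mult_left_mono) auto
    also have "\<dots> = D * (real (n + n + m) / (real n)\<^sup>2)" by (simp add: D_def)
    also have "\<dots> \<le> D * ((2 + real m) / real n)"
    proof (rule mult_left_mono[OF _ D])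
      have "real m * 1 \<le> real m * real n" using n by (intro mult_left_mono) auto
      then have "real (n + n + m) \<le> (2 + real m) * real n" by (simp add: algebra_simps)
      then have "real (n + n + m) / (real n)\<^sup>2 \<le> (2 + real m) * real n / (real n)\<^sup>2" by (rule divide_right_mono) simp
      then show "real (n + n + m) / (real n)\<^sup>2 \<le> (2 + real m) / real n" using n by (simp add: power2_eq_square)
    qed
    finally show ?thesis .
  qed
  obtain k :: nat where k: "\<bar>fst x\<bar> < real k" using reals_Archimedean2 by blast
  \<comment> \<open>The slab of half-width k is fixed and contained in all larger ones, whose
    energies tend to zero.\<close>
  have "(energy ?w 0 (real k)) \<le> 0"
  proof (rule LIMSEQ_le_const)
    have "(\<lambda>n. D * ((2 + real m) / real n)) \<longlonglongrightarrow> D * 0"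
      by (intro tendsto_mult tendsto_const lim_const_over_n)
    then show "(\<lambda>n. D * ((2 + real m) / real n)) \<longlonglongrightarrow> 0" by simp
    have "(energy ?w 0 (real k)) \<le> D * ((2 + real m) / real n)" if n: "n \<ge> max 1 k" for n
    proof -
      have "(energy ?w 0 (real k)) \<le> (energy ?w 0 (real n))"
        using n by (intro slab_integral_mono_set[OF cw] slab_borel slab_mono order_refl) auto
      then show ?thesis using decay[of n] n by simp
    qed
    then show "\<exists>N. \<forall>n\<ge>N. (energy ?w 0 (real k)) \<le> D * ((2 + real m) / real n)" by blast
  qed
  moreover have "x \<in> slab 0 (real k)" using k x by (simp add: slab_def)
  ultimately have "(norm (?w x))\<^sup>2 = 0" by (intro slab_integral_zero[OF cw]) auto
  then show ?thesis by simp
qed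

text \<open>Once g is invariant along the axis, f(x + t e1) - f(x) has zero gradient in x and is
  constant on the connected cylinder; differentiating at t = 0 shows that the axial component of g
  is the same everywhere. After subtraction of b x1 the remaining gradient w is transversal, hence
  orthogonal to the gradient of an axial cut-off, so no error term from the cut-off arises.\<close>

theorem liouville:
  assumes h: "harm f g" and \<sigma>: "\<sigma> = 1 \<or> \<sigma> = (-1::real)" and C: "C \<ge> 0"
    and right: "\<And>x. x \<in> X \<Longrightarrow> fst x \<ge> 0 \<Longrightarrow> \<sigma> * f x \<ge> - C"
    and left: "\<And>x. x \<in> X \<Longrightarrow> fst x \<le> 0 \<Longrightarrow> - \<sigma> * f x \<ge> - C"
    and conn: "connected \<omega>" and ne: "\<omega> \<noteq> {}"
  obtains b where "\<And>x. x \<in> Om \<Longrightarrow> g x = (b, 0)"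
proof -
  have pp: "continuous_on X f" "continuous_on X g" "\<And>x. x \<in> Om \<Longrightarrow> has_grad f x (g x)" "solenoidal g"
    using h by (auto simp: harm_def potential_def)
  obtain K where K: "K \<ge> 0" "\<And>k::int. (L1 f (of_int k) 2) \<le> K * (1 + \<bar>of_int k\<bar>)"
    by (rule L1_growth[OF h \<sigma> C right left]) blast+
  obtain C2 where C2: "C2 \<ge> 0" "\<And>n::nat. n \<ge> 1 \<Longrightarrow> (L2 f 0 (real n)) \<le> C2 * real n ^ 3"
    using L2_growth[OF h K] by blast
  have inv: "g (x + (t, 0)) = g x" if "x \<in> Om" for x t
    by (rule velocity_translation_invariant[OF h C2 that])
  have conO: "connected Om" unfolding Om_def using conn by (intro connected_Times) auto
  obtain y0 where "y0 \<in> \<omega>" using ne by blast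
  then have x0: "(0, y0) \<in> Om" by (simp add: Om_def)
  define b where "b = fst (g (0, y0))"
  have fstb: "fst (g x) = b" if x: "x \<in> Om" for x
  proof -
    have const: "f (x + (t, 0)) - f x = f ((0, y0) + (t, 0)) - f (0, y0)" for t
    proof (rule has_derivative_zero_unique_connected[OF open_Om conO _ x x0, of "\<lambda>x. f (x + (t, 0)) - f x"])
      fix z assume z: "z \<in> Om"
      have "has_grad (\<lambda>x. f (x + (t, 0)) - f x) z (g (z + (t, 0)) - g z)"
        using harm_shift_diff[OF h, of t] z by (simp add: harm_def potential_def)
      then show "((\<lambda>x. f (x + (t, 0)) - f x) has_derivative (\<lambda>x. 0)) (at z)"
        by (simp add: inv[OF z] has_grad_def)
    qed
    have d: "((\<lambda>t. f (z + (t, 0))) has_real_derivative fst (g z)) (at 0)" if "z \<in> Om" for z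
    proof -
      have "has_grad f (z + 0 *\<^sub>R (1, 0)) (g z)" using pp(3)[OF that] by (simp del: scaleR_Pair)
      from has_grad_line[OF this] show ?thesis by (simp add: inner_prod_def)
    qed
    have "(\<lambda>t. f (x + (t, 0))) = (\<lambda>t. f ((0, y0) + (t, 0)) + (f x - f (0, y0)))"
      using const by (simp add: fun_eq_iff algebra_simps)
    moreover have "((\<lambda>t. f ((0, y0) + (t, 0)) + (f x - f (0, y0))) has_real_derivative fst (g (0, y0)) + 0) (at 0)"
      by (intro DERIV_add d x0 DERIV_const)
    ultimately have "((\<lambda>t. f (x + (t, 0))) has_real_derivative b) (at 0)" by (simp only: b_def add_0_right)
    then show ?thesis using DERIV_unique[OF d[OF x]] by blast
  qed
  define G where "G x = f x - b * fst x" for x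
  define w where "w x = g x - (b, 0)" for x
  have cG: "continuous_on X G" "continuous_on X w" unfolding G_def w_def by (intro continuous_intros pp)+
  have gG: "has_grad G x (w x)" if "x \<in> Om" for x
  proof -
    have "has_grad (\<lambda>x::real \<times> 'a. b * fst x) x (b *\<^sub>R (1, 0))"
      by (rule has_grad_compose[OF has_grad_fst]) (auto intro!: derivative_eq_intros)
    from has_grad_diff[OF pp(3)[OF that] this] show ?thesis by (simp add: G_def[abs_def] w_def)
  qed
  have w0: "fst (w x) = 0" if "x \<in> Om" for x using fstb[OF that] by (simp add: w_def)
  have "w x = 0" if x: "x \<in> Om" for x
  proof -
    obtain e e' where e: "\<And>t. (e has_real_derivative e' t) (at t)" "continuous_on UNIV e'"
      "\<And>t. 0 \<le> e t" "\<And>t. \<bar>t - fst x\<bar> \<le> 1 \<Longrightarrow> e t = 1"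
      "\<And>t. \<bar>t - fst x\<bar> \<ge> 1 + 1 \<Longrightarrow> e t = 0" "\<And>t. \<bar>t - fst x\<bar> \<ge> 1 + 1 \<Longrightarrow> e' t = 0"
      using cutoff_exists[of 1 1 "fst x"] by (metis zero_less_one zero_le_one)
    have ce: "continuous_on UNIV e"
      by (rule continuous_at_imp_continuous_on) (use DERIV_isCont[OF e(1)] in blast)
    have cE: "continuous_on S (\<lambda>x. e (fst x))" "continuous_on S (\<lambda>x. e' (fst x))" for S :: "(real \<times> 'a) set"
      by (intro continuous_fst_comp ce e)+
    have far: "\<bar>s - fst x\<bar> \<ge> 1 + 1" if "\<bar>s\<bar> > \<bar>fst x\<bar> + 2" for s :: real using that by linarith
    let ?\<phi>' = "\<lambda>x. e (fst x) *\<^sub>R w x + G x *\<^sub>R (e' (fst x) *\<^sub>R (1, 0))"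
    have t: "test (\<lambda>x. e (fst x) * G x) ?\<phi>'"
      unfolding test_def
    proof (intro conjI ballI exI[of _ "\<bar>fst x\<bar> + 2"] impI)
      show "has_grad (\<lambda>x. e (fst x) * G x) z (?\<phi>' z)" if "z \<in> Om" for z
        by (rule has_grad_mult[OF has_grad_compose[OF has_grad_fst e(1)] gG[OF that]])
    qed (use far e(5,6) in \<open>auto intro!: continuous_intros cE cG simp: zero_prod_def\<close>)
    have i1: "(LINT x:Om|lborel. g x \<bullet> ?\<phi>' x) = 0" using pp(4) t unfolding solenoidal_def by blast
    have i2: "(LINT x:Om|lborel. (1, 0) \<bullet> ?\<phi>' x) = 0" using solenoidal_axis t unfolding solenoidal_def by blast
    have cS: "continuous_on X (\<lambda>x. e (fst x) * (norm (w x))\<^sup>2)" by (intro continuous_intros cE cG)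
    have iS: "set_integrable lborel Om (\<lambda>x. e (fst x) * (norm (w x))\<^sup>2)"
      by (rule integrable_slab_support[OF cS, of "\<bar>fst x\<bar> + 2"]) (use far e(5) in auto)
    \<comment> \<open>Splitting g into w and b times the axial field: against w only the term e
      |w|^2 survives because w is transversal, and the axial part integrates to zero by
      \<open>solenoidal_axis\<close>.\<close>
    have "indicator Om z *\<^sub>R (g z \<bullet> ?\<phi>' z) = indicator Om z *\<^sub>R (e (fst z) * (norm (w z))\<^sup>2 + b * ((1, 0) \<bullet> ?\<phi>' z))" for z
    proof (cases "z \<in> Om")
      case True
      have gz: "g z = w z + b *\<^sub>R (1, 0)" by (simp add: w_def)
      have "w z \<bullet> (1, 0) = 0" using w0[OF True] by (simp add: inner_prod_def)
      then have "w z \<bullet> ?\<phi>' z = e (fst z) * (norm (w z))\<^sup>2"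
        by (simp add: inner_add_right dot_square_norm del: scaleR_Pair)
      then show ?thesis unfolding gz inner_add_left inner_scaleR_left by simp
    qed simp
    then have "(LINT x:Om|lborel. g x \<bullet> ?\<phi>' x) = (LINT x:Om|lborel. e (fst x) * (norm (w x))\<^sup>2 + b * ((1, 0) \<bullet> ?\<phi>' x))"
      unfolding set_lebesgue_integral_def by (rule Bochner_Integration.integral_cong[OF refl])
    also have "\<dots> = (LINT x:Om|lborel. e (fst x) * (norm (w x))\<^sup>2) + (LINT x:Om|lborel. b * ((1, 0) \<bullet> ?\<phi>' x))"
      by (intro set_integral_add(2) iS set_integrable_mult_right impI test_integrable[OF t] continuous_on_const)
    finally have zero: "(LINT x:Om|lborel. e (fst x) * (norm (w x))\<^sup>2) = 0" using i1 i2 by simp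
    have c2: "continuous_on X (\<lambda>x. (norm (w x))\<^sup>2)" by (intro continuous_intros cG)
    have "(energy w (fst x) 1) \<le> (LINT x:Om|lborel. e (fst x) * (norm (w x))\<^sup>2)"
      unfolding set_lebesgue_integral_def
      using set_integrable_slab[OF c2, of "fst x" 1] iS e(3,4) unfolding set_integrable_def
      by (intro integral_mono) (auto simp: indicator_def slab_def)
    then have "(norm (w x))\<^sup>2 = 0"
      by (intro slab_integral_zero[OF c2, of "fst x" 1]) (use zero x in \<open>auto simp: slab_def\<close>)
    then show ?thesis by simp
  qed
  then show ?thesis by (intro that[of b]) (simp add: w_def)
qed

end

subsection \<open>The pressure\<close>

text \<open>The test field is a bump times the fixed vector \<open>g x0\<close>. Near x0 the product
  of g with this vector is positive, so the integrand is nonnegative with integral zero; on a small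
  box it is continuous and must vanish, although it is positive at x0.\<close>

lemma fundamental_lemma_C1c:
  fixes \<Omega> :: "'a::euclidean_space set"
  assumes op: "open \<Omega>" and cg: "continuous_on \<Omega> g"
    and weak: "\<And>\<phi> D\<phi>. C1c_test \<Omega> \<phi> D\<phi> \<Longrightarrow> ((\<lambda>x. g x \<bullet> \<phi> x) has_integral 0) \<Omega>"
    and x0: "x0 \<in> \<Omega>"
  shows "g x0 = 0"
proof (rule ccontr)
  define u where "u = g x0"
  assume "g x0 \<noteq> 0"
  then have u: "u \<bullet> u > 0" by (simp add: u_def)
  have "isCont (\<lambda>x. g x \<bullet> u) x0"
    using cg op x0 by (intro continuous_intros) (simp add: continuous_on_eq_continuous_at)
  then have "\<forall>\<^sub>F x in nhds x0. g x \<bullet> u > 0"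
    using u by (intro order_tendstoD(1)[of _ "g x0 \<bullet> u"]) (auto simp: isCont_def tendsto_nhds_iff u_def)
  then obtain S where S: "open S" "x0 \<in> S" "\<And>x. x \<in> S \<Longrightarrow> g x \<bullet> u > 0" unfolding eventually_nhds by blast
  obtain r where r: "r > 0" "cball x0 r \<subseteq> \<Omega> \<inter> S"
    using open_contains_cball[of "\<Omega> \<inter> S"] op S x0 by blast
  obtain \<beta> \<beta>' where b: "\<And>y. has_grad \<beta> y (\<beta>' y)" "continuous_on UNIV \<beta>'"
    "\<And>y. \<beta> y \<ge> 0" "\<And>y. y \<in> ball x0 r \<Longrightarrow> \<beta> y > 0" "\<And>y. dist x0 y \<ge> r \<Longrightarrow> \<beta> y = 0 \<and> \<beta>' y = 0"
    using bump_exists[OF r(1), of x0] by metis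
  define D where "D x = blinfun_scaleR_left u o\<^sub>L blinfun_inner_right (\<beta>' x)" for x
  have cbeta: "continuous_on A \<beta>" for A
    using b(1) has_grad_continuous continuous_at_imp_continuous_on by blast
  have "C1c_test \<Omega> (\<lambda>x. \<beta> x *\<^sub>R u) D"
    unfolding C1c_test_def
  proof (intro conjI allI)
    show "((\<lambda>x. \<beta> x *\<^sub>R u) has_derivative blinfun_apply (D x)) (at x)" for x
      by (rule has_derivative_eq_rhs[OF has_derivative_scaleR_left[OF has_gradD[OF b(1)]]]) (simp add: D_def fun_eq_iff)
    show "continuous_on UNIV D" unfolding D_def
      by (intro continuous_intros bounded_linear.continuous_on[OF bounded_linear_blinfun_inner_right] b(2))
    have "{x. \<beta> x *\<^sub>R u \<noteq> 0} \<subseteq> cball x0 r"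
      using b(5) by (auto simp: not_le[symmetric]) (meson less_imp_le not_le)
    then have cl: "closure {x. \<beta> x *\<^sub>R u \<noteq> 0} \<subseteq> cball x0 r" by (intro closure_minimal) auto
    then show "closure {x. \<beta> x *\<^sub>R u \<noteq> 0} \<subseteq> \<Omega>" using r(2) by auto
    show "compact (closure {x. \<beta> x *\<^sub>R u \<noteq> 0})"
      using cl by (meson bounded_cball bounded_subset closed_closure compact_eq_bounded_closed)
  qed
  from weak[OF this] have I: "((\<lambda>x. \<beta> x * (g x \<bullet> u)) has_integral 0) \<Omega>" by simp
  have F0: "0 \<le> \<beta> x * (g x \<bullet> u)" for x
  proof (cases "dist x0 x < r")
    case True
    then have "g x \<bullet> u > 0" using r(2) by (intro S(3)) auto
    then show ?thesis using b(3)[of x] by simp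
  qed (use b(5)[of x] in simp)
  obtain p q where pq: "cbox p q \<subseteq> \<Omega>" "x0 \<in> box p q" using open_contains_cbox[OF op x0] by metis
  have cF: "continuous_on (cbox p q) (\<lambda>x. \<beta> x * (g x \<bullet> u))"
    by (intro continuous_intros cbeta continuous_on_subset[OF cg pq(1)])
  then have i: "(\<lambda>x. \<beta> x * (g x \<bullet> u)) integrable_on cbox p q" by (rule integrable_continuous)
  have "integral (cbox p q) (\<lambda>x. \<beta> x * (g x \<bullet> u)) \<le> integral \<Omega> (\<lambda>x. \<beta> x * (g x \<bullet> u))"
    using I F0 by (intro integral_subset_le pq i) (auto simp: has_integral_integrable)
  also have "\<dots> = 0" using I by (rule integral_unique)
  finally have "integral (cbox p q) (\<lambda>x. \<beta> x * (g x \<bullet> u)) = 0"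
    using integral_nonneg[OF i] F0 by (intro antisym) auto
  then have "((\<lambda>x. \<beta> x * (g x \<bullet> u)) has_integral 0) (cbox p q)" using i by (metis integrable_integral)
  then have "\<beta> x0 * (g x0 \<bullet> u) = 0"
    using cF F0 pq(2) subsetD[OF box_subset_cbox pq(2)]
    by (intro has_integral_0_cbox_imp_0[of p q "\<lambda>x. \<beta> x * (g x \<bullet> u)"]) auto
  moreover have "\<beta> x0 > 0" using b(4)[of x0] r by simp
  ultimately show False using u by (simp add: u_def)
qed

theorem theorem1p1:
  fixes \<omega> :: "'a::euclidean_space set"
    and v :: "real \<times> 'a \<Rightarrow> real \<times> 'a"
    and Dv :: "real \<times> 'a \<Rightarrow> (real \<times> 'a) \<Rightarrow>\<^sub>L (real \<times> 'a)"
    and p :: "real \<times> 'a \<Rightarrow> real"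
    and gp :: "real \<times> 'a \<Rightarrow> real \<times> 'a"
    and \<psi> :: "real \<times> 'a \<Rightarrow> real"
  assumes omega: "bounded \<omega>" "connected \<omega>" "C1_domain \<omega>"
    and p_C1: "\<forall>x\<in>UNIV \<times> \<omega>. has_grad p x (gp x)" "continuous_on (UNIV \<times> \<omega>) gp"
    and v_C1: "\<forall>x\<in>UNIV \<times> \<omega>. (v has_derivative blinfun_apply (Dv x)) (at x)"
              "continuous_on (UNIV \<times> \<omega>) Dv"
    and v_cont: "continuous_on (closure (UNIV \<times> \<omega>)) v"
    and equations:
      "(\<forall>x\<in>UNIV \<times> \<omega>. blinfun_apply (Dv x) (v x) + gp x = 0)
       \<or> (\<exists>\<mu>>0. \<forall>\<phi> D\<phi>. C1c_test (UNIV \<times> \<omega>) \<phi> D\<phi> \<longrightarrow>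
            ((\<lambda>x. - \<mu> * (\<Sum>b\<in>Basis. blinfun_apply (Dv x) b \<bullet> blinfun_apply (D\<phi> x) b)
                   + (blinfun_apply (Dv x) (v x) + gp x) \<bullet> \<phi> x) has_integral 0) (UNIV \<times> \<omega>))"
    and div_free: "\<forall>x\<in>UNIV \<times> \<omega>. div_of (Dv x) = 0"
    and slip: "\<forall>t y \<nu>. y \<in> frontier \<omega> \<and> outward_normal \<omega> y \<nu> \<longrightarrow> v (t, y) \<bullet> (0, \<nu>) = 0"
    and potential: "\<forall>x\<in>UNIV \<times> \<omega>. has_grad \<psi> x (v x)" "continuous_on (closure (UNIV \<times> \<omega>)) \<psi>"
    and nonstag: "(INF x\<in>closure (UNIV \<times> \<omega>). norm (v x)) > 0"
  shows "\<exists>a. a \<noteq> 0 \<and> (\<forall>x\<in>closure (UNIV \<times> \<omega>). v x = (a, 0)) \<and>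
             (\<exists>c. \<forall>x\<in>UNIV \<times> \<omega>. p x = c)"
proof (cases "\<omega> = {}")
  case True
  \<comment> \<open>The cylinder and its closure are empty, so any nonzero number serves.\<close>
  then show ?thesis by (intro exI[of _ 1]) auto
next
  case False
  obtain \<Theta> \<Theta>' where T: "\<And>y. has_grad \<Theta> y (\<Theta>' y)" "continuous_on UNIV \<Theta>'" "\<omega> = {y. \<Theta> y < 0}"
    "\<And>y. y \<in> frontier \<omega> \<Longrightarrow> \<Theta>' y \<noteq> 0"
    "\<And>y w. y \<in> frontier \<omega> \<Longrightarrow> (\<And>\<nu>. outward_normal \<omega> y \<nu> \<Longrightarrow> w \<bullet> \<nu> = 0) \<Longrightarrow> w \<bullet> \<Theta>' y = 0"
    using C1_domain_defining_function[OF omega(3,1)] by blast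
  interpret cylinder \<omega> \<Theta> \<Theta>'
    by (rule cylinder.intro[OF T(1-4) omega(1)])
  have OmE: "UNIV \<times> \<omega> = Om" by (simp add: Om_def)
  have XE: "closure (UNIV \<times> \<omega>) = X" unfolding OmE by (rule closure_Om)
  note v' = v_C1[unfolded OmE] v_cont[unfolded XE] and psi' = potential[unfolded XE, unfolded OmE]
  note p' = p_C1[unfolded OmE]
  define \<delta> where "\<delta> = (INF x\<in>X. norm (v x))"
  have d: "\<delta> > 0" using nonstag unfolding XE \<delta>_def .
  have speed: "norm (v x) \<ge> \<delta>" if "x \<in> X" for x
    unfolding \<delta>_def by (rule cINF_lower[OF _ that]) (auto intro: bdd_belowI[of _ 0])
  \<comment> \<open>The slip condition speaks of unit normals; the last property of the defining
    function transfers it to \<open>\<Theta>'\<close>.\<close>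
  have tan: "v x \<bullet> (0, \<Theta>' (snd x)) = 0" if "snd x \<in> frontier \<omega>" for x
  proof -
    have "snd (v x) \<bullet> \<Theta>' (snd x) = 0"
    proof (rule T(5)[OF that])
      fix \<nu> assume "outward_normal \<omega> (snd x) \<nu>"
      then have "v (fst x, snd x) \<bullet> (0, \<nu>) = 0" using slip that by blast
      then show "snd (v x) \<bullet> \<nu> = 0" by (simp add: inner_prod_def)
    qed
    then show ?thesis by (simp add: inner_prod_def)
  qed
  have "solenoidal v"
    by (rule tangential_solenoidal[of v Dv]) (use v' div_free[unfolded OmE] tan in auto)
  then have harm: "harm \<psi> v" unfolding harm_def potential_def using psi' v'(3) by blast
  interpret potential_flow \<omega> \<Theta> \<Theta>' v \<psi> \<delta>
    by unfold_locales (use v'(3) psi' d speed tan in auto)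
  obtain C \<sigma> where one: "\<sigma> = 1 \<or> \<sigma> = (-1::real)" "C \<ge> 0" "\<And>x. x \<in> X \<Longrightarrow> fst x \<ge> 0 \<Longrightarrow> \<sigma> * \<psi> x \<ge> - C"
    "\<And>x. x \<in> X \<Longrightarrow> fst x \<le> 0 \<Longrightarrow> - \<sigma> * \<psi> x \<ge> - C"
    by (rule one_signed_on_halves[OF omega(2) False]) blast+
  obtain a where a: "\<And>x. x \<in> Om \<Longrightarrow> v x = (a, 0)"
    by (rule liouville[OF harm one omega(2) False]) blast+
  have aX: "v x = (a, 0)" if "x \<in> X" for x
    by (rule continuous_constant_on_closure[of Om v]) (use v'(3) a that closure_Om in auto)
  obtain y0 where "y0 \<in> \<omega>" using False by blast
  then have x0: "(0, y0) \<in> Om" by (simp add: Om_def)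
  have "a \<noteq> 0"
  proof
    assume "a = 0"
    then show False using speed[of "(0, y0)"] a[OF x0] d x0 Om_subset_X by (auto simp: zero_prod_def[symmetric])
  qed
  have Dv0: "blinfun_apply (Dv x) h = 0" if x: "x \<in> Om" for x h
  proof -
    have "((\<lambda>_. (a, 0)) has_derivative blinfun_apply (Dv x)) (at x)"
      by (rule has_derivative_transform_within_open[of v _ _ _ Om]) (use v'(1) x open_Om a in auto)
    then have "blinfun_apply (Dv x) = (\<lambda>h. 0)" by (rule has_derivative_unique) simp
    then show ?thesis by simp
  qed
  \<comment> \<open>The velocity is constant, so inertial and viscous terms vanish. In the Euler
    case the pressure gradient is zero at once; in the viscous case it is weakly zero against all C1
    fields of compact support, hence zero by continuity.\<close>
  have gp0: "gp x = 0" if x: "x \<in> Om" for x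
    using equations[unfolded OmE]
  proof
    assume "\<forall>x\<in>Om. blinfun_apply (Dv x) (v x) + gp x = 0"
    then have "blinfun_apply (Dv x) (v x) + gp x = 0" using x by blast
    then show ?thesis by (simp add: Dv0[OF x])
  next
    assume "\<exists>\<mu>>0. \<forall>\<phi> D\<phi>. C1c_test Om \<phi> D\<phi> \<longrightarrow>
      ((\<lambda>x. - \<mu> * (\<Sum>b\<in>Basis. blinfun_apply (Dv x) b \<bullet> blinfun_apply (D\<phi> x) b)
             + (blinfun_apply (Dv x) (v x) + gp x) \<bullet> \<phi> x) has_integral 0) Om"
    then obtain \<mu> where mu: "\<And>\<phi> D\<phi>. C1c_test Om \<phi> D\<phi> \<Longrightarrow>
      ((\<lambda>x. - \<mu> * (\<Sum>b\<in>Basis. blinfun_apply (Dv x) b \<bullet> blinfun_apply (D\<phi> x) b)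
             + (blinfun_apply (Dv x) (v x) + gp x) \<bullet> \<phi> x) has_integral 0) Om" by blast
    show ?thesis
    proof (rule fundamental_lemma_C1c[OF open_Om p'(2) _ x])
      fix \<phi> D\<phi> assume t: "C1c_test Om \<phi> D\<phi>"
      show "((\<lambda>x. gp x \<bullet> \<phi> x) has_integral 0) Om"
        by (rule has_integral_eq[OF _ mu[OF t]]) (simp add: Dv0)
    qed
  qed
  have conO: "connected Om" unfolding Om_def using omega(2) by (intro connected_Times) auto
  have "p x = p (0, y0)" if "x \<in> Om" for x
  proof (rule has_derivative_zero_unique_connected[OF open_Om conO _ that x0])
    show "(p has_derivative (\<lambda>x. 0)) (at z)" if "z \<in> Om" for z
      using p'(1) that gp0[OF that] by (auto simp: has_grad_def)
  qed
  then show ?thesis using \<open>a \<noteq> 0\<close> aX unfolding OmE[symmetric] XE[symmetric] by blast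
qed

end
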